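(* Consider the initial value problem $\frac{d\mathbf{y}}{dt}=\mathbf{f}(\mathbf{y},t)+\mathbf{g}(\mathbf{y},t)$ on $[0,T]$ in $\mathbb{R}^N$, with exact solution $\mathbf{y}(t)$. Let an IMEX Runge–Kutta method with an ESDIRK scheme (coefficients $a_{ij},\tilde a_{ij},b_i,c_i,\gamma$, see context) be of order $p$. Let $\mathcal{F}(\mathbf{r},\mathbf{y}_n,\theta,t;\mathbf{g})$ be an implicit step filter, with associated bound $\theta_B$, which for $\theta\in[0,\theta_B]$ has continuous partial derivatives in $t$ and $\mathbf{r}$ up to order $p$. Suppose that all the partial derivatives of $\mathbf{g}$ and $\mathbf{f}$ with respect to $t$ and $\mathbf{y}$ up to order $p$ exist and are continuous, and that there is a neighborhood of the exact solution $(\mathbf{y}(t),t)$ in which both $\mathbf{g}$ and $\mathbf{f}$ are Lipschitz continuous. Then the SIMEX-RK method (the algorithm given in the context) converges globally with order $p$; that is, the global error of the method is $O(h^p)$ as $h\to 0$.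
   Context: **Tableau.** An IMEX-RK method with an ESDIRK scheme with $s$ stages is given by real coefficients $a_{ij}$ (implicit part), $\tilde a_{ij}$ (explicit part), $b_i$, $c_i$, $1\le i,j\le s$, where $a_{11}=0$, $a_{ii}=\gamma>0$ for $i=2,\dots,s$, $a_{ij}=0$ for $j>i$, $\tilde a_{ij}=0$ for $j\ge i$, $c_1=0$; the weights $b_i$ and nodes $c_i$ are the same in both parts. Applied exactly to a decomposition $\mathbf{y}'=\mathbf{F}+\mathbf{G}$ (explicit part $\mathbf{F}$, implicit part $\mathbf{G}$), it computes $\mathbf{Y}_i=\mathbf{y}_n+h\sum_{j=1}^{i}a_{ij}\mathbf{k}_j+h\sum_{j=1}^{i-1}\tilde a_{ij}\tilde{\mathbf{k}}_j$, $\mathbf{k}_i=\mathbf{G}(\mathbf{Y}_i,t_n+c_ih)$, $\tilde{\mathbf{k}}_i=\mathbf{F}(\mathbf{Y}_i,t_n+c_ih)$, $\mathbf{y}_{n+1}=\mathbf{y}_n+h\sum_{i=1}^s b_i(\mathbf{k}_i+\tilde{\mathbf{k}}_i)$. The method is of order $p$ if its coefficients satisfy the order conditions of partitioned (additive) Runge–Kutta methods up to order $p$, i.e. for every sufficiently smooth decomposition the local error after one step is $O(h^{p+1})$. **Implicit step filter.** Let $\mathcal{U},\mathcal{V},\mathcal{Y}$ be open sets of $\mathbb{R}^N$, $I_\theta=[0,\theta_M]$, $I_T=[0,T]$. A map $\mathcal{F}(\mathbf{r},\mathbf{y}_n,\theta,t;\mathbf{g}):\mathcal{U}\times \mathcal{Y}\times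 I_\theta\times I_T\times C^p(\mathcal{Y}\times I_T)\to\mathbb{R}^N$ is called an implicit step filter (or filter) if there is $\theta_B$, $0<\theta_B\le\theta_M$, such that: (1) $\mathcal{F}(\mathbf{r},\mathbf{y}_n,\theta,t;\mathbf{g})$ is defined for all $\theta\in[0,\theta_M]$ with the possible exception of a finite number of values; (2) $\mathcal{F}(\mathbf{0},\mathbf{y}_n,\theta,t;\mathbf{g})=\mathbf{0}$; (3) when $\theta=0$, $\mathcal{F}(\cdot,\mathbf{y}_n,0,t;\mathbf{g}):\mathcal{U}\to \mathcal{V}$ is the identity map; (4) all the partial derivatives $\partial^\rho\partial_t^m\partial_\theta^n\mathcal{F}$ with $0\le|\rho|+m\le p$ and $0\le n\le1$ (where $\partial^\rho$, $\rho$ a multi-index, denotes partial derivatives with respect to the components of $\mathbf{r}$) exist and are continuous functions of $\mathbf{r},\mathbf{y}_n,\theta,t$ for all $\theta\in[0,\theta_B]$; (5) $\mathcal{F}(\cdot,\mathbf{y}_n,\theta,t;\mathbf{g}):\mathcal{U}\to \mathcal{V}$ has an inverse $\mathcal{F}^{-1}(\cdot,\mathbf{y}_n,\theta,t;\mathbf{g}):\mathcal{V}\to \mathcal{U}$ for all $\theta\in[0,\theta_B]$. **SIMEX-RK algorithm (one step of size $h>0$ from $\mathbf{y}_n$ at time $t_n$).** Set $\mathbf{k}_1=\mathbf{g}(\mathbf{y}_n,t_n)$, $\tilde{\mathbf{k}}_1=\mathbf{f}(\mathbf{y}_n,t_n)$. For $i=2,\dots,s$ compute $\mathbf{d}=h\sum_{j=1}^{i-1}(a_{ij}\mathbf{k}_j+\tilde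 a_{ij}\tilde{\mathbf{k}}_j)$; $\eta=\mathcal{F}(\mathbf{d}+h\gamma\mathbf{k}_1,\mathbf{y}_n,h\gamma,t_n+c_ih;\mathbf{g})$; $\mathbf{k}_i=(\eta-\mathbf{d})/(h\gamma)$; $\tilde{\mathbf{k}}_i=\mathbf{f}(\mathbf{y}_n+\eta,t_n+c_ih)+\mathbf{g}(\mathbf{y}_n+\eta,t_n+c_ih)-\mathbf{k}_i$. Finally $\mathbf{y}_{n+1}=\mathbf{y}_n+h\sum_{i=1}^s b_i(\mathbf{k}_i+\tilde{\mathbf{k}}_i)$. **Global convergence of order $p$.** Starting from $\mathbf{y}_0=\mathbf{y}(0)$ and with $t_n=nh$, $h=T/M$, there are constants $C,h_0>0$ such that for all such $h\le h_0$ the numerical solution is defined and $\max_{0\le n\le M}\|\mathbf{y}_n-\mathbf{y}(t_n)\|\le C h^p$. The points $(\mathbf{y}(t),t)$, $t\in[0,T]$, lie in $\mathcal{Y}\times I_T$.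
   Formalization: The nodes are assumed to satisfy 0 ≤ c_i ≤ 1 (otherwise the first or last step evaluates F, f, g outside [0,T] and the numerical solution is undefined), and p ≥ 1; order conditions include those for time-dependent decompositions. *)

theory Defs
  imports "HOL-Analysis.Analysis"
begin

text \<open>
  The derivative is taken within the slice of \<open>D\<close> through \<open>x\<close>, so it is the usual
  partial derivative at interior points and one-sided at the end points of a closed interval
  (such as \<open>t = 0\<close>, \<open>t = T\<close> or \<open>\<theta> = 0\<close>). Values of \<open>\<psi>\<close> outside \<open>D\<close> are irrelevant.
\<close>

definition has_partial_derivative ::
    "'a::euclidean_space set \<Rightarrow> 'a \<Rightarrow> ('a \<Rightarrow> 'b::real_normed_vector) \<Rightarrow> ('a \<Rightarrow> 'b) \<Rightarrow> bool"
  where "has_partial_derivative D e \<phi> \<psi> \<longleftrightarrow>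
    (\<forall>x\<in>D. ((\<lambda>\<sigma>. \<phi> (x + \<sigma> *\<^sub>R e)) has_vector_derivative \<psi> x) (at 0 within {\<sigma>. x + \<sigma> *\<^sub>R e \<in> D}))"

text \<open>
  \<open>continuous_partial D [e\<^sub>1, \<dots>, e\<^sub>m] \<phi>\<close>: the iterated partial derivative of \<open>\<phi>\<close>, first
  along \<open>e\<^sub>1\<close> and last along \<open>e\<^sub>m\<close>, exists on \<open>D\<close> and is continuous there.
\<close>

primrec continuous_partial ::
    "'a::euclidean_space set \<Rightarrow> 'a list \<Rightarrow> ('a \<Rightarrow> 'b::real_normed_vector) \<Rightarrow> bool"
  where
    "continuous_partial D [] \<phi> \<longleftrightarrow> continuous_on D \<phi>"
  | "continuous_partial D (e # es) \<phi> \<longleftrightarrow>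
       (\<exists>\<psi>. has_partial_derivative D e \<phi> \<psi> \<and> continuous_partial D es \<psi>)"

definition C_upto ::
    "nat \<Rightarrow> 'a::euclidean_space set \<Rightarrow> ('a \<Rightarrow> 'b::real_normed_vector) \<Rightarrow> bool"
  where "C_upto p D \<phi> \<longleftrightarrow>
    (\<forall>es. set es \<subseteq> Basis \<and> length es \<le> p \<longrightarrow> continuous_partial D es \<phi>)"

record imex_tableau =
  stages :: nat
  impl :: "nat \<Rightarrow> nat \<Rightarrow> real"
  expl :: "nat \<Rightarrow> nat \<Rightarrow> real"
  weight :: "nat \<Rightarrow> real"
  node :: "nat \<Rightarrow> real"
  diag :: real

text \<open>Stages are numbered from 1; coefficients with other indices are never used.\<close>

definition imex_esdirk :: "imex_tableau \<Rightarrow> bool"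
  where "imex_esdirk tab \<longleftrightarrow>
    1 \<le> stages tab \<and>
    0 < diag tab \<and>
    impl tab 1 1 = 0 \<and>
    (\<forall>i\<in>{2..stages tab}. impl tab i i = diag tab) \<and>
    (\<forall>i\<in>{1..stages tab}. \<forall>j\<in>{1..stages tab}. i < j \<longrightarrow> impl tab i j = 0) \<and>
    (\<forall>i\<in>{1..stages tab}. \<forall>j\<in>{1..stages tab}. i \<le> j \<longrightarrow> expl tab i j = 0) \<and>
    node tab 1 = 0"

text \<open>
  Order conditions of the additive method
  \<open>Y\<^sub>i = y\<^sub>n + h (\<Sum>\<^sub>j a\<^sub>i\<^sub>j G(Y\<^sub>j, t\<^sub>n + c\<^sub>j h) + \<Sum>\<^sub>j a'\<^sub>i\<^sub>j F(Y\<^sub>j, t\<^sub>n + c\<^sub>j h))\<close>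
  with equal weights \<open>b\<^sub>i\<close>, applied to a nonautonomous decomposition
  \<open>y' = F(y, t) + G(y, t)\<close>. They are indexed by rooted trees whose vertices carry the label of
  the part, \<open>F\<close> (\<open>Explicit\<close>) or \<open>G\<close> (\<open>Implicit\<close>), that they stand for. A leaf \<open>Time\<close>
  stands for a differentiation with respect to \<open>t\<close>, i.e. for the equation \<open>t' = 1\<close> whose stage
  increments are \<open>c\<^sub>i h\<close>. If the row sums satisfy
  \<open>\<Sum>\<^sub>j a\<^sub>i\<^sub>j = \<Sum>\<^sub>j a'\<^sub>i\<^sub>j = c\<^sub>i\<close>, a \<open>Time\<close> leaf has the same weight as any other leaf and the
  conditions below are the usual ones for two-coloured trees. Trees are ordered here; reordering
  children does not change any of the quantities, so this only repeats conditions.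
\<close>

datatype part = Explicit | Implicit

datatype rk_tree = Time | Node part "rk_tree list"

fun tree_order :: "rk_tree \<Rightarrow> nat"
  where
    "tree_order Time = 1"
  | "tree_order (Node q ts) = 1 + (\<Sum>u\<leftarrow>ts. tree_order u)"

fun tree_density :: "rk_tree \<Rightarrow> nat"
  where
    "tree_density Time = 1"
  | "tree_density (Node q ts) = tree_order (Node q ts) * (\<Prod>u\<leftarrow>ts. tree_density u)"

fun stage_weight :: "imex_tableau \<Rightarrow> nat \<Rightarrow> rk_tree \<Rightarrow> real"
  where
    "stage_weight tab i Time = node tab i"
  | "stage_weight tab i (Node q ts) =
       (\<Sum>j=1..stages tab. (case q of Explicit \<Rightarrow> expl tab i j | Implicit \<Rightarrow> impl tab i j)
          * (\<Prod>u\<leftarrow>ts. stage_weight tab j u))"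

definition imex_order :: "imex_tableau \<Rightarrow> nat \<Rightarrow> bool"
  where "imex_order tab p \<longleftrightarrow>
    (\<forall>q ts. tree_order (Node q ts) \<le> p \<longrightarrow>
       (\<Sum>i=1..stages tab. weight tab i * (\<Prod>u\<leftarrow>ts. stage_weight tab i u))
         = 1 / real (tree_density (Node q ts)))"

type_synonym 'n vec_field = "real ^ 'n \<Rightarrow> real \<Rightarrow> real ^ 'n"

text \<open>
  Arguments \<open>r\<close>, \<open>y\<^sub>n\<close>, \<open>\<theta>\<close>, \<open>t\<close>, \<open>g\<close>; the value \<open>None\<close> means "not defined".
\<close>

type_synonym 'n step_filter =
  "real ^ 'n \<Rightarrow> real ^ 'n \<Rightarrow> real \<Rightarrow> real \<Rightarrow> 'n vec_field \<Rightarrow> (real ^ 'n) option"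

text \<open>
  The filter property for a given \<open>g\<close>, with bound \<open>\<theta>B\<close> (which may thus depend on \<open>g\<close>). That
  the filter is everywhere defined for \<open>\<theta> \<le> \<theta>B\<close> is presupposed by the existence of its
  derivatives and of its inverse there; that \<open>0 \<in> U\<close>, by \<open>\<F>\<close> vanishing at \<open>r = 0\<close>.
  The derivative \<open>\<partial>\<^sup>\<rho> \<partial>\<^sub>t\<^sup>m \<partial>\<^sub>\<theta>\<^sup>n\<close> is taken first in \<open>\<theta>\<close>, then in \<open>t\<close>, then in the components
  of \<open>r\<close>; the lists \<open>es\<close> enumerate the multi-indices \<open>\<rho>\<close>.
\<close>

definition implicit_step_filter ::
    "nat \<Rightarrow> real \<Rightarrow> real \<Rightarrow> (real ^ 'n) set \<Rightarrow> (real ^ 'n) set \<Rightarrow> (real ^ 'n) set \<Rightarrow>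
     real \<Rightarrow> 'n step_filter \<Rightarrow> 'n::finite vec_field \<Rightarrow> bool"
  where "implicit_step_filter p T \<theta>M U V Y \<theta>B \<F> g \<longleftrightarrow>
    open U \<and> open V \<and> open Y \<and> 0 \<in> U \<and> 0 < \<theta>B \<and> \<theta>B \<le> \<theta>M \<and>
    (\<forall>r\<in>U. \<forall>y\<in>Y. \<forall>\<theta>\<in>{0..\<theta>B}. \<forall>t\<in>{0..T}. \<F> r y \<theta> t g \<noteq> None) \<and>
    (\<forall>r\<in>U. \<forall>y\<in>Y. \<forall>t\<in>{0..T}. finite {\<theta>\<in>{0..\<theta>M}. \<F> r y \<theta> t g = None}) \<and>
    (\<forall>y\<in>Y. \<forall>\<theta>\<in>{0..\<theta>M}. \<forall>t\<in>{0..T}. \<F> 0 y \<theta> t g \<noteq> None \<longrightarrow> \<F> 0 y \<theta> t g = Some 0) \<and>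
    (\<forall>r\<in>U. \<forall>y\<in>Y. \<forall>t\<in>{0..T}. \<F> r y 0 t g = Some r) \<and>
    (\<forall>n m es. n \<le> 1 \<and> set es \<subseteq> Basis \<and> length es + m \<le> p \<longrightarrow>
       continuous_partial (U \<times> Y \<times> {0..\<theta>B} \<times> {0..T})
         (replicate n (0, 0, 1, 0) @ replicate m (0, 0, 0, 1) @ map (\<lambda>e. (e, 0, 0, 0)) es)
         (\<lambda>(r, y, \<theta>, t). the (\<F> r y \<theta> t g))) \<and>
    (\<forall>y\<in>Y. \<forall>\<theta>\<in>{0..\<theta>B}. \<forall>t\<in>{0..T}. bij_betw (\<lambda>r. the (\<F> r y \<theta> t g)) U V)"

text \<open>
  \<open>simex_step \<dots> h tn yn yn1\<close>: the step of size \<open>h\<close> from \<open>yn\<close> at time \<open>tn\<close> is defined, i.e.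
  \<open>\<F>\<close>, \<open>f\<close> and \<open>g\<close> are only evaluated inside their domains, and its result is \<open>yn1\<close>.
\<close>

definition simex_step ::
    "imex_tableau \<Rightarrow> real \<Rightarrow> real \<Rightarrow> (real ^ 'n) set \<Rightarrow> (real ^ 'n) set \<Rightarrow> 'n step_filter \<Rightarrow>
     'n vec_field \<Rightarrow> 'n::finite vec_field \<Rightarrow> real \<Rightarrow> real \<Rightarrow> real ^ 'n \<Rightarrow> real ^ 'n \<Rightarrow> bool"
  where "simex_step tab T \<theta>M U Y \<F> f g h tn yn yn1 \<longleftrightarrow>
    yn \<in> Y \<and> tn \<in> {0..T} \<and>
    (\<exists>k k'.
       k 1 = g yn tn \<and>
       k' 1 = f yn tn \<and>
       (\<forall>i\<in>{2..stages tab}. \<exists>d \<eta>.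
          d = h *\<^sub>R (\<Sum>j=1..<i. impl tab i j *\<^sub>R k j + expl tab i j *\<^sub>R k' j) \<and>
          d + (h * diag tab) *\<^sub>R k 1 \<in> U \<and>
          h * diag tab \<in> {0..\<theta>M} \<and>
          tn + node tab i * h \<in> {0..T} \<and>
          \<F> (d + (h * diag tab) *\<^sub>R k 1) yn (h * diag tab) (tn + node tab i * h) g = Some \<eta> \<and>
          yn + \<eta> \<in> Y \<and>
          k i = (\<eta> - d) /\<^sub>R (h * diag tab) \<and>
          k' i = f (yn + \<eta>) (tn + node tab i * h) + g (yn + \<eta>) (tn + node tab i * h) - k i) \<and>
       yn1 = yn + h *\<^sub>R (\<Sum>i=1..stages tab. weight tab i *\<^sub>R (k i + k' i)))"

lemma simex_step_unique:
  assumes "simex_step tab T \<theta>M U Y \<F> f g h tn yn u"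
    and "simex_step tab T \<theta>M U Y \<F> f g h tn yn v"
  shows "u = v"
proof -
  define D where "D k k' i = h *\<^sub>R (\<Sum>j=1..<i. impl tab i j *\<^sub>R k j + expl tab i j *\<^sub>R k' j)"
    for k k' :: "nat \<Rightarrow> real ^ 'a" and i
  define S where "S k k' \<longleftrightarrow> k 1 = g yn tn \<and> k' 1 = f yn tn \<and>
    (\<forall>i\<in>{2..stages tab}. \<exists>\<eta>.
       \<F> (D k k' i + (h * diag tab) *\<^sub>R k 1) yn (h * diag tab) (tn + node tab i * h) g = Some \<eta> \<and>
       k i = (\<eta> - D k k' i) /\<^sub>R (h * diag tab) \<and>
       k' i = f (yn + \<eta>) (tn + node tab i * h) + g (yn + \<eta>) (tn + node tab i * h) - k i)"
    for k k'
  define R where "R k k' = yn + h *\<^sub>R (\<Sum>i=1..stages tab. weight tab i *\<^sub>R (k i + k' i))"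
    for k k' :: "nat \<Rightarrow> real ^ 'a"
  obtain k k' where k: "S k k'" "u = R k k'"
    using assms(1) unfolding simex_step_def S_def R_def D_def by blast
  obtain l l' where l: "S l l'" "v = R l l'"
    using assms(2) unfolding simex_step_def S_def R_def D_def by blast
  have eq: "i \<in> {1..stages tab} \<longrightarrow> k i = l i \<and> k' i = l' i" for i
  proof (induction i rule: less_induct)
    case (less i)
    show ?case
    proof (intro impI)
      assume i: "i \<in> {1..stages tab}"
      show "k i = l i \<and> k' i = l' i"
      proof (cases "i = 1")
        case True
        then show ?thesis using k(1) l(1) by (simp add: S_def)
      next
        case False
        with i have i2: "i \<in> {2..stages tab}" by auto
        have "D k k' i = D l l' i"
          unfolding D_def using less.IH i by (intro arg_cong2[where f = scaleR] sum.cong) auto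
        moreover have "k 1 = l 1" using k(1) l(1) by (simp add: S_def)
        ultimately show ?thesis
          using k(1) l(1) i2 unfolding S_def by (metis option.inject)
      qed
    qed
  qed
  have "R k k' = R l l'"
    unfolding R_def using eq
    by (intro arg_cong2[where f = "(+)"] arg_cong2[where f = scaleR] sum.cong) auto
  then show ?thesis using k(2) l(2) by simp
qed

text \<open>
  Global convergence of order \<open>p\<close> towards \<open>y\<close> on \<open>[0, T]\<close>. As the result of a step is unique
  if it is defined, the existential quantifier over \<open>u\<close> says that the numerical solution
  \<open>u 0, \<dots>, u M\<close> is defined.
\<close>

definition simex_converges ::
    "imex_tableau \<Rightarrow> real \<Rightarrow> real \<Rightarrow> (real ^ 'n) set \<Rightarrow> (real ^ 'n) set \<Rightarrow> 'n step_filter \<Rightarrow>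
     'n vec_field \<Rightarrow> 'n::finite vec_field \<Rightarrow> (real \<Rightarrow> real ^ 'n) \<Rightarrow> nat \<Rightarrow> bool"
  where "simex_converges tab T \<theta>M U Y \<F> f g y p \<longleftrightarrow>
    (\<exists>C h0. 0 < C \<and> 0 < h0 \<and>
       (\<forall>M::nat. \<forall>h. 0 < M \<and> h = T / real M \<and> h \<le> h0 \<longrightarrow>
          (\<exists>u. u 0 = y 0 \<and>
               (\<forall>n<M. simex_step tab T \<theta>M U Y \<F> f g h (real n * h) (u n) (u (Suc n))) \<and>
               (\<forall>n\<le>M. norm (u n - y (real n * h)) \<le> C * h ^ p))))"

end

theory Submission
  imports Defs
begin

text \<open>
  The filter, as a function of the increment \<open>r\<close>, has the form \<open>\<F> = r + \<theta> \<Psi>(r, \<theta>, t)\<close> with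
  \<open>\<Psi>\<close> the mean of \<open>\<partial>\<^sub>\<theta> \<F>\<close> over \<open>[0, \<theta>]\<close>, so that with the full stage sums
  \<open>\<eta>\<^sub>i = h (\<Sum>\<^sub>j a\<^sub>i\<^sub>j k\<^sub>j + \<Sum>\<^sub>j a'\<^sub>i\<^sub>j k'\<^sub>j)\<close> and \<open>r\<^sub>i = \<eta>\<^sub>i - h \<gamma> (k\<^sub>i - k\<^sub>1)\<close> one has
  \<open>k\<^sub>i = k\<^sub>1 + \<Psi>(r\<^sub>i, t\<^sub>i)\<close> and \<open>k'\<^sub>i = (f + g)(y\<^sub>n + \<eta>\<^sub>i, t\<^sub>i) - k\<^sub>i\<close>; the inverse of the filter is
  not needed. Every pass through these equations gains one order in an expansion of the stages in
  elementary weights of trees, whose coefficients do not depend on the stage.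

  Exact integration is a Runge--Kutta method as well, with stages \<open>\<tau> \<in> [0, 1]\<close>, integration from
  \<open>0\<close> to \<open>\<tau>\<close> in place of both coefficient matrices, and elementary weights
  \<open>\<tau> ^ tree_order u / tree_density u\<close>. Expanding both methods with the same coefficients, the order
  conditions make the numerical step agree with the \<open>p + 1\<close>-st Picard iterate up to
  \<open>O(h\<^sup>p\<^sup>+\<^sup>1)\<close>. A Picard iterate depends on \<open>f + g\<close> only and is compared with the exact solution by the
  Lipschitz condition, which gives the one-step recursion of the global error.
\<close>

section \<open>Discrete and continuous stages\<close>

text \<open>The filter is differentiable \<open>p\<close> times in \<open>r\<close> and
  \<open>t\<close>, but just once in \<theta> and merely continuous in the base point. The
  expansions therefore run in \<open>r\<close> and \<open>t\<close> alone, and elementary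
  differentials are never written down: a coefficient is an anonymous function of base point, time
  and step size (which also fixes \<theta> = h * \<gamma>), and only its boundedness is recorded. To
  be sure that both methods share these coefficients, the two kinds of stages form one index set,
  and one expansion is stated on all of it.

  The obstacle is that exact integration has no natural splitting of the slope into implicit and
  explicit parts. Any splitting will do that is produced by the same equations, because on the
  continuous stages both parts are integrated alike and only their sum is seen. Starting there with
  the constant value of \<open>g\<close> at the base point, every pass defines the next splitting
  through \<Psi>. It reproduces the stages of the numerical method and advances the Picard iterate
  by one. The trees that arise carry both colours in every combination, which is what the order
  conditions of additive methods provide for.\<close>

text \<open>
  \<open>Inl i\<close> is the \<open>i\<close>-th stage of the tableau, \<open>Inr \<tau>\<close> the stage at \<open>\<tau>\<close> of exact integration.
\<close>

definition stage_index :: "imex_tableau \<Rightarrow> (nat + real) set"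
  where "stage_index tab = Inl ` {1..stages tab} \<union> Inr ` {0..1}"

primrec tree_weight :: "imex_tableau \<Rightarrow> nat + real \<Rightarrow> rk_tree \<Rightarrow> real"
  where
    "tree_weight tab (Inl i) = stage_weight tab i"
  | "tree_weight tab (Inr \<tau>) = (\<lambda>u. \<tau> ^ tree_order u / real (tree_density u))"

text \<open>Products of stage values lead from trees to forests: concatenation multiplies the
  weights, and a \<open>stage_operator\<close> grafts a forest onto a new root, which gives a forest
  with one tree again.\<close>

definition forest_weight :: "imex_tableau \<Rightarrow> nat + real \<Rightarrow> rk_tree list \<Rightarrow> real"
  where "forest_weight tab j us = (\<Prod>u\<leftarrow>us. tree_weight tab j u)"

definition forest_order :: "rk_tree list \<Rightarrow> nat"
  where "forest_order us = (\<Sum>u\<leftarrow>us. tree_order u)"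

fun coefficient :: "imex_tableau \<Rightarrow> part \<Rightarrow> nat \<Rightarrow> nat \<Rightarrow> real"
  where
    "coefficient tab Explicit = expl tab"
  | "coefficient tab Implicit = impl tab"

primrec stage_operator ::
    "imex_tableau \<Rightarrow> part \<Rightarrow> (nat + real \<Rightarrow> real) \<Rightarrow> nat + real \<Rightarrow> real"
  where
    "stage_operator tab q x (Inl i) = (\<Sum>j=1..stages tab. coefficient tab q i j * x (Inl j))"
  | "stage_operator tab q x (Inr \<tau>) = integral {0..\<tau>} (\<lambda>\<sigma>. x (Inr \<sigma>))"

lemma stage_weight_Node:
  "stage_weight tab i (Node q us) =
     (\<Sum>j=1..stages tab. coefficient tab q i j * (\<Prod>u\<leftarrow>us. stage_weight tab j u))"
  by (cases q) auto

lemma tree_density_pos: "0 < tree_density u"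
proof (induction u)
  case (Node q ts)
  then have "(\<Prod>u\<leftarrow>ts. tree_density u) \<noteq> 0"
    by (auto simp: prod_list_zero_iff dest: less_imp_neq)
  then show ?case by simp
qed simp

lemma forest_weight_Nil [simp]: "forest_weight tab j [] = 1"
  and forest_weight_append:
    "forest_weight tab j (us @ vs) = forest_weight tab j us * forest_weight tab j vs"
  and forest_order_Nil [simp]: "forest_order [] = 0"
  and forest_order_append: "forest_order (us @ vs) = forest_order us + forest_order vs"
  by (simp_all add: forest_weight_def forest_order_def)

lemma forest_weight_Inr:
  "forest_weight tab (Inr \<tau>) us = \<tau> ^ forest_order us / real (\<Prod>u\<leftarrow>us. tree_density u)"
  by (induction us) (simp_all add: forest_weight_def forest_order_def power_add)

lemma continuous_forest_weight: "continuous_on A (\<lambda>\<tau>. forest_weight tab (Inr \<tau>) us)"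
  unfolding forest_weight_Inr
  by (intro continuous_intros) (auto simp: prod_list_zero_iff tree_density_pos[THEN gr_implies_not0])

lemma forest_weight_bounded:
  "\<exists>C. \<forall>j\<in>stage_index tab. \<bar>forest_weight tab j us\<bar> \<le> C"
proof -
  have "compact ((\<lambda>\<tau>. forest_weight tab (Inr \<tau>) us) ` {0..1})"
    by (intro compact_continuous_image continuous_forest_weight) simp
  moreover have "finite ((\<lambda>i. forest_weight tab (Inl i) us) ` {1..stages tab})"
    by simp
  ultimately have "bounded ((\<lambda>\<tau>. forest_weight tab (Inr \<tau>) us) ` {0..1} \<union>
      (\<lambda>i. forest_weight tab (Inl i) us) ` {1..stages tab})"
    by (simp add: compact_imp_bounded finite_imp_bounded)
  then show ?thesis
    unfolding bounded_iff stage_index_def by auto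
qed

lemma integral_power_unit:
  assumes "0 \<le> \<tau>"
  shows "integral {0..\<tau>} (\<lambda>\<sigma>. \<sigma> ^ n) = \<tau> ^ Suc n / real (Suc n)"
proof -
  have "((\<lambda>\<sigma>. \<sigma> ^ n) has_integral (\<tau> ^ Suc n / real (Suc n) - 0 ^ Suc n / real (Suc n))) {0..\<tau>}"
    by (rule fundamental_theorem_of_calculus[OF assms])
      (auto intro!: derivative_eq_intros simp: has_real_derivative_iff_has_vector_derivative[symmetric]
        simp del: power_Suc of_nat_Suc)
  then show ?thesis by (simp add: integral_unique)
qed

text \<open>At a discrete stage this is the recursion of \<open>stage_weight\<close>. At a
  continuous stage, integration of \<sigma> ^ n divides by n + 1, which is the order of the new tree
  and hence the new factor in \<open>tree_density\<close>; the colour \<open>q\<close> leaves no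
  trace there.\<close>

lemma stage_operator_forest_weight:
  assumes "j \<in> stage_index tab"
  shows "stage_operator tab q (\<lambda>j. forest_weight tab j us) j = forest_weight tab j [Node q us]"
  using assms
  by (auto simp: stage_index_def forest_weight_def[of _ "Inl _"] stage_weight_Node forest_weight_Inr
      forest_order_def integral_power_unit algebra_simps simp del: stage_weight.simps)

text \<open>Both parts have the same weights, so the colour of the root is immaterial and
  \<open>Explicit\<close> is an arbitrary choice. One over the density is also the integral over the
  continuous stages: the order conditions say that the quadrature is exact on elementary weights of
  order below \<open>p\<close>.\<close>

lemma order_condition_forest:
  assumes "imex_order tab p" and "forest_order us < p"
  shows "(\<Sum>i=1..stages tab. weight tab i * forest_weight tab (Inl i) us) =
    integral {0..1} (\<lambda>\<tau>. forest_weight tab (Inr \<tau>) us)"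
proof -
  have "tree_order (Node Explicit us) \<le> p"
    using assms(2) by (simp add: forest_order_def)
  then have "(\<Sum>i=1..stages tab. weight tab i * forest_weight tab (Inl i) us) =
      1 / real (tree_density (Node Explicit us))"
    using assms(1) by (simp only: imex_order_def forest_weight_def tree_weight.simps)
  then show ?thesis
    by (simp add: forest_weight_Inr integral_power_unit forest_order_def algebra_simps)
qed

section \<open>Families with an expansion in elementary weights\<close>

text \<open>A parameter in \<open>P\<close> will be a base point with a time and a step size. All
  constants below are uniform over \<open>P\<close>, as a local bound along a whole trajectory
  requires.\<close>

locale step_family =
  fixes tab :: imex_tableau and P :: "'p set" and h :: "'p \<Rightarrow> real"
  assumes h_pos: "\<pi> \<in> P \<Longrightarrow> 0 < h \<pi>" and h_le_1: "\<pi> \<in> P \<Longrightarrow> h \<pi> \<le> 1"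
begin

text \<open>The coefficient \<open>c\<close> may depend on the parameter, even on the step size, but
  not on the stage \<open>j\<close>; any other dependence on the stage has to carry the factor
  \<open>h ^ m\<close>. Monomials of order \<open>m\<close> and above are harmless and are kept.
  Remainders are continuous in \<tau> because they will be integrated.\<close>

inductive expandable :: "nat \<Rightarrow> ('p \<Rightarrow> nat + real \<Rightarrow> real) \<Rightarrow> bool"
  for m :: nat
  where
    monomial: "(\<And>\<pi>. \<pi> \<in> P \<Longrightarrow> \<bar>c \<pi>\<bar> \<le> C) \<Longrightarrow>
      expandable m (\<lambda>\<pi> j. c \<pi> * (h \<pi> ^ forest_order us * forest_weight tab j us))"
  | remainder: "(\<And>\<pi> j. \<pi> \<in> P \<Longrightarrow> j \<in> stage_index tab \<Longrightarrow> \<bar>x \<pi> j\<bar> \<le> C * h \<pi> ^ m) \<Longrightarrow>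
      (\<And>\<pi>. \<pi> \<in> P \<Longrightarrow> continuous_on {0..1} (\<lambda>\<tau>. x \<pi> (Inr \<tau>))) \<Longrightarrow> expandable m x"
  | add: "expandable m x \<Longrightarrow> expandable m z \<Longrightarrow> expandable m (\<lambda>\<pi> j. x \<pi> j + z \<pi> j)"

lemma expandable_continuous:
  assumes "expandable m x" and "\<pi> \<in> P"
  shows "continuous_on {0..1} (\<lambda>\<tau>. x \<pi> (Inr \<tau>))"
  using assms
  by induction (auto intro!: continuous_intros continuous_forest_weight)

lemma expandable_integrable:
  assumes "expandable m x" and "\<pi> \<in> P" and "\<tau> \<in> {0..1}"
  shows "(\<lambda>\<sigma>. x \<pi> (Inr \<sigma>)) integrable_on {0..\<tau>}"
  using expandable_continuous[OF assms(1,2)] assms(3)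
  by (intro integrable_continuous_real) (auto elim: continuous_on_subset)

lemma h_power_le: "\<pi> \<in> P \<Longrightarrow> m \<le> n \<Longrightarrow> h \<pi> ^ n \<le> h \<pi> ^ m"
  by (intro power_decreasing) (auto dest: h_le_1 h_pos)

lemma expandable_bounded:
  assumes "expandable m x"
  shows "\<exists>C. \<forall>\<pi>\<in>P. \<forall>j\<in>stage_index tab. \<bar>x \<pi> j\<bar> \<le> C"
  using assms
proof induction
  case (monomial c C us)
  obtain B where B: "\<forall>j\<in>stage_index tab. \<bar>forest_weight tab j us\<bar> \<le> B"
    using forest_weight_bounded by blast
  have "\<bar>c \<pi> * (h \<pi> ^ forest_order us * forest_weight tab j us)\<bar> \<le> C * (1 * B)"
    if "\<pi> \<in> P" "j \<in> stage_index tab" for \<pi> j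
    unfolding abs_mult using B that monomial h_pos[OF that(1)] h_le_1[OF that(1)]
      order_trans[OF abs_ge_zero monomial[OF that(1)]]
    by (intro mult_mono) (auto simp: power_le_one)
  then show ?case by blast
next
  case (remainder x C)
  have "\<bar>x \<pi> j\<bar> \<le> \<bar>C\<bar>" if "\<pi> \<in> P" "j \<in> stage_index tab" for \<pi> j
  proof -
    have "C * h \<pi> ^ m \<le> \<bar>C\<bar> * 1"
      using h_pos[OF that(1)] h_le_1[OF that(1)] by (intro mult_mono) (auto simp: power_le_one)
    with remainder(1)[OF that] show ?thesis by simp
  qed
  then show ?case by blast
next
  case (add x z)
  then obtain C D where "\<forall>\<pi>\<in>P. \<forall>j\<in>stage_index tab. \<bar>x \<pi> j\<bar> \<le> C"
    "\<forall>\<pi>\<in>P. \<forall>j\<in>stage_index tab. \<bar>z \<pi> j\<bar> \<le> D" by blast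
  then have "\<bar>x \<pi> j + z \<pi> j\<bar> \<le> C + D" if "\<pi> \<in> P" "j \<in> stage_index tab" for \<pi> j
    using that by (meson abs_triangle_ineq add_mono order_trans)
  then show ?case by blast
qed

section \<open>Algebra of expandable families\<close>

lemma expandable_cong:
  assumes "expandable m x"
    and "\<And>\<pi> j. \<pi> \<in> P \<Longrightarrow> j \<in> stage_index tab \<Longrightarrow> z \<pi> j = x \<pi> j"
  shows "expandable m z"
proof -
  \<comment> \<open>The difference vanishes on the index set, so it is a remainder with constant 0,
    whatever \<open>z\<close> does elsewhere.\<close>
  have "expandable m (\<lambda>\<pi> j. z \<pi> j - x \<pi> j)"
  proof (rule remainder[where C = 0])
    fix \<pi> assume "\<pi> \<in> P"
    have "continuous_on {0..1} (\<lambda>\<tau>::real. 0::real)" by simp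
    then show "continuous_on {0..1} (\<lambda>\<tau>. z \<pi> (Inr \<tau>) - x \<pi> (Inr \<tau>))"
      by (rule continuous_on_eq) (use assms(2) \<open>\<pi> \<in> P\<close> in \<open>auto simp: stage_index_def\<close>)
  qed (use assms(2) in auto)
  from add[OF assms(1) this] show ?thesis by simp
qed

lemma expandable_const:
  assumes "\<And>\<pi>. \<pi> \<in> P \<Longrightarrow> \<bar>c \<pi>\<bar> \<le> C"
  shows "expandable m (\<lambda>\<pi> j. c \<pi>)"
  using monomial[of c C m "[]"] assms by simp

lemma expandable_monomial_mult:
  assumes "expandable m x" and "\<And>\<pi>. \<pi> \<in> P \<Longrightarrow> \<bar>c \<pi>\<bar> \<le> C"
  shows "expandable m (\<lambda>\<pi> j. (c \<pi> * (h \<pi> ^ forest_order us * forest_weight tab j us)) * x \<pi> j)"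
  using assms(1)
proof induction
  case (monomial c' C' us')
  have "\<bar>c \<pi> * c' \<pi>\<bar> \<le> C * C'" if "\<pi> \<in> P" for \<pi>
    unfolding abs_mult using assms(2)[OF that] monomial[OF that] by (intro mult_mono) auto
  then show ?case
    using expandable.monomial[of "\<lambda>\<pi>. c \<pi> * c' \<pi>" "C * C'" m "us @ us'"]
    by (simp add: forest_order_append forest_weight_append power_add mult_ac)
next
  case (remainder x C')
  have "expandable m (\<lambda>\<pi> j. c \<pi> * (h \<pi> ^ forest_order us * forest_weight tab j us))"
    by (rule monomial[OF assms(2)])
  from expandable_bounded[OF this] obtain B where B: "\<And>\<pi> j. \<pi> \<in> P \<Longrightarrow> j \<in> stage_index tab \<Longrightarrow>
      \<bar>c \<pi> * (h \<pi> ^ forest_order us * forest_weight tab j us)\<bar> \<le> B" by blast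
  show ?case
  proof (rule expandable.remainder[where C = "B * C'"])
    fix \<pi> j assume \<pi>: "\<pi> \<in> P" "j \<in> stage_index tab"
    show "\<bar>(c \<pi> * (h \<pi> ^ forest_order us * forest_weight tab j us)) * x \<pi> j\<bar> \<le> B * C' * h \<pi> ^ m"
      unfolding abs_mult[of "c \<pi> * _"] mult.assoc[of B]
      using B[OF \<pi>] remainder(1)[OF \<pi>] by (intro mult_mono) auto
  qed (use remainder in \<open>auto intro!: continuous_intros continuous_forest_weight\<close>)
next
  case (add x z)
  from expandable.add[OF add.IH] show ?case by (simp add: distrib_left)
qed

lemma expandable_antimono:
  assumes "expandable m x" and "k \<le> m"
  shows "expandable k x"
  using assms(1)
proof induction
  case (monomial c C us)
  then show ?case by (rule expandable.monomial)
next
  case (remainder x C)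
  show ?case
  proof (rule expandable.remainder[where C = "\<bar>C\<bar>"])
    fix \<pi> j assume \<pi>: "\<pi> \<in> P" "j \<in> stage_index tab"
    have "C * h \<pi> ^ m \<le> \<bar>C\<bar> * h \<pi> ^ k"
      using h_power_le[OF \<pi>(1) assms(2)] h_pos[OF \<pi>(1)] by (intro mult_mono) auto
    with remainder(1)[OF \<pi>] show "\<bar>x \<pi> j\<bar> \<le> \<bar>C\<bar> * h \<pi> ^ k" by simp
  qed (rule remainder(2))
next
  case (add x z)
  from expandable.add[OF add.IH] show ?case .
qed

lemma expandable_scale:
  assumes "expandable m x" and "\<And>\<pi>. \<pi> \<in> P \<Longrightarrow> \<bar>c \<pi>\<bar> \<le> C"
  shows "expandable m (\<lambda>\<pi> j. c \<pi> * x \<pi> j)"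
  using expandable_monomial_mult[OF assms, where us = "[]"] by simp

lemma expandable_diff:
  assumes "expandable m x" and "expandable m z"
  shows "expandable m (\<lambda>\<pi> j. x \<pi> j - z \<pi> j)"
  using add[OF assms(1) expandable_scale[OF assms(2), of "\<lambda>_. -1" 1]] by simp

lemma expandable_sum:
  assumes "\<And>i. i \<in> A \<Longrightarrow> expandable m (x i)"
  shows "expandable m (\<lambda>\<pi> j. \<Sum>i\<in>A. x i \<pi> j)"
  using assms
proof (induction A rule: infinite_finite_induct)
  case (insert i A)
  then show ?case using add[of m "x i" "\<lambda>\<pi> j. \<Sum>i\<in>A. x i \<pi> j"] by simp
qed (auto intro: expandable_const[of _ 0])

text \<open>A factor of size \<open>h ^ k\<close> makes up for an expansion that is \<open>k\<close>
  orders short. This pays for the Taylor terms: a k-th derivative can be expanded only to order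
  \<open>m - k\<close>, but it is multiplied by the k-th power of a small displacement.\<close>

lemma expandable_mult_small:
  assumes z: "expandable (m - k) z" and x: "expandable m x" and "k \<le> m"
    and small: "\<And>\<pi> j. \<pi> \<in> P \<Longrightarrow> j \<in> stage_index tab \<Longrightarrow> \<bar>x \<pi> j\<bar> \<le> C * h \<pi> ^ k"
  shows "expandable m (\<lambda>\<pi> j. x \<pi> j * z \<pi> j)"
  using z
proof induction
  case (monomial c C' us)
  from expandable_monomial_mult[OF x monomial] show ?case by (simp add: mult_ac)
next
  case (remainder z C')
  show ?case
  proof (rule expandable.remainder[where C = "C * C'"])
    fix \<pi> j assume \<pi>: "\<pi> \<in> P" "j \<in> stage_index tab"
    have "\<bar>x \<pi> j\<bar> * \<bar>z \<pi> j\<bar> \<le> (C * h \<pi> ^ k) * (C' * h \<pi> ^ (m - k))"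
      using small[OF \<pi>] remainder(1)[OF \<pi>] by (intro mult_mono) auto
    also have "\<dots> = C * C' * (h \<pi> ^ k * h \<pi> ^ (m - k))" by simp
    also have "h \<pi> ^ k * h \<pi> ^ (m - k) = h \<pi> ^ m"
      using \<open>k \<le> m\<close> by (simp flip: power_add)
    finally show "\<bar>x \<pi> j * z \<pi> j\<bar> \<le> C * C' * h \<pi> ^ m" by (simp add: abs_mult)
  next
    fix \<pi> assume "\<pi> \<in> P"
    then show "continuous_on {0..1} (\<lambda>\<tau>. x \<pi> (Inr \<tau>) * z \<pi> (Inr \<tau>))"
      using remainder(2) expandable_continuous[OF x] by (intro continuous_intros) auto
  qed
next
  case (add z z')
  from expandable.add[OF add.IH] show ?case by (simp add: distrib_left)
qed

lemma expandable_power: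
  assumes "expandable m x"
  shows "expandable m (\<lambda>\<pi> j. x \<pi> j ^ k)"
proof (induction k)
  case 0
  show ?case using expandable_const[of "\<lambda>_. 1" 1] by simp
next
  case (Suc k)
  obtain C where "\<And>\<pi> j. \<pi> \<in> P \<Longrightarrow> j \<in> stage_index tab \<Longrightarrow> \<bar>x \<pi> j\<bar> \<le> C"
    using expandable_bounded[OF assms] by blast
  then show ?case
    using expandable_mult_small[of m 0 "\<lambda>\<pi> j. x \<pi> j ^ k" x C] Suc assms by simp
qed

section \<open>Operations that gain an order, and quadrature\<close>

lemma expandable_times_step:
  assumes "expandable m x"
  shows "expandable (Suc m) (\<lambda>\<pi> j. h \<pi> * x \<pi> j)"
  using assms
proof induction
  case (monomial c C us)
  have "\<bar>h \<pi> * c \<pi>\<bar> \<le> 1 * C" if "\<pi> \<in> P" for \<pi>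
    unfolding abs_mult using monomial[OF that] h_pos[OF that] h_le_1[OF that]
    by (intro mult_mono) auto
  from expandable.monomial[OF this, where us = us] show ?case by (simp add: mult_ac)
next
  case (remainder x C)
  show ?case
  proof (rule expandable.remainder[where C = C])
    fix \<pi> j assume \<pi>: "\<pi> \<in> P" "j \<in> stage_index tab"
    have "h \<pi> * \<bar>x \<pi> j\<bar> \<le> h \<pi> * (C * h \<pi> ^ m)"
      using remainder(1)[OF \<pi>] h_pos[OF \<pi>(1)] by (intro mult_left_mono) auto
    then show "\<bar>h \<pi> * x \<pi> j\<bar> \<le> C * h \<pi> ^ Suc m"
      using h_pos[OF \<pi>(1)] by (simp add: abs_mult mult_ac)
  qed (use remainder in \<open>auto intro: continuous_intros\<close>)
next
  case (add x z)
  from expandable.add[OF add.IH] show ?case by (simp add: distrib_left)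
qed

text \<open>Grafting raises the order of each forest by one, and the factor \<open>h\<close>
  supplies exactly the missing power. On remainders the operator is bounded, and \<open>h\<close>
  improves the exponent.\<close>

lemma expandable_stage_operator:
  assumes "expandable m x"
  shows "expandable (Suc m) (\<lambda>\<pi> j. h \<pi> * stage_operator tab q (x \<pi>) j)"
  using assms
proof induction
  case (monomial c C us)
  have eq: "h \<pi> * stage_operator tab q (\<lambda>j. c \<pi> * (h \<pi> ^ forest_order us * forest_weight tab j us)) j =
      c \<pi> * (h \<pi> ^ forest_order [Node q us] * forest_weight tab j [Node q us])"
    if "j \<in> stage_index tab" for \<pi> j
  proof -
    have "stage_operator tab q (\<lambda>j. c \<pi> * (h \<pi> ^ forest_order us * forest_weight tab j us)) j =
        c \<pi> * h \<pi> ^ forest_order us * stage_operator tab q (\<lambda>j. forest_weight tab j us) j"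
      by (cases j) (simp_all add: sum_distrib_left mult_ac)
    then show ?thesis
      using stage_operator_forest_weight[OF that, of q us] by (simp add: forest_order_def)
  qed
  show ?case
    by (rule expandable_cong[OF expandable.monomial[of c C "Suc m" "[Node q us]"]])
      (use monomial eq in auto)
next
  case (remainder x C)
  \<comment> \<open>The double sum dominates every row of coefficients. The summand 1 is for the
    continuous stages, where the operator is bounded by the length \<tau> \<le> 1 of the
    interval.\<close>
  define A where "A = 1 + (\<Sum>i=1..stages tab. \<Sum>j=1..stages tab. \<bar>coefficient tab q i j\<bar>)"
  have A1: "1 \<le> A" unfolding A_def by (simp add: sum_nonneg)
  show ?case
  proof (rule expandable.remainder[where C = "A * C"])
    fix \<pi> j assume \<pi>: "\<pi> \<in> P" and j: "j \<in> stage_index tab"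
    have C0: "0 \<le> C * h \<pi> ^ m" using remainder(1)[OF \<pi> j] by linarith
    have "\<bar>stage_operator tab q (x \<pi>) j\<bar> \<le> A * (C * h \<pi> ^ m)"
    proof (cases j)
      case (Inl i)
      with j have i: "i \<in> {1..stages tab}" by (auto simp: stage_index_def)
      have "\<bar>stage_operator tab q (x \<pi>) j\<bar> \<le>
          (\<Sum>j=1..stages tab. \<bar>coefficient tab q i j * x \<pi> (Inl j)\<bar>)"
        unfolding Inl by (simp add: sum_abs)
      also have "\<dots> \<le> (\<Sum>j=1..stages tab. \<bar>coefficient tab q i j\<bar> * (C * h \<pi> ^ m))"
        unfolding abs_mult using remainder(1)[OF \<pi>]
        by (intro sum_mono mult_left_mono) (auto simp: stage_index_def)
      also have "\<dots> = (\<Sum>j=1..stages tab. \<bar>coefficient tab q i j\<bar>) * (C * h \<pi> ^ m)"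
        by (simp only: sum_distrib_right)
      also have "\<dots> \<le> A * (C * h \<pi> ^ m)"
      proof (rule mult_right_mono[OF _ C0])
        have "(\<Sum>j=1..stages tab. \<bar>coefficient tab q i j\<bar>) \<le>
            (\<Sum>i=1..stages tab. \<Sum>j=1..stages tab. \<bar>coefficient tab q i j\<bar>)"
          using member_le_sum[OF i, of "\<lambda>i. \<Sum>j=1..stages tab. \<bar>coefficient tab q i j\<bar>"]
          by (simp add: sum_nonneg)
        then show "(\<Sum>j=1..stages tab. \<bar>coefficient tab q i j\<bar>) \<le> A" unfolding A_def by simp
      qed
      finally show ?thesis .
    next
      case (Inr \<tau>)
      with j have \<tau>: "0 \<le> \<tau>" "\<tau> \<le> 1" by (auto simp: stage_index_def)
      have "continuous_on {0..\<tau>} (\<lambda>\<sigma>. x \<pi> (Inr \<sigma>))"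
        using remainder(2)[OF \<pi>] \<tau> by (auto elim: continuous_on_subset)
      then have "norm (integral {0..\<tau>} (\<lambda>\<sigma>. x \<pi> (Inr \<sigma>))) \<le> C * h \<pi> ^ m * (\<tau> - 0)"
        using \<tau> remainder(1)[OF \<pi>] by (intro integral_bound) (auto simp: stage_index_def)
      also have "\<dots> \<le> (C * h \<pi> ^ m) * A"
        using \<tau> A1 C0 by (intro mult_left_mono) auto
      finally show ?thesis by (simp add: Inr mult_ac)
    qed
    then have "h \<pi> * \<bar>stage_operator tab q (x \<pi>) j\<bar> \<le> h \<pi> * (A * (C * h \<pi> ^ m))"
      using h_pos[OF \<pi>] by (intro mult_left_mono) auto
    then show "\<bar>h \<pi> * stage_operator tab q (x \<pi>) j\<bar> \<le> A * C * h \<pi> ^ Suc m"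
      using h_pos[OF \<pi>] by (simp add: abs_mult mult_ac)
  next
    fix \<pi> assume "\<pi> \<in> P"
    then have "(\<lambda>\<sigma>. x \<pi> (Inr \<sigma>)) integrable_on {0..1}"
      using remainder(2) by (intro integrable_continuous_real) auto
    from indefinite_integral_continuous_1[OF this]
    show "continuous_on {0..1} (\<lambda>\<tau>. h \<pi> * stage_operator tab q (x \<pi>) (Inr \<tau>))"
      by (auto intro!: continuous_intros)
  qed
next
  case (add x z)
  have "stage_operator tab q (\<lambda>j. x \<pi> j + z \<pi> j) j =
      stage_operator tab q (x \<pi>) j + stage_operator tab q (z \<pi>) j"
    if "\<pi> \<in> P" "j \<in> stage_index tab" for \<pi> j
    using that add.hyps
    by (auto simp: stage_index_def algebra_simps sum.distrib expandable_integrable integral_add)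
  then show ?case
    using expandable_cong[OF expandable.add[OF add.IH]] by (auto simp: distrib_left)
qed

text \<open>Monomials of order below \<open>p\<close> cancel by the order conditions; those of
  higher order and the remainders are O(h ^ p) in the sum and in the integral separately.\<close>

lemma expandable_quadrature:
  assumes "imex_order tab p" and "expandable p x"
  shows "\<exists>C. \<forall>\<pi>\<in>P. \<bar>(\<Sum>i=1..stages tab. weight tab i * x \<pi> (Inl i)) -
    integral {0..1} (\<lambda>\<tau>. x \<pi> (Inr \<tau>))\<bar> \<le> C * h \<pi> ^ p"
  using assms(2)
proof induction
  case (monomial c C us)
  define \<Delta> where "\<Delta> = (\<Sum>i=1..stages tab. weight tab i * forest_weight tab (Inl i) us) -
    integral {0..1} (\<lambda>\<tau>. forest_weight tab (Inr \<tau>) us)"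
  have eq: "(\<Sum>i=1..stages tab. weight tab i * (c \<pi> * (h \<pi> ^ forest_order us * forest_weight tab (Inl i) us)))
      - integral {0..1} (\<lambda>\<tau>. c \<pi> * (h \<pi> ^ forest_order us * forest_weight tab (Inr \<tau>) us)) =
      c \<pi> * (h \<pi> ^ forest_order us * \<Delta>)" for \<pi>
    by (simp add: \<Delta>_def algebra_simps sum_distrib_left)
  have "\<bar>c \<pi> * (h \<pi> ^ forest_order us * \<Delta>)\<bar> \<le> (C * \<bar>\<Delta>\<bar>) * h \<pi> ^ p" if \<pi>: "\<pi> \<in> P" for \<pi>
  proof (cases "forest_order us < p")
    case True
    then have "\<Delta> = 0" using order_condition_forest[OF assms(1)] by (simp add: \<Delta>_def)
    then show ?thesis by simp
  next
    case False
    then have "h \<pi> ^ forest_order us \<le> h \<pi> ^ p" using h_power_le[OF \<pi>] by simp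
    then have "\<bar>c \<pi>\<bar> * (h \<pi> ^ forest_order us * \<bar>\<Delta>\<bar>) \<le> C * (h \<pi> ^ p * \<bar>\<Delta>\<bar>)"
      using monomial[OF \<pi>] h_pos[OF \<pi>] by (intro mult_mono) auto
    then show ?thesis using h_pos[OF \<pi>] by (simp add: abs_mult mult_ac)
  qed
  then show ?case unfolding eq by blast
next
  case (remainder x C)
  have "\<bar>(\<Sum>i=1..stages tab. weight tab i * x \<pi> (Inl i)) - integral {0..1} (\<lambda>\<tau>. x \<pi> (Inr \<tau>))\<bar>
      \<le> ((\<Sum>i=1..stages tab. \<bar>weight tab i\<bar>) * C + C) * h \<pi> ^ p" if \<pi>: "\<pi> \<in> P" for \<pi>
  proof -
    have "\<bar>\<Sum>i=1..stages tab. weight tab i * x \<pi> (Inl i)\<bar> \<le>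
        (\<Sum>i=1..stages tab. \<bar>weight tab i\<bar> * (C * h \<pi> ^ p))"
      by (rule order_trans[OF sum_abs], unfold abs_mult)
        (use remainder(1)[OF \<pi>] in \<open>auto intro!: sum_mono mult_left_mono simp: stage_index_def\<close>)
    moreover have "norm (integral {0..1} (\<lambda>\<tau>. x \<pi> (Inr \<tau>))) \<le> C * h \<pi> ^ p * (1 - 0)"
      using remainder \<pi> by (intro integral_bound) (auto simp: stage_index_def)
    ultimately show ?thesis
      by (simp add: algebra_simps sum_distrib_left sum_distrib_right)
  qed
  then show ?case by blast
next
  case (add x z)
  then obtain C D where CD:
    "\<forall>\<pi>\<in>P. \<bar>(\<Sum>i=1..stages tab. weight tab i * x \<pi> (Inl i)) - integral {0..1} (\<lambda>\<tau>. x \<pi> (Inr \<tau>))\<bar> \<le> C * h \<pi> ^ p"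
    "\<forall>\<pi>\<in>P. \<bar>(\<Sum>i=1..stages tab. weight tab i * z \<pi> (Inl i)) - integral {0..1} (\<lambda>\<tau>. z \<pi> (Inr \<tau>))\<bar> \<le> D * h \<pi> ^ p"
    by blast
  have "\<bar>(\<Sum>i=1..stages tab. weight tab i * (x \<pi> (Inl i) + z \<pi> (Inl i))) -
      integral {0..1} (\<lambda>\<tau>. x \<pi> (Inr \<tau>) + z \<pi> (Inr \<tau>))\<bar> \<le> (C + D) * h \<pi> ^ p" if \<pi>: "\<pi> \<in> P" for \<pi>
  proof -
    have "integral {0..1} (\<lambda>\<tau>. x \<pi> (Inr \<tau>) + z \<pi> (Inr \<tau>)) =
        integral {0..1} (\<lambda>\<tau>. x \<pi> (Inr \<tau>)) + integral {0..1} (\<lambda>\<tau>. z \<pi> (Inr \<tau>))"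
      using add.hyps \<pi> by (intro integral_add expandable_integrable) auto
    then show ?thesis
      using CD[rule_format, OF \<pi>] by (simp add: distrib_left distrib_right sum.distrib)
  qed
  then show ?case by blast
qed

end

section \<open>Iterated partial derivatives in a fixed order\<close>

text \<open>The definition gives the derivative at parameter 0 of each slice. Recentring at
  \<open>s0\<close> and the chain rule give it along a segment traversed with speed
  \<open>\<delta>\<close>, where \<open>\<delta>\<close> = 0 needs no separate treatment.\<close>

lemma has_partial_derivative_line:
  assumes "has_partial_derivative D c \<phi> \<psi>"
    and "\<And>s. s \<in> S \<Longrightarrow> x + (s * \<delta>) *\<^sub>R c \<in> D" and "s0 \<in> S"
  shows "((\<lambda>s. \<phi> (x + (s * \<delta>) *\<^sub>R c)) has_vector_derivative \<delta> *\<^sub>R \<psi> (x + (s0 * \<delta>) *\<^sub>R c))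
    (at s0 within S)"
proof -
  let ?x = "x + (s0 * \<delta>) *\<^sub>R c" and ?g = "\<lambda>s. (s - s0) * \<delta>"
  have g: "(?g has_vector_derivative \<delta>) (at s0 within S)"
    by (auto intro!: derivative_eq_intros simp: has_real_derivative_iff_has_vector_derivative[symmetric])
  have shift: "?x + ?g s *\<^sub>R c = x + (s * \<delta>) *\<^sub>R c" for s
    by (simp add: algebra_simps flip: scaleR_add_left)
  have "((\<lambda>\<sigma>. \<phi> (?x + \<sigma> *\<^sub>R c)) has_vector_derivative \<psi> ?x) (at 0 within {\<sigma>. ?x + \<sigma> *\<^sub>R c \<in> D})"
    using assms unfolding has_partial_derivative_def by blast
  moreover have "?g ` S \<subseteq> {\<sigma>. ?x + \<sigma> *\<^sub>R c \<in> D}"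
    unfolding image_subset_iff mem_Collect_eq shift using assms(2) by blast
  ultimately have "((\<lambda>\<sigma>. \<phi> (?x + \<sigma> *\<^sub>R c)) has_vector_derivative \<psi> ?x) (at 0 within ?g ` S)"
    by (rule has_vector_derivative_within_subset)
  then have "((\<lambda>\<sigma>. \<phi> (?x + \<sigma> *\<^sub>R c)) has_vector_derivative \<psi> ?x) (at (?g s0) within ?g ` S)"
    by simp
  from vector_diff_chain_within[OF g this] show ?thesis
    by (simp add: o_def shift)
qed

lemma has_partial_derivative_cong:
  assumes "has_partial_derivative D c \<phi> \<psi>"
    and "\<And>x. x \<in> D \<Longrightarrow> \<phi>' x = \<phi> x" and "\<And>x. x \<in> D \<Longrightarrow> \<psi>' x = \<psi> x"
  shows "has_partial_derivative D c \<phi>' \<psi>'"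
  unfolding has_partial_derivative_def
proof
  fix x assume x: "x \<in> D"
  show "((\<lambda>\<sigma>. \<phi>' (x + \<sigma> *\<^sub>R c)) has_vector_derivative \<psi>' x) (at 0 within {\<sigma>. x + \<sigma> *\<^sub>R c \<in> D})"
    by (rule has_vector_derivative_transform[where f = "\<lambda>\<sigma>. \<phi> (x + \<sigma> *\<^sub>R c)"])
      (use assms x in \<open>auto simp: has_partial_derivative_def\<close>)
qed

lemma continuous_partial_cong:
  assumes "continuous_partial D es \<phi>" and "\<And>x. x \<in> D \<Longrightarrow> \<phi>' x = \<phi> x"
  shows "continuous_partial D es \<phi>'"
proof (cases es)
  case Nil
  with assms show ?thesis by (auto intro: continuous_on_eq)
next
  case (Cons c es')
  with assms(1) obtain \<psi> where "has_partial_derivative D c \<phi> \<psi>" "continuous_partial D es' \<psi>"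
    by auto
  with has_partial_derivative_cong[of D c \<phi> \<psi> \<phi>' \<psi>] assms(2) Cons show ?thesis by auto
qed

text \<open>It serves two purposes: with the identity as \<open>L\<close> it restricts the domain,
  and with (r, u, \<theta>, t) sent to (u + r, t) it turns derivatives of a field into derivatives
  in the displacement.\<close>

lemma continuous_partial_pullback:
  assumes "continuous_partial D (map \<iota> es) \<phi>"
    and "continuous_on D' L" and "\<And>x. x \<in> D' \<Longrightarrow> L x \<in> D"
    and "\<And>c x \<sigma>. c \<in> set es \<Longrightarrow> L (x + \<sigma> *\<^sub>R c) = L x + \<sigma> *\<^sub>R \<iota> c"
  shows "continuous_partial D' es (\<lambda>x. \<phi> (L x))"
  using assms(1,4)
proof (induction es arbitrary: \<phi>)
  case Nil
  then show ?case using assms(2,3) by (auto intro: continuous_on_compose2)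
next
  case (Cons c es)
  then obtain \<psi> where \<psi>: "has_partial_derivative D (\<iota> c) \<phi> \<psi>" "continuous_partial D (map \<iota> es) \<psi>"
    by auto
  have "has_partial_derivative D' c (\<lambda>x. \<phi> (L x)) (\<lambda>x. \<psi> (L x))"
    unfolding has_partial_derivative_def
  proof
    fix x assume "x \<in> D'"
    then have "((\<lambda>\<sigma>. \<phi> (L x + \<sigma> *\<^sub>R \<iota> c)) has_vector_derivative \<psi> (L x))
        (at 0 within {\<sigma>. L x + \<sigma> *\<^sub>R \<iota> c \<in> D})"
      using \<psi>(1) assms(3) by (auto simp: has_partial_derivative_def)
    moreover have L: "L (x + \<sigma> *\<^sub>R c) = L x + \<sigma> *\<^sub>R \<iota> c" for \<sigma>
      using Cons.prems(2)[of c x \<sigma>] by simp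
    moreover have "{\<sigma>. x + \<sigma> *\<^sub>R c \<in> D'} \<subseteq> {\<sigma>. L x + \<sigma> *\<^sub>R \<iota> c \<in> D}"
      using assms(3) by (auto simp flip: L)
    ultimately show "((\<lambda>\<sigma>. \<phi> (L (x + \<sigma> *\<^sub>R c))) has_vector_derivative \<psi> (L x))
        (at 0 within {\<sigma>. x + \<sigma> *\<^sub>R c \<in> D'})"
      unfolding L by (blast intro: has_vector_derivative_within_subset)
  qed
  moreover have "continuous_partial D' es (\<lambda>x. \<psi> (L x))"
    using Cons.IH[OF \<psi>(2)] Cons.prems(2) by simp
  ultimately show ?case by auto
qed

text \<open>
  The witnesses in \<open>continuous_partial\<close> for different lists are related only through the
  uniqueness of derivatives, which needs that the slices have no isolated points.
\<close>

definition nondegenerate :: "'a::euclidean_space set \<Rightarrow> 'a \<Rightarrow> bool"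
  where "nondegenerate D c \<longleftrightarrow> (\<forall>x\<in>D. at 0 within {\<sigma>. x + \<sigma> *\<^sub>R c \<in> D} \<noteq> bot)"

definition partial_derivative ::
    "'a::euclidean_space set \<Rightarrow> 'a \<Rightarrow> ('a \<Rightarrow> 'b::real_normed_vector) \<Rightarrow> 'a \<Rightarrow> 'b"
  where "partial_derivative D c \<phi> x =
    vector_derivative (\<lambda>\<sigma>. \<phi> (x + \<sigma> *\<^sub>R c)) (at 0 within {\<sigma>. x + \<sigma> *\<^sub>R c \<in> D})"

lemma continuous_partial_Cons:
  assumes "nondegenerate D c" and "continuous_partial D (c # es) \<phi>"
  shows "has_partial_derivative D c \<phi> (partial_derivative D c \<phi>)"
    and "continuous_partial D es (partial_derivative D c \<phi>)"
proof -
  obtain \<psi> where \<psi>: "has_partial_derivative D c \<phi> \<psi>" "continuous_partial D es \<psi>"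
    using assms(2) by auto
  have eq: "partial_derivative D c \<phi> x = \<psi> x" if "x \<in> D" for x
    unfolding partial_derivative_def
    by (rule vector_derivative_within)
      (use \<psi>(1) assms(1) that in \<open>auto simp: has_partial_derivative_def nondegenerate_def\<close>)
  show "has_partial_derivative D c \<phi> (partial_derivative D c \<phi>)"
    using has_partial_derivative_cong[OF \<psi>(1)] eq by blast
  show "continuous_partial D es (partial_derivative D c \<phi>)"
    using continuous_partial_cong[OF \<psi>(2)] eq by blast
qed

lemma continuous_partial_replicate:
  assumes "nondegenerate D c" and "continuous_partial D (replicate k c @ es) \<phi>"
  shows "continuous_partial D es ((partial_derivative D c ^^ k) \<phi>)"
  using assms(2)
proof (induction k arbitrary: \<phi>)
  case (Suc k)
  then have "continuous_partial D (replicate k c @ es) (partial_derivative D c \<phi>)"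
    using continuous_partial_Cons(2)[OF assms(1)] by simp
  from Suc.IH[OF this] show ?case by (simp add: funpow_swap1)
qed simp

text \<open>The directions are exhausted in the order of the list. Each has one chain
  \<open>G\<close> of successive derivatives, and after \<open>k\<close> of them the budget
  \<open>m - k\<close> is left for the later directions. Unlike unrelated witnesses for each list of
  directions, such a chain can be fed to the Taylor formula; and only mixed derivatives in one fixed
  order are asked for, as a filter grants them.\<close>

primrec smooth_along ::
    "'a::euclidean_space set \<Rightarrow> 'a list \<Rightarrow> nat \<Rightarrow> ('a \<Rightarrow> 'b::real_normed_vector) \<Rightarrow> bool"
  where
    "smooth_along D [] = (\<lambda>m \<phi>. continuous_on D \<phi>)"
  | "smooth_along D (c # cs) = (\<lambda>m \<phi>. \<exists>G. G 0 = \<phi> \<and>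
       (\<forall>k<m. has_partial_derivative D c (G k) (G (Suc k))) \<and>
       (\<forall>k\<le>m. smooth_along D cs (m - k) (G k)))"

lemma smooth_along_continuous:
  "smooth_along D cs m \<phi> \<Longrightarrow> continuous_on D \<phi>"
proof (induction cs arbitrary: m \<phi>)
  case (Cons c cs)
  then obtain G where "G 0 = \<phi>" "\<forall>k\<le>m. smooth_along D cs (m - k) (G k)" by auto
  then have "smooth_along D cs m \<phi>" by (metis diff_zero le0)
  then show ?case by (rule Cons.IH)
qed simp

text \<open>The list \<open>ks\<close> is a multi-index of exponents. Nondegeneracy makes the
  iterated \<open>partial_derivative\<close> a single chain that serves all multi-indices at
  once.\<close>

lemma smooth_alongI:
  assumes "\<And>c. c \<in> set cs \<Longrightarrow> nondegenerate D c"
    and "\<And>ks. length ks = length cs \<Longrightarrow> sum_list ks \<le> m \<Longrightarrow>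
      continuous_partial D (concat (map2 replicate ks cs)) \<phi>"
  shows "smooth_along D cs m \<phi>"
  using assms
proof (induction cs arbitrary: m \<phi>)
  case Nil
  from Nil(2)[of "[]"] show ?case by simp
next
  case (Cons c cs)
  let ?G = "\<lambda>k. (partial_derivative D c ^^ k) \<phi>"
  have c: "nondegenerate D c" using Cons.prems(1) by simp
  have G: "continuous_partial D (replicate l c @ concat (map2 replicate ks cs)) (?G k)"
    if "length ks = length cs" "k + l + sum_list ks \<le> m" for k l ks
    using Cons.prems(2)[of "(k + l) # ks"] that continuous_partial_replicate[OF c]
    by (simp add: replicate_add)
  \<comment> \<open>One more derivative along \<open>c\<close> and none along the later directions,
    hence the zero multi-index.\<close>
  have "has_partial_derivative D c (?G k) (?G (Suc k))" if "k < m" for k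
    using continuous_partial_Cons(1)[OF c, of _ "?G k"]
      G[of "replicate (length cs) 0" k 1] that by (simp add: sum_list_replicate)
  moreover have "smooth_along D cs (m - k) (?G k)" if "k \<le> m" for k
    using Cons.prems(1) G[of _ k 0] that by (intro Cons.IH) auto
  ultimately show ?case by (auto intro!: exI[of _ ?G])
qed

lemma smooth_along_inner:
  fixes \<phi> :: "'a::euclidean_space \<Rightarrow> 'b::real_inner"
  shows "smooth_along D cs m \<phi> \<Longrightarrow> smooth_along D cs m (\<lambda>x. \<phi> x \<bullet> b)"
proof (induction cs arbitrary: m \<phi>)
  case Nil
  then show ?case by (auto intro: continuous_intros)
next
  case (Cons c cs)
  then obtain G where G: "G 0 = \<phi>" "\<forall>k<m. has_partial_derivative D c (G k) (G (Suc k))"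
    "\<forall>k\<le>m. smooth_along D cs (m - k) (G k)" by auto
  then have "\<forall>k<m. has_partial_derivative D c (\<lambda>x. G k x \<bullet> b) (\<lambda>x. G (Suc k) x \<bullet> b)"
    by (auto simp: has_partial_derivative_def
        intro!: bounded_linear.has_vector_derivative[OF bounded_linear_inner_left])
  then show ?case
    using G Cons.IH by (auto intro!: exI[of _ "\<lambda>k x. G k x \<bullet> b"])
qed

text \<open>Differentiation under the integral sign. \<open>L s\<close> commutes with translations
  along the listed directions since it is going to scale the \<theta> component alone; convexity of
  the slices is a condition of the Leibniz rule.\<close>

lemma smooth_along_integral:
  fixes \<psi> :: "'a::euclidean_space \<Rightarrow> 'b::euclidean_space" and L :: "real \<Rightarrow> 'a \<Rightarrow> 'a"
  assumes "smooth_along D cs m \<psi>"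
    and contL: "continuous_on (D \<times> {0..1}) (\<lambda>(x, s). L s x)"
    and L: "\<And>x s. x \<in> D \<Longrightarrow> s \<in> {0..1} \<Longrightarrow> L s x \<in> D"
    and "\<And>c x s \<sigma>. c \<in> set cs \<Longrightarrow> L s (x + \<sigma> *\<^sub>R c) = L s x + \<sigma> *\<^sub>R c"
    and "\<And>c x. c \<in> set cs \<Longrightarrow> x \<in> D \<Longrightarrow> convex {\<sigma>. x + \<sigma> *\<^sub>R c \<in> D}"
  shows "smooth_along D cs m (\<lambda>x. integral {0..1} (\<lambda>s. \<psi> (L s x)))"
proof -
  have comp: "continuous_on (D \<times> {0..1}) (\<lambda>(x, s). \<psi> (L s x))"
    if "continuous_on D \<psi>" for \<psi> :: "'a \<Rightarrow> 'b"
  proof -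
    have "continuous_on (D \<times> {0..1}) (\<lambda>z. \<psi> (case z of (x, s) \<Rightarrow> L s x))"
      by (rule continuous_on_compose2[OF that contL]) (use L in auto)
    then show ?thesis by (simp add: split_beta)
  qed
  show ?thesis
    using assms(1,4,5)
  proof (induction cs arbitrary: m \<psi>)
    case Nil
    then have "continuous_on (D \<times> cbox 0 1) (\<lambda>(x, s). \<psi> (L s x))"
      using comp by simp
    from integral_continuous_on_param[OF this] show ?case by simp
  next
    case (Cons c cs)
    then obtain G where G: "G 0 = \<psi>" "\<And>k. k < m \<Longrightarrow> has_partial_derivative D c (G k) (G (Suc k))"
      "\<And>k. k \<le> m \<Longrightarrow> smooth_along D cs (m - k) (G k)" by auto
    have Lc: "L s (x + \<sigma> *\<^sub>R c) = L s x + \<sigma> *\<^sub>R c" for s x \<sigma>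
      using Cons.prems(2) by simp
    have "has_partial_derivative D c (\<lambda>x. integral {0..1} (\<lambda>s. G k (L s x)))
        (\<lambda>x. integral {0..1} (\<lambda>s. G (Suc k) (L s x)))" if k: "k < m" for k
      unfolding has_partial_derivative_def
    proof
      fix x assume x: "x \<in> D"
      let ?U = "{\<sigma>. x + \<sigma> *\<^sub>R c \<in> D}"
      have cont: "continuous_on (D \<times> {0..1}) (\<lambda>(x, s). G l (L s x))" if "l \<le> m" for l
        using comp[OF smooth_along_continuous[OF G(3)[OF that]]] .
      have "((\<lambda>\<sigma>. integral (cbox 0 1) (\<lambda>s. G k (L s (x + \<sigma> *\<^sub>R c)))) has_vector_derivative
          integral (cbox 0 1) (\<lambda>s. G (Suc k) (L s (x + 0 *\<^sub>R c)))) (at 0 within ?U)"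
      proof (rule leibniz_rule_vector_derivative)
        fix \<sigma> s :: real assume "\<sigma> \<in> ?U" "s \<in> cbox 0 1"
        then show "((\<lambda>\<sigma>. G k (L s (x + \<sigma> *\<^sub>R c))) has_vector_derivative G (Suc k) (L s (x + \<sigma> *\<^sub>R c)))
            (at \<sigma> within ?U)"
          using has_partial_derivative_line[OF G(2)[OF k], of ?U "L s x" 1 \<sigma>] L
          unfolding Lc by (simp flip: Lc)
      next
        fix \<sigma> assume "\<sigma> \<in> ?U"
        then have "continuous_on {0..1} (\<lambda>s. case (x + \<sigma> *\<^sub>R c, s) of (x, s) \<Rightarrow> G k (L s x))"
          using k by (intro continuous_on_compose2[OF cont[of k]] continuous_intros) auto
        then show "(\<lambda>s. G k (L s (x + \<sigma> *\<^sub>R c))) integrable_on cbox 0 1"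
          by (simp add: integrable_continuous_real)
      next
        have "continuous_on (?U \<times> {0..1})
            (\<lambda>z. case (x + fst z *\<^sub>R c, snd z) of (x, s) \<Rightarrow> G (Suc k) (L s x))"
          using k by (intro continuous_on_compose2[OF cont[of "Suc k"]] continuous_intros) auto
        then show "continuous_on (?U \<times> cbox 0 1) (\<lambda>(\<sigma>, s). G (Suc k) (L s (x + \<sigma> *\<^sub>R c)))"
          by (simp add: split_beta)
      qed (use x Cons.prems(3) in auto)
      then show "((\<lambda>\<sigma>. integral {0..1} (\<lambda>s. G k (L s (x + \<sigma> *\<^sub>R c)))) has_vector_derivative
          integral {0..1} (\<lambda>s. G (Suc k) (L s x))) (at 0 within ?U)" by simp
    qed
    moreover have "smooth_along D cs (m - k) (\<lambda>x. integral {0..1} (\<lambda>s. G k (L s x)))" if "k \<le> m" for k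
      using Cons.prems by (intro Cons.IH G(3)[OF that]) auto
    ultimately show ?case
      using G(1) by (auto intro!: exI[of _ "\<lambda>k x. integral {0..1} (\<lambda>s. G k (L s x))"])
  qed
qed

text \<open>The kernel in the integral form of the remainder is at most 1 on the unit interval, so
  the remainder inherits the bound of the last derivative. For \<open>m = 0\<close> there is no
  integral form and nothing to expand.\<close>

lemma Taylor_remainder_unit:
  fixes Df :: "nat \<Rightarrow> real \<Rightarrow> real"
  assumes "\<And>k s. k < m \<Longrightarrow> s \<in> {0..1} \<Longrightarrow>
      (Df k has_vector_derivative Df (Suc k) s) (at s within {0..1})"
    and B: "\<And>s. s \<in> {0..1} \<Longrightarrow> \<bar>Df m s\<bar> \<le> B"
  shows "\<bar>Df 0 1 - (\<Sum>k<m. Df k 0 / fact k)\<bar> \<le> B"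
proof (cases "m = 0")
  case True
  with B[of 1] show ?thesis by simp
next
  case False
  let ?i = "\<lambda>s. ((1 - s) ^ (m - 1) / fact (m - 1)) *\<^sub>R Df m s"
  note T = Taylor_integral[of m Df "Df 0" 0 1] Taylor_integrable[of m Df "Df 0" 0 1]
  have eq: "Df 0 1 = (\<Sum>k<m. (1 ^ k / fact k) *\<^sub>R Df k 0) + integral {0..1} ?i"
    using T(1) assms(1) False by simp
  have int: "?i integrable_on {0..1}"
    using T(2) assms(1) False by simp
  have "norm (integral {0..1} ?i) \<le> integral {0..1::real} (\<lambda>_. B)"
  proof (rule integral_norm_bound_integral[OF int])
    fix s :: real assume s: "s \<in> {0..1}"
    have "(1 - s) ^ (m - 1) / fact (m - 1) \<le> 1 / 1"
      using s by (intro frac_le) (auto simp: power_le_one fact_ge_1)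
    then have "\<bar>(1 - s) ^ (m - 1) / fact (m - 1)\<bar> * \<bar>Df m s\<bar> \<le> 1 * B"
      using s B[OF s] by (intro mult_mono) auto
    then show "norm (?i s) \<le> B" by (simp add: abs_mult)
  qed auto
  then show ?thesis
    using eq by (simp add: divide_inverse mult.commute)
qed

section \<open>Composition of smooth functions with expandable displacements\<close>

context step_family
begin

text \<open>
  Taylor expansion in one coordinate at a time: expanding in the first direction leaves partial
  derivatives evaluated at points that are displaced in the remaining directions only.
\<close>

lemma expandable_compose:
  fixes \<phi> :: "'a::euclidean_space \<Rightarrow> real"
  assumes "compact D" and "smooth_along D cs m \<phi>" and "distinct cs"
    and "\<And>c. c \<in> set cs \<Longrightarrow> expandable m (\<delta> c)"
    and "\<And>c. c \<in> set cs \<Longrightarrow> \<exists>C. \<forall>\<pi>\<in>P. \<forall>j\<in>stage_index tab. \<bar>\<delta> c \<pi> j\<bar> \<le> C * h \<pi>"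
    and "\<And>\<pi> j \<sigma>. \<pi> \<in> P \<Longrightarrow> j \<in> stage_index tab \<Longrightarrow> (\<And>c. \<sigma> c \<in> {0..1}) \<Longrightarrow>
      x0 \<pi> + (\<Sum>c\<leftarrow>cs. (\<sigma> c * \<delta> c \<pi> j) *\<^sub>R c) \<in> D"
  shows "expandable m (\<lambda>\<pi> j. \<phi> (x0 \<pi> + (\<Sum>c\<leftarrow>cs. \<delta> c \<pi> j *\<^sub>R c)))"
  using assms(2-)
proof (induction cs arbitrary: m \<phi>)
  case Nil
  \<comment> \<open>Here derivatives at the base point become coefficients: with no direction left,
    the value is the same at all stages and bounded on the compact domain.\<close>
  have "x0 \<pi> \<in> D" if "\<pi> \<in> P" for \<pi>
    using Nil(5)[OF that, of "Inr 0" "\<lambda>_. 0"] by (simp add: stage_index_def)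
  moreover have "bounded (\<phi> ` D)"
    using Nil(1) assms(1) by (simp add: compact_imp_bounded compact_continuous_image)
  moreover from this obtain B where "\<forall>x\<in>D. \<bar>\<phi> x\<bar> \<le> B"
    by (auto simp: bounded_iff)
  ultimately show ?case
    using expandable_const[of "\<lambda>\<pi>. \<phi> (x0 \<pi>)" B] by simp
next
  case (Cons c cs)
  obtain G where G0: "G 0 = \<phi>"
    and G: "\<And>k. k < m \<Longrightarrow> has_partial_derivative D c (G k) (G (Suc k))"
    and smooth: "\<And>k. k \<le> m \<Longrightarrow> smooth_along D cs (m - k) (G k)"
    using Cons.prems(1) by auto
  define X where "X \<pi> j = x0 \<pi> + (\<Sum>c\<leftarrow>cs. \<delta> c \<pi> j *\<^sub>R c)" for \<pi> j
  have in_D: "X \<pi> j + (s * \<delta> c \<pi> j) *\<^sub>R c \<in> D"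
    if "\<pi> \<in> P" "j \<in> stage_index tab" "s \<in> {0..1}" for \<pi> j s
  proof -
    \<comment> \<open>Only the displacement along \<open>c\<close> is scaled by \<open>s\<close>.
      Distinctness guarantees that \<open>c\<close> does not recur in \<open>cs\<close>.\<close>
    have "(\<Sum>c'\<leftarrow>cs. ((if c' = c then s else 1) * \<delta> c' \<pi> j) *\<^sub>R c') = (\<Sum>c\<leftarrow>cs. \<delta> c \<pi> j *\<^sub>R c)"
      using Cons.prems(2) by (intro arg_cong[where f = sum_list] map_cong) auto
    then show ?thesis
      using Cons.prems(5)[OF that(1,2), of "\<lambda>c'. if c' = c then s else 1"] that(3)
      by (simp add: X_def algebra_simps)
  qed
  have XD: "X \<pi> j \<in> D" if "\<pi> \<in> P" "j \<in> stage_index tab" for \<pi> j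
    using in_D[OF that, of 0] by simp
  \<comment> \<open>The k-th derivative along \<open>c\<close> has only \<open>m - k\<close>
    derivatives left, so the induction has to cover all orders and all functions.\<close>
  have IH: "expandable (m - k) (\<lambda>\<pi> j. G k (X \<pi> j))" if "k \<le> m" for k
    unfolding X_def
  proof (rule Cons.IH[OF smooth[OF that]])
    fix \<pi> j and \<sigma> :: "'a \<Rightarrow> real"
    assume *: "\<pi> \<in> P" "j \<in> stage_index tab" "\<And>c. \<sigma> c \<in> {0..1}"
    have "(\<Sum>c'\<leftarrow>cs. ((\<sigma>(c := 0)) c' * \<delta> c' \<pi> j) *\<^sub>R c') = (\<Sum>c\<leftarrow>cs. (\<sigma> c * \<delta> c \<pi> j) *\<^sub>R c)"
      using Cons.prems(2) by (intro arg_cong[where f = sum_list] map_cong) auto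
    then show "x0 \<pi> + (\<Sum>c\<leftarrow>cs. (\<sigma> c * \<delta> c \<pi> j) *\<^sub>R c) \<in> D"
      using Cons.prems(5)[OF *(1,2), of "\<sigma>(c := 0)"] *(3) by simp
  next
    fix c' assume "c' \<in> set cs"
    then have "expandable m (\<delta> c')" using Cons.prems(3) by simp
    then show "expandable (m - k) (\<delta> c')" by (rule expandable_antimono) simp
  qed (use Cons.prems(2,4) in auto)
  obtain C where C: "\<And>\<pi> j. \<pi> \<in> P \<Longrightarrow> j \<in> stage_index tab \<Longrightarrow> \<bar>\<delta> c \<pi> j\<bar> \<le> C * h \<pi>"
    using Cons.prems(4)[of c] by auto
  have Ck: "\<bar>\<delta> c \<pi> j ^ k\<bar> \<le> C ^ k * h \<pi> ^ k" if "\<pi> \<in> P" "j \<in> stage_index tab" for \<pi> j k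
    using C[OF that] by (simp add: power_abs power_mono flip: power_mult_distrib)
  let ?term = "\<lambda>k \<pi> j. 1 / fact k * (\<delta> c \<pi> j ^ k * G k (X \<pi> j))"
  have terms: "expandable m (\<lambda>\<pi> j. \<Sum>k<m. ?term k \<pi> j)"
  proof (intro expandable_sum expandable_scale)
    fix k assume "k \<in> {..<m}"
    then show "expandable m (\<lambda>\<pi> j. \<delta> c \<pi> j ^ k * G k (X \<pi> j))"
      using Cons.prems(3)[of c] Ck
      by (intro expandable_mult_small[of m k _ _ "C ^ k"] IH expandable_power) auto
  qed auto
  have "bounded (G m ` D)"
    using smooth[of m] assms(1) smooth_along_continuous
    by (intro compact_imp_bounded compact_continuous_image) auto
  then obtain B where B: "\<And>x. x \<in> D \<Longrightarrow> \<bar>G m x\<bar> \<le> B"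
    by (auto simp: bounded_iff)
  have path: "continuous_on {0..1} (\<lambda>\<tau>. X \<pi> (Inr \<tau>) + \<delta> c \<pi> (Inr \<tau>) *\<^sub>R c)" if "\<pi> \<in> P" for \<pi>
  proof -
    note \<delta> = Cons.prems(3)
    have "continuous_on {0..1} (\<lambda>\<tau>. \<Sum>c\<leftarrow>cs'. \<delta> c \<pi> (Inr \<tau>) *\<^sub>R c)" if "set cs' \<subseteq> set cs" for cs'
      using that
    proof (induction cs')
      case (Cons c' cs')
      then have "continuous_on {0..1} (\<lambda>\<tau>. \<delta> c' \<pi> (Inr \<tau>))"
        using expandable_continuous[OF \<delta> \<open>\<pi> \<in> P\<close>] by simp
      with Cons show ?case by (auto intro!: continuous_intros)
    qed simp
    from this[of cs] show ?thesis
      unfolding X_def using expandable_continuous[OF \<delta> \<open>\<pi> \<in> P\<close>, of c]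
      by (intro continuous_intros) auto
  qed
  have "expandable m (\<lambda>\<pi> j. \<phi> (X \<pi> j + \<delta> c \<pi> j *\<^sub>R c) - (\<Sum>k<m. ?term k \<pi> j))"
  proof (rule remainder[where C = "C ^ m * B"])
    fix \<pi> j assume \<pi>: "\<pi> \<in> P" "j \<in> stage_index tab"
    define Df where "Df k s = \<delta> c \<pi> j ^ k * G k (X \<pi> j + (s * \<delta> c \<pi> j) *\<^sub>R c)" for k s
    have "(Df k has_vector_derivative Df (Suc k) s) (at s within {0..1})"
      if "k < m" "s \<in> {0..1}" for k s
    proof -
      have "((\<lambda>s. \<delta> c \<pi> j ^ k * G k (X \<pi> j + (s * \<delta> c \<pi> j) *\<^sub>R c)) has_vector_derivative
          \<delta> c \<pi> j ^ k * (\<delta> c \<pi> j *\<^sub>R G (Suc k) (X \<pi> j + (s * \<delta> c \<pi> j) *\<^sub>R c))) (at s within {0..1})"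
        using has_partial_derivative_line[OF G[OF that(1)], of "{0..1}" "X \<pi> j" "\<delta> c \<pi> j" s]
          in_D[OF \<pi>] that(2) by (intro has_vector_derivative_mult_right) auto
      then show ?thesis by (simp add: Df_def[abs_def] mult_ac)
    qed
    moreover have "\<bar>Df m s\<bar> \<le> C ^ m * h \<pi> ^ m * B" if "s \<in> {0..1}" for s
      unfolding Df_def abs_mult[of "_ ^ m"]
      using Ck[OF \<pi>] B[OF in_D[OF \<pi> that]] by (intro mult_mono) (auto intro: order_trans[OF abs_ge_zero])
    ultimately have "\<bar>Df 0 1 - (\<Sum>k<m. Df k 0 / fact k)\<bar> \<le> C ^ m * h \<pi> ^ m * B"
      by (rule Taylor_remainder_unit)
    then show "\<bar>\<phi> (X \<pi> j + \<delta> c \<pi> j *\<^sub>R c) - (\<Sum>k<m. ?term k \<pi> j)\<bar> \<le> C ^ m * B * h \<pi> ^ m"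
      by (simp add: Df_def G0 mult_ac)
  next
    fix \<pi> assume \<pi>: "\<pi> \<in> P"
    have "continuous_on {0..1} (\<lambda>\<tau>. \<phi> (X \<pi> (Inr \<tau>) + \<delta> c \<pi> (Inr \<tau>) *\<^sub>R c))"
      by (rule continuous_on_compose2[OF smooth_along_continuous[OF Cons.prems(1)] path[OF \<pi>]])
        (use in_D[OF \<pi>, of _ 1] in \<open>auto simp: stage_index_def\<close>)
    then show "continuous_on {0..1} (\<lambda>\<tau>. \<phi> (X \<pi> (Inr \<tau>) + \<delta> c \<pi> (Inr \<tau>) *\<^sub>R c) -
        (\<Sum>k<m. ?term k \<pi> (Inr \<tau>)))"
      using expandable_continuous[OF terms \<pi>] by (intro continuous_on_diff) auto
  qed
  from add[OF this terms] show ?case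
    by (simp add: X_def algebra_simps)
qed

end

section \<open>The filter as an increment function\<close>

text \<open>
  Points are \<open>(r, u, \<theta>, t)\<close> as for the filter; \<open>f\<close> and \<open>g\<close> are used in the form
  \<open>(r, u, \<theta>, t) \<mapsto> f (u + r) t\<close>, so that only \<open>t\<close> and the displacement \<open>r\<close> of the base point
  \<open>u\<close> are differentiated.
\<close>

abbreviation time_dir :: "(real ^ 'n::finite) \<times> (real ^ 'n) \<times> real \<times> real"
  where "time_dir \<equiv> (0, 0, 0, 1)"

abbreviation space_dir :: "real ^ 'n \<Rightarrow> (real ^ 'n::finite) \<times> (real ^ 'n) \<times> real \<times> real"
  where "space_dir e \<equiv> (e, 0, 0, 0)"

definition basis_list :: "(real ^ 'n::finite) list"
  where "basis_list = (SOME bs. set bs = Basis \<and> distinct bs)"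

lemma set_basis_list: "set (basis_list :: (real ^ 'n::finite) list) = Basis"
  and distinct_basis_list: "distinct (basis_list :: (real ^ 'n) list)"
proof -
  have "\<exists>bs. set bs = (Basis :: (real ^ 'n) set) \<and> distinct bs"
    using finite_distinct_list[OF finite_Basis] by blast
  from someI_ex[OF this] show "set (basis_list :: (real ^ 'n) list) = Basis"
    "distinct (basis_list :: (real ^ 'n) list)"
    unfolding basis_list_def by auto
qed

abbreviation directions :: "((real ^ 'n::finite) \<times> (real ^ 'n) \<times> real \<times> real) list"
  where "directions \<equiv> time_dir # map space_dir basis_list"

text \<open>A box in \<open>r\<close>, not a ball, contains all intermediate points of an expansion
  in one coordinate at a time. The base point is never differentiated and ranges over a mere compact
  set.\<close>

definition box_domain ::
    "real \<Rightarrow> (real ^ 'n) set \<Rightarrow> real \<Rightarrow> real \<Rightarrow> ((real ^ 'n::finite) \<times> (real ^ 'n) \<times> real \<times> real) set"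
  where "box_domain \<rho> K \<theta>0 T = cbox (- (\<rho> *\<^sub>R One)) (\<rho> *\<^sub>R One) \<times> K \<times> {0..\<theta>0} \<times> {0..T}"

lemma mem_box_domain:
  "(r, u, \<theta>, t) \<in> box_domain \<rho> K \<theta>0 T \<longleftrightarrow>
    (\<forall>b\<in>Basis. \<bar>r \<bullet> b\<bar> \<le> \<rho>) \<and> u \<in> K \<and> \<theta> \<in> {0..\<theta>0} \<and> t \<in> {0..T}"
  by (auto simp: box_domain_def mem_box abs_le_iff minus_le_iff)

lemma compact_box_domain: "compact K \<Longrightarrow> compact (box_domain \<rho> K \<theta>0 T)"
  unfolding box_domain_def by (intro compact_Times) auto

lemma box_norm_le:
  fixes r :: "real ^ 'n::finite"
  assumes "\<forall>b\<in>Basis. \<bar>r \<bullet> b\<bar> \<le> \<rho>"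
  shows "norm r \<le> real CARD('n) * \<rho>"
proof -
  have "norm r \<le> (\<Sum>b\<in>Basis. \<bar>r \<bullet> b\<bar>)" by (rule norm_le_l1)
  also have "\<dots> \<le> real CARD('n) * \<rho>" using sum_bounded_above[of Basis "\<lambda>b. \<bar>r \<bullet> b\<bar>" \<rho>] assms by simp
  finally show ?thesis .
qed

section \<open>Slices of the box and smoothness on it\<close>

lemma nondegenerateI:
  assumes "\<And>x. x \<in> D \<Longrightarrow> \<exists>a b. a < b \<and> 0 \<in> {a..b} \<and> (\<forall>\<sigma>\<in>{a..b}. x + \<sigma> *\<^sub>R c \<in> D)"
  shows "nondegenerate D c"
  unfolding nondegenerate_def
proof
  fix x assume "x \<in> D"
  then obtain a b :: real where ab: "a < b" "0 \<in> {a..b}" "{a..b} \<subseteq> {\<sigma>. x + \<sigma> *\<^sub>R c \<in> D}"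
    using assms by blast
  have "0 islimpt {a..b}" using ab by simp
  then have "0 islimpt {\<sigma>. x + \<sigma> *\<^sub>R c \<in> D}" using ab(3) by (rule islimpt_subset)
  then show "at 0 within {\<sigma>. x + \<sigma> *\<^sub>R c \<in> D} \<noteq> bot" by (simp add: trivial_limit_within)
qed

lemma nondegenerate_time:
  assumes "0 < T"
  shows "nondegenerate (box_domain \<rho> K \<theta>0 T) time_dir"
proof (rule nondegenerateI, clarify)
  fix r u :: "real ^ 'a" and \<theta> t assume "(r, u, \<theta>, t) \<in> box_domain \<rho> K \<theta>0 T"
  then show "\<exists>a b. a < b \<and> 0 \<in> {a..b} \<and>
      (\<forall>\<sigma>\<in>{a..b}. (r, u, \<theta>, t) + \<sigma> *\<^sub>R time_dir \<in> box_domain \<rho> K \<theta>0 T)"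
    using assms by (intro exI[of _ "- t"] exI[of _ "T - t"]) (auto simp: mem_box_domain)
qed

lemma nondegenerate_theta:
  assumes "0 < \<theta>0"
  shows "nondegenerate (box_domain \<rho> K \<theta>0 T) (0, 0, 1, 0)"
proof (rule nondegenerateI, clarify)
  fix r u :: "real ^ 'a" and \<theta> t assume "(r, u, \<theta>, t) \<in> box_domain \<rho> K \<theta>0 T"
  then show "\<exists>a b. a < b \<and> 0 \<in> {a..b} \<and>
      (\<forall>\<sigma>\<in>{a..b}. (r, u, \<theta>, t) + \<sigma> *\<^sub>R (0, 0, 1, 0) \<in> box_domain \<rho> K \<theta>0 T)"
    using assms by (intro exI[of _ "- \<theta>"] exI[of _ "\<theta>0 - \<theta>"]) (auto simp: mem_box_domain)
qed

lemma nondegenerate_space: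
  assumes "0 < \<rho>" and "e \<in> Basis"
  shows "nondegenerate (box_domain \<rho> K \<theta>0 T) (space_dir e)"
proof (rule nondegenerateI, clarify)
  fix r u :: "real ^ 'a" and \<theta> t assume *: "(r, u, \<theta>, t) \<in> box_domain \<rho> K \<theta>0 T"
  then have "\<bar>r \<bullet> e\<bar> \<le> \<rho>" using assms(2) by (simp add: mem_box_domain)
  moreover have "(r, u, \<theta>, t) + \<sigma> *\<^sub>R space_dir e \<in> box_domain \<rho> K \<theta>0 T"
    if "\<sigma> \<in> {- \<rho> - r \<bullet> e..\<rho> - r \<bullet> e}" for \<sigma>
    using * that assms(2) by (auto simp: mem_box_domain inner_add_left inner_Basis abs_le_iff)
  ultimately show "\<exists>a b. a < b \<and> 0 \<in> {a..b} \<and>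
      (\<forall>\<sigma>\<in>{a..b}. (r, u, \<theta>, t) + \<sigma> *\<^sub>R space_dir e \<in> box_domain \<rho> K \<theta>0 T)"
    using assms(1) by (intro exI[of _ "- \<rho> - r \<bullet> e"] exI[of _ "\<rho> - r \<bullet> e"]) auto
qed

lemma nondegenerate_directions:
  "0 < T \<Longrightarrow> 0 < \<rho> \<Longrightarrow> c \<in> set directions \<Longrightarrow> nondegenerate (box_domain \<rho> K \<theta>0 T) c"
  using nondegenerate_time nondegenerate_space by (auto simp: set_basis_list)

lemma distinct_directions: "distinct (directions :: ((real ^ 'n::finite) \<times> _) list)"
  by (auto simp: distinct_map distinct_basis_list inj_on_def)

text \<open>Moving along a listed direction fixes \<open>u\<close> and \<theta>, so within one slice
  \<open>K\<close> can be replaced by the convex set consisting of \<open>u\<close> alone.\<close>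

lemma convex_slice:
  assumes "c \<in> set directions" and "x \<in> box_domain \<rho> K \<theta>0 T"
  shows "convex {\<sigma>. x + \<sigma> *\<^sub>R c \<in> box_domain \<rho> K \<theta>0 T}"
proof -
  obtain r u \<theta> t where x: "x = (r, u, \<theta>, t)" by (cases x)
  let ?S = "cbox (- (\<rho> *\<^sub>R One)) (\<rho> *\<^sub>R One) \<times> {u} \<times> {\<theta>} \<times> {0..T}"
  have eq: "{\<sigma>. x + \<sigma> *\<^sub>R c \<in> box_domain \<rho> K \<theta>0 T} = {\<sigma>. x + \<sigma> *\<^sub>R c \<in> ?S}"
    using assms unfolding x box_domain_def by auto
  have "convex ?S" by (intro convex_Times) auto
  show ?thesis
    unfolding eq
  proof (rule convexI)
    fix a b v w :: real
    assume "a \<in> {\<sigma>. x + \<sigma> *\<^sub>R c \<in> ?S}" "b \<in> {\<sigma>. x + \<sigma> *\<^sub>R c \<in> ?S}" "0 \<le> v" "0 \<le> w" "v + w = 1"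
    then have "v *\<^sub>R (x + a *\<^sub>R c) + w *\<^sub>R (x + b *\<^sub>R c) \<in> ?S"
      using \<open>convex ?S\<close> by (auto intro: convexD simp del: mem_Times_iff)
    also have "v *\<^sub>R (x + a *\<^sub>R c) + w *\<^sub>R (x + b *\<^sub>R c) = (v + w) *\<^sub>R x + (v *\<^sub>R a + w *\<^sub>R b) *\<^sub>R c"
      by (simp add: scaleR_add_left scaleR_add_right)
    finally show "v *\<^sub>R a + w *\<^sub>R b \<in> {\<sigma>. x + \<sigma> *\<^sub>R c \<in> ?S}"
      using \<open>v + w = 1\<close> by simp
  qed
qed

lemma concat_map2_replicate:
  assumes "length ks = length bs"
  shows "concat (map2 replicate ks (map \<iota> bs)) = map \<iota> (concat (map2 replicate ks bs))"
    and "length (concat (map2 replicate ks bs)) = sum_list ks"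
    and "set (concat (map2 replicate ks bs)) \<subseteq> set bs"
  using assms by (induction ks bs rule: list_induct2) auto

lemma smooth_along_directionsI:
  assumes "0 < T" and "0 < \<rho>"
    and "\<And>k es. set es \<subseteq> Basis \<Longrightarrow> length es + k \<le> m \<Longrightarrow>
      continuous_partial (box_domain \<rho> K \<theta>0 T) (replicate k time_dir @ map space_dir es) \<phi>"
  shows "smooth_along (box_domain \<rho> K \<theta>0 T) directions m \<phi>"
proof (rule smooth_alongI)
  fix ks :: "nat list"
  assume "length ks = length (directions :: ((real ^ 'a) \<times> _) list)" and sum: "sum_list ks \<le> m"
  then obtain k ks' where ks: "ks = k # ks'" "length ks' = length (basis_list :: (real ^ 'a) list)"
    by (cases ks) auto
  note c = concat_map2_replicate[OF ks(2)]
  have "continuous_partial (box_domain \<rho> K \<theta>0 T)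
      (replicate k time_dir @ map space_dir (concat (map2 replicate ks' basis_list))) \<phi>"
    using sum ks(1) c(2,3) by (intro assms(3)) (simp_all only: set_basis_list, simp)
  then show "continuous_partial (box_domain \<rho> K \<theta>0 T) (concat (map2 replicate ks directions)) \<phi>"
    unfolding c(1)[of space_dir, symmetric] by (simp add: ks(1))
qed (rule nondegenerate_directions[OF assms(1,2)])

lemma smooth_along_field:
  fixes f :: "'n::finite vec_field"
  assumes "0 < T" and "0 < \<rho>" and "m \<le> p" and "C_upto p (Y \<times> {0..T}) (\<lambda>(u, t). f u t)"
    and "\<And>u r. u \<in> K \<Longrightarrow> \<forall>b\<in>Basis. \<bar>r \<bullet> b\<bar> \<le> \<rho> \<Longrightarrow> u + r \<in> Y"
  shows "smooth_along (box_domain \<rho> K \<theta>0 T) directions m (\<lambda>(r, u, \<theta>, t). f (u + r) t)"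
proof (rule smooth_along_directionsI)
  fix k and es :: "(real ^ 'n) list" assume es: "set es \<subseteq> Basis" "length es + k \<le> m"
  let ?\<iota> = "\<lambda>c :: (real ^ 'n) \<times> (real ^ 'n) \<times> real \<times> real. (fst c, snd (snd (snd c)))"
  let ?L = "\<lambda>c :: (real ^ 'n) \<times> (real ^ 'n) \<times> real \<times> real. (fst (snd c) + fst c, snd (snd (snd c)))"
  let ?es = "replicate k time_dir @ map space_dir es"
  have "set (map ?\<iota> ?es) \<subseteq> Basis" "length (map ?\<iota> ?es) \<le> p"
    using assms(3) es by (auto simp: Basis_prod_def)
  then have "continuous_partial (Y \<times> {0..T}) (map ?\<iota> ?es) (\<lambda>(u, t). f u t)"
    using assms(4)[unfolded C_upto_def, rule_format] by (simp only: simp_thms)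
  then have "continuous_partial (box_domain \<rho> K \<theta>0 T) ?es (\<lambda>x. case ?L x of (u, t) \<Rightarrow> f u t)"
  proof (rule continuous_partial_pullback)
    show "?L x \<in> Y \<times> {0..T}" if "x \<in> box_domain \<rho> K \<theta>0 T" for x
      using that assms(5) by (cases x) (auto simp: mem_box_domain)
    show "?L (x + \<sigma> *\<^sub>R c) = ?L x + \<sigma> *\<^sub>R ?\<iota> c" if "c \<in> set ?es" for c x \<sigma>
      using that by auto
  qed (intro continuous_intros)
  then show "continuous_partial (box_domain \<rho> K \<theta>0 T) ?es (\<lambda>(r, u, \<theta>, t). f (u + r) t)"
    by (simp add: case_prod_unfold)
qed fact+

lemma implicit_step_filterD:
  assumes "implicit_step_filter p T \<theta>M U V Y \<theta>B \<F> g"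
  shows "open U" and "open Y" and "0 \<in> U" and "0 < \<theta>B" and "\<theta>B \<le> \<theta>M"
    and "\<forall>r\<in>U. \<forall>y\<in>Y. \<forall>\<theta>\<in>{0..\<theta>B}. \<forall>t\<in>{0..T}. \<F> r y \<theta> t g \<noteq> None"
    and "\<forall>y\<in>Y. \<forall>\<theta>\<in>{0..\<theta>M}. \<forall>t\<in>{0..T}. \<F> 0 y \<theta> t g \<noteq> None \<longrightarrow> \<F> 0 y \<theta> t g = Some 0"
    and "\<forall>r\<in>U. \<forall>y\<in>Y. \<forall>t\<in>{0..T}. \<F> r y 0 t g = Some r"
    and "\<forall>n m es. n \<le> 1 \<and> set es \<subseteq> Basis \<and> length es + m \<le> p \<longrightarrow>
       continuous_partial (U \<times> Y \<times> {0..\<theta>B} \<times> {0..T})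
         (replicate n (0, 0, 1, 0) @ replicate m (0, 0, 0, 1) @ map (\<lambda>e. (e, 0, 0, 0)) es)
         (\<lambda>(r, y, \<theta>, t). the (\<F> r y \<theta> t g))"
  using assms unfolding implicit_step_filter_def by - (elim conjE, assumption)+

text \<open>The increment function is the mean of \<open>\<partial>\<^sub>\<theta> \<F>\<close> over \<open>[0, \<theta>]\<close>.\<close>

lemma filter_increment:
  fixes \<F> :: "'n::finite step_filter"
  assumes filter: "implicit_step_filter p T \<theta>M U V Y \<theta>B \<F> g"
    and "0 < T" and "0 < \<rho>" and "0 < \<theta>0" and "\<theta>0 \<le> \<theta>B" and "K \<subseteq> Y"
    and box: "\<And>r. \<forall>b\<in>Basis. \<bar>r \<bullet> b\<bar> \<le> \<rho> \<Longrightarrow> r \<in> U"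
  obtains \<Psi> :: "(real ^ 'n) \<times> (real ^ 'n) \<times> real \<times> real \<Rightarrow> real ^ 'n"
  where "\<And>m. m \<le> p \<Longrightarrow> smooth_along (box_domain \<rho> K \<theta>0 T) directions m \<Psi>"
    and "\<And>r u \<theta> t. (r, u, \<theta>, t) \<in> box_domain \<rho> K \<theta>0 T \<Longrightarrow>
      \<F> r u \<theta> t g = Some (r + \<theta> *\<^sub>R \<Psi> (r, u, \<theta>, t))"
    and "\<And>u \<theta> t. (0, u, \<theta>, t) \<in> box_domain \<rho> K \<theta>0 T \<Longrightarrow> 0 < \<theta> \<Longrightarrow> \<Psi> (0, u, \<theta>, t) = 0"
proof -
  let ?D = "box_domain \<rho> K \<theta>0 T" and ?\<theta> = "(0, 0, 1, 0) :: (real ^ 'n) \<times> (real ^ 'n) \<times> real \<times> real"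
  define H where "H = (\<lambda>(r, u, \<theta>, t). the (\<F> r u \<theta> t g))"
  define \<psi> where "\<psi> = partial_derivative ?D ?\<theta> H"
  define L :: "real \<Rightarrow> (real ^ 'n) \<times> (real ^ 'n) \<times> real \<times> real \<Rightarrow> _"
    where "L s = (\<lambda>(r, u, \<theta>, t). (r, u, s * \<theta>, t))" for s
  define \<Psi> where "\<Psi> x = integral {0..1} (\<lambda>s. \<psi> (L s x))" for x
  have D_sub: "x \<in> U \<times> Y \<times> {0..\<theta>B} \<times> {0..T}" if "x \<in> ?D" for x
    using that assms(5-7) by (cases x) (auto simp: mem_box_domain)
  have H: "continuous_partial ?D (?\<theta> # replicate k time_dir @ map space_dir es) H"
    if "set es \<subseteq> Basis" "length es + k \<le> p" for k es
  proof -
    have "continuous_partial (U \<times> Y \<times> {0..\<theta>B} \<times> {0..T})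
         (replicate 1 ?\<theta> @ replicate k time_dir @ map space_dir es) H"
      unfolding H_def by (rule implicit_step_filterD(9)[OF filter, rule_format]) (use that in simp)
    \<comment> \<open>The list is written as a \<open>map\<close> of the identity, so that
      restriction to the box becomes an instance of the pullback.\<close>
    then have "continuous_partial (U \<times> Y \<times> {0..\<theta>B} \<times> {0..T})
         (map (\<lambda>c. c) (?\<theta> # replicate k time_dir @ map space_dir es)) H"
      by simp
    then show ?thesis
      by (rule continuous_partial_pullback) (use D_sub in \<open>auto intro: continuous_intros\<close>)
  qed
  note nd = nondegenerate_theta[OF \<open>0 < \<theta>0\<close>, of \<rho> K T]
  \<comment> \<open>The one derivative in \<theta> has been spent; all \<open>p\<close> derivatives
    in \<open>t\<close> and \<open>r\<close> are still available.\<close>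
  have \<psi>_smooth: "smooth_along ?D directions m \<psi>" if "m \<le> p" for m
  proof (rule smooth_along_directionsI[OF \<open>0 < T\<close> \<open>0 < \<rho>\<close>])
    fix k and es :: "(real ^ 'n) list" assume es: "set es \<subseteq> Basis" "length es + k \<le> m"
    show "continuous_partial ?D (replicate k time_dir @ map space_dir es) \<psi>"
      unfolding \<psi>_def using es that by (intro continuous_partial_Cons(2)[OF nd] H) auto
  qed
  have \<psi>_deriv: "has_partial_derivative ?D ?\<theta> H \<psi>"
    unfolding \<psi>_def using H[of "[]" 0] by (intro continuous_partial_Cons(1)[OF nd, of "[]"]) auto
  have LD: "L s x \<in> ?D" if "x \<in> ?D" "s \<in> {0..1}" for s x
    using that by (cases x) (auto simp: L_def mem_box_domain intro: order_trans[OF mult_right_mono[of s 1]])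
  have contL: "continuous_on (?D \<times> {0..1}) (\<lambda>(x, s). L s x)"
    unfolding L_def split_beta by (intro continuous_intros)
  have smooth: "smooth_along ?D directions m \<Psi>" if "m \<le> p" for m
    unfolding \<Psi>_def
    by (rule smooth_along_integral[OF \<psi>_smooth[OF that] contL LD _ convex_slice])
      (auto simp: L_def)
  have incr: "\<F> r u \<theta> t g = Some (r + \<theta> *\<^sub>R \<Psi> (r, u, \<theta>, t))" if x: "(r, u, \<theta>, t) \<in> ?D" for r u \<theta> t
  proof -
    have line: "(r, u, 0, t) + (s * \<theta>) *\<^sub>R ?\<theta> = L s (r, u, \<theta>, t)" for s
      by (simp add: L_def)
    have "((\<lambda>s. \<theta> *\<^sub>R \<psi> (L s (r, u, \<theta>, t))) has_integral
        (H (L 1 (r, u, \<theta>, t)) - H (L 0 (r, u, \<theta>, t)))) {0..1}"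
    proof (rule fundamental_theorem_of_calculus)
      fix s :: real assume "s \<in> {0..1}"
      then show "((\<lambda>s. H (L s (r, u, \<theta>, t))) has_vector_derivative \<theta> *\<^sub>R \<psi> (L s (r, u, \<theta>, t)))
          (at s within {0..1})"
        using has_partial_derivative_line[OF \<psi>_deriv, of "{0..1}" "(r, u, 0, t)" \<theta> s] LD[OF x]
        unfolding line by blast
    qed simp
    then have "\<theta> *\<^sub>R \<Psi> (r, u, \<theta>, t) = H (L 1 (r, u, \<theta>, t)) - H (L 0 (r, u, \<theta>, t))"
      unfolding \<Psi>_def by (simp add: integral_unique flip: integral_cmul)
    moreover have "\<F> r u 0 t g = Some r" "\<F> r u \<theta> t g \<noteq> None"
      using D_sub[OF x] implicit_step_filterD(6,8)[OF filter] by auto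
    ultimately show ?thesis by (auto simp: H_def L_def)
  qed
  have "\<Psi> (0, u, \<theta>, t) = 0" if x: "(0, u, \<theta>, t) \<in> ?D" and "0 < \<theta>" for u \<theta> t
  proof -
    have "u \<in> Y" "\<theta> \<in> {0..\<theta>M}" "t \<in> {0..T}"
      using D_sub[OF x] implicit_step_filterD(5)[OF filter] by auto
    then have "\<F> 0 u \<theta> t g = Some 0"
      using implicit_step_filterD(7)[OF filter] incr[OF x] by auto
    with incr[OF x] \<open>0 < \<theta>\<close> show ?thesis by simp
  qed
  with smooth incr that show ?thesis by blast
qed

context step_family
begin

text \<open>The displacements are the elapsed time \<open>\<delta>\<close> and the coordinates of
  \<open>r\<close>. Base point and \<theta> are common to all stages and thus remain inside the
  coefficients.\<close>

lemma expandable_compose_box: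
  fixes \<phi> :: "(real ^ 'n::finite) \<times> (real ^ 'n) \<times> real \<times> real \<Rightarrow> real ^ 'n"
  assumes K: "compact K" and \<phi>: "smooth_along (box_domain \<rho> K \<theta>0 T) directions m \<phi>"
    and \<delta>: "expandable m \<delta>"
    and r: "\<And>b. b \<in> Basis \<Longrightarrow> expandable m (\<lambda>\<pi> j. r \<pi> j \<bullet> b)"
    and \<delta>_small: "\<And>\<pi> j. \<pi> \<in> P \<Longrightarrow> j \<in> stage_index tab \<Longrightarrow> 0 \<le> \<delta> \<pi> j \<and> \<delta> \<pi> j \<le> h \<pi>"
    and r_small: "\<And>\<pi> j. \<pi> \<in> P \<Longrightarrow> j \<in> stage_index tab \<Longrightarrow> norm (r \<pi> j) \<le> C * h \<pi>"
    and dom: "\<And>\<pi> j. \<pi> \<in> P \<Longrightarrow> j \<in> stage_index tab \<Longrightarrow>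
      norm (r \<pi> j) \<le> \<rho> \<and> u \<pi> \<in> K \<and> \<theta> \<pi> \<in> {0..\<theta>0} \<and> 0 \<le> t \<pi> \<and> t \<pi> + \<delta> \<pi> j \<le> T"
  shows "expandable m (\<lambda>\<pi> j. \<phi> (r \<pi> j, u \<pi>, \<theta> \<pi>, t \<pi> + \<delta> \<pi> j) \<bullet> b)"
proof -
  define \<Delta> where "\<Delta> c = (if c = time_dir then \<delta> else (\<lambda>\<pi> j. r \<pi> j \<bullet> fst c))"
    for c :: "(real ^ 'n) \<times> (real ^ 'n) \<times> real \<times> real"
  have \<Delta>_space: "\<Delta> (space_dir e) = (\<lambda>\<pi> j. r \<pi> j \<bullet> e)" for e
    by (simp add: \<Delta>_def)
  have list_sum: "(\<Sum>e\<leftarrow>bs. (a e) *\<^sub>R space_dir e) = space_dir (\<Sum>e\<leftarrow>bs. a e *\<^sub>R e)" for a and bs :: "(real ^ 'n) list"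
    by (induction bs) (simp_all add: zero_prod_def)
  have sum: "(0, u \<pi>, \<theta> \<pi>, t \<pi>) + (\<Sum>c\<leftarrow>directions. (\<sigma> c * \<Delta> c \<pi> j) *\<^sub>R c) =
      (\<Sum>e\<in>Basis. (\<sigma> (space_dir e) * (r \<pi> j \<bullet> e)) *\<^sub>R e, u \<pi>, \<theta> \<pi>, t \<pi> + \<sigma> time_dir * \<delta> \<pi> j)" for \<sigma> \<pi> j
  proof -
    have "(\<Sum>c\<leftarrow>map space_dir basis_list. (\<sigma> c * \<Delta> c \<pi> j) *\<^sub>R c) =
        space_dir (\<Sum>e\<leftarrow>basis_list. (\<sigma> (space_dir e) * (r \<pi> j \<bullet> e)) *\<^sub>R e)"
      unfolding list_sum[symmetric] by (simp add: o_def \<Delta>_space)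
    also have "(\<Sum>e\<leftarrow>basis_list. (\<sigma> (space_dir e) * (r \<pi> j \<bullet> e)) *\<^sub>R e) =
        (\<Sum>e\<in>Basis. (\<sigma> (space_dir e) * (r \<pi> j \<bullet> e)) *\<^sub>R e)"
      by (simp only: sum_list_distinct_conv_sum_set[OF distinct_basis_list] set_basis_list)
    finally show ?thesis by (simp add: \<Delta>_def)
  qed
  have rb: "\<bar>r \<pi> j \<bullet> e\<bar> \<le> norm (r \<pi> j)" if "e \<in> Basis" for \<pi> j e
    using Basis_le_norm[OF that] .
  have "expandable m (\<lambda>\<pi> j. (\<phi> ((0, u \<pi>, \<theta> \<pi>, t \<pi>) + (\<Sum>c\<leftarrow>directions. \<Delta> c \<pi> j *\<^sub>R c))) \<bullet> b)"
  proof (rule expandable_compose[OF compact_box_domain[OF K] smooth_along_inner[OF \<phi>] distinct_directions])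
    fix c assume c: "c \<in> set (directions :: ((real ^ 'n) \<times> _) list)"
    then show "expandable m (\<Delta> c)"
      using \<delta> r by (auto simp: \<Delta>_space set_basis_list) (simp add: \<Delta>_def)
    have "\<bar>\<Delta> c \<pi> j\<bar> \<le> max 1 C * h \<pi>" if \<pi>: "\<pi> \<in> P" "j \<in> stage_index tab" for \<pi> j
    proof -
      have le: "1 * h \<pi> \<le> max 1 C * h \<pi>" "C * h \<pi> \<le> max 1 C * h \<pi>"
        using h_pos[OF \<pi>(1)] by (intro mult_right_mono; simp)+
      show ?thesis
      proof (cases "c = time_dir")
        case True
        then show ?thesis using \<delta>_small[OF \<pi>] le(1) by (simp add: \<Delta>_def)
      next
        case False
        then obtain e where "c = space_dir e" "e \<in> Basis" using c by (auto simp: set_basis_list)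
        then show ?thesis using r_small[OF \<pi>] rb[of e \<pi> j] le(2) by (simp add: \<Delta>_space)
      qed
    qed
    then show "\<exists>C. \<forall>\<pi>\<in>P. \<forall>j\<in>stage_index tab. \<bar>\<Delta> c \<pi> j\<bar> \<le> C * h \<pi>" by blast
  next
    fix \<pi> j and \<sigma> :: "(real ^ 'n) \<times> (real ^ 'n) \<times> real \<times> real \<Rightarrow> real"
    assume \<pi>: "\<pi> \<in> P" "j \<in> stage_index tab" and \<sigma>: "\<And>c. \<sigma> c \<in> {0..1}"
    have "\<bar>\<sigma> (space_dir e) * (r \<pi> j \<bullet> e)\<bar> \<le> 1 * \<rho>" if "e \<in> Basis" for e
      unfolding abs_mult using \<sigma>[of "space_dir e"] dom[OF \<pi>] rb[OF that, of \<pi> j]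
      by (intro mult_mono) auto
    moreover have "0 \<le> \<sigma> time_dir * \<delta> \<pi> j" "\<sigma> time_dir * \<delta> \<pi> j \<le> 1 * \<delta> \<pi> j"
      using \<sigma>[of time_dir] \<delta>_small[OF \<pi>] by (simp, intro mult_right_mono) auto
    ultimately show "(0, u \<pi>, \<theta> \<pi>, t \<pi>) + (\<Sum>c\<leftarrow>directions. (\<sigma> c * \<Delta> c \<pi> j) *\<^sub>R c)
        \<in> box_domain \<rho> K \<theta>0 T"
      unfolding sum mem_box_domain using dom[OF \<pi>] by auto
  qed
  then show ?thesis
    using sum[where \<sigma> = "\<lambda>_. 1"] by (simp add: euclidean_representation)
qed

end

section \<open>Picard iterates and stage values\<close>

text \<open>The step is rescaled to \<tau> in [0, 1], so that the iterates live on the continuous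
  stages.\<close>

primrec picard :: "'n::finite vec_field \<Rightarrow> real \<Rightarrow> real \<Rightarrow> real ^ 'n \<Rightarrow> nat \<Rightarrow> real \<Rightarrow> real ^ 'n"
  where
    "picard \<phi> h t u 0 = (\<lambda>\<tau>. u)"
  | "picard \<phi> h t u (Suc m) =
       (\<lambda>\<tau>. u + h *\<^sub>R integral {0..\<tau>} (\<lambda>\<sigma>. \<phi> (picard \<phi> h t u m \<sigma>) (t + \<sigma> * h)))"

text \<open>By \<open>h * B \<le> \<rho>\<close> no iterate leaves the ball in which the field is
  continuous and bounded by \<open>B\<close>. The claims support each other and go through one
  induction.\<close>

lemma picard_properties:
  fixes \<phi> :: "'n::finite vec_field"
  assumes cont: "continuous_on (cball 0 \<rho> \<times> {0..T}) (\<lambda>(v, s). \<phi> (u + v) s)"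
    and bound: "\<And>v s. norm v \<le> \<rho> \<Longrightarrow> s \<in> {0..T} \<Longrightarrow> norm (\<phi> (u + v) s) \<le> B"
    and "0 < h" and "0 \<le> B" and "h * B \<le> \<rho>" and "0 \<le> t" and "t + h \<le> T"
  shows "continuous_on {0..1} (picard \<phi> h t u m)"
    and "\<And>\<tau>. \<tau> \<in> {0..1} \<Longrightarrow> norm (picard \<phi> h t u m \<tau> - u) \<le> h * B"
    and "continuous_on {0..1} (\<lambda>\<sigma>. \<phi> (picard \<phi> h t u m \<sigma>) (t + \<sigma> * h))"
proof -
  have time: "t + \<sigma> * h \<in> {0..T}" if "\<sigma> \<in> {0..1}" for \<sigma>
  proof -
    have "\<sigma> * h \<le> 1 * h" "0 \<le> \<sigma> * h"
      using that assms(3) by (auto intro!: mult_right_mono simp del: mult_1)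
    then show ?thesis using assms(6,7) by auto
  qed
  have "0 \<le> T" using assms(3,6,7) by simp
  have field: "continuous_on {0..1} (\<lambda>\<sigma>. \<phi> (Z \<sigma>) (t + \<sigma> * h))"
    if "continuous_on {0..1} Z" "\<And>\<tau>. \<tau> \<in> {0..1} \<Longrightarrow> norm (Z \<tau> - u) \<le> h * B" for Z
  proof -
    have "continuous_on {0..1} (\<lambda>\<sigma>. case (Z \<sigma> - u, t + \<sigma> * h) of (v, s) \<Rightarrow> \<phi> (u + v) s)"
    proof (rule continuous_on_compose2[OF cont])
      show "continuous_on {0..1} (\<lambda>\<sigma>. (Z \<sigma> - u, t + \<sigma> * h))"
        using that(1) by (intro continuous_intros)
      show "(\<lambda>\<sigma>. (Z \<sigma> - u, t + \<sigma> * h)) ` {0..1} \<subseteq> cball 0 \<rho> \<times> {0..T}"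
        using that(2) time assms(5) by fastforce
    qed
    then show ?thesis by simp
  qed
  have "0 \<le> h * B \<and> continuous_on {0..1} (picard \<phi> h t u m) \<and>
    (\<forall>\<tau>\<in>{0..1}. norm (picard \<phi> h t u m \<tau> - u) \<le> h * B) \<and>
    continuous_on {0..1} (\<lambda>\<sigma>. \<phi> (picard \<phi> h t u m \<sigma>) (t + \<sigma> * h))" for m
  proof (induction m)
    case 0
    have "0 \<le> h * B" using assms(3,4) by simp
    then show ?case using field[of "\<lambda>_. u"] by simp
  next
    case (Suc m)
    let ?f = "\<lambda>\<sigma>. \<phi> (picard \<phi> h t u m \<sigma>) (t + \<sigma> * h)"
    have "continuous_on {0..1} (\<lambda>\<tau>. integral {0..\<tau>} ?f)"
      using Suc by (intro indefinite_integral_continuous_1 integrable_continuous_real) simp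
    then have c: "continuous_on {0..1} (picard \<phi> h t u (Suc m))"
      by (auto intro!: continuous_intros)
    have B: "norm (?f \<sigma>) \<le> B" if "\<sigma> \<in> {0..1}" for \<sigma>
      using bound[of "picard \<phi> h t u m \<sigma> - u" "t + \<sigma> * h"] Suc that time assms(5) by force
    have n: "norm (picard \<phi> h t u (Suc m) \<tau> - u) \<le> h * B" if \<tau>: "\<tau> \<in> {0..1}" for \<tau>
    proof -
      have "norm (integral {0..\<tau>} ?f) \<le> B * (\<tau> - 0)"
        using Suc \<tau> B by (intro integral_bound) (auto elim: continuous_on_subset)
      also have "\<dots> \<le> B * 1"
        using \<tau> Suc \<open>0 < h\<close> by (intro mult_left_mono) (auto simp: zero_le_mult_iff)
      finally show ?thesis using \<open>0 < h\<close> by simp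
    qed
    show ?case using Suc c n field[OF c n] by blast
  qed
  then show "continuous_on {0..1} (picard \<phi> h t u m)"
    and "\<And>\<tau>. \<tau> \<in> {0..1} \<Longrightarrow> norm (picard \<phi> h t u m \<tau> - u) \<le> h * B"
    and "continuous_on {0..1} (\<lambda>\<sigma>. \<phi> (picard \<phi> h t u m \<sigma>) (t + \<sigma> * h))"
    by blast+
qed

text \<open>The algorithm with the filter written as r + \<theta> \<Psi>: since d = r - \<theta> k
  1, the quotient (\<eta> - d) / \<theta> becomes k 1 + \<Psi>, free of a division by the step size.
  The number \<open>s\<close> of stages is a parameter so that stages can be added one by one; the
  bounds by \<open>\<rho>\<close> keep every evaluation inside the domain.\<close>

definition stage_equations ::
    "imex_tableau \<Rightarrow> real \<Rightarrow> 'n::finite vec_field \<Rightarrow> 'n vec_field \<Rightarrow>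
     ((real ^ 'n) \<times> (real ^ 'n) \<times> real \<times> real \<Rightarrow> real ^ 'n) \<Rightarrow> real \<Rightarrow> real \<Rightarrow> real ^ 'n \<Rightarrow> nat \<Rightarrow>
     (nat \<Rightarrow> real ^ 'n) \<Rightarrow> (nat \<Rightarrow> real ^ 'n) \<Rightarrow> bool"
  where "stage_equations tab \<rho> f g \<Psi> h t u s k k' \<longleftrightarrow>
    k 1 = g u t \<and> k' 1 = f u t \<and>
    (\<forall>i\<in>{2..s}. \<exists>r \<eta>.
       r = h *\<^sub>R (\<Sum>j=1..<i. impl tab i j *\<^sub>R k j + expl tab i j *\<^sub>R k' j) + (h * diag tab) *\<^sub>R k 1 \<and>
       \<eta> = r + (h * diag tab) *\<^sub>R \<Psi> (r, u, h * diag tab, t + node tab i * h) \<and>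
       norm r \<le> \<rho> \<and> norm \<eta> \<le> \<rho> \<and>
       k i = k 1 + \<Psi> (r, u, h * diag tab, t + node tab i * h) \<and>
       k' i = f (u + \<eta>) (t + node tab i * h) + g (u + \<eta>) (t + node tab i * h) - k i)"

locale simex_increment =
  fixes tab :: imex_tableau and p :: nat and T \<rho> \<theta>0 :: real
    and K :: "(real ^ 'n::finite) set" and f g :: "'n vec_field"
    and \<Psi> :: "(real ^ 'n) \<times> (real ^ 'n) \<times> real \<times> real \<Rightarrow> real ^ 'n"
  assumes esdirk: "imex_esdirk tab"
    and nodes: "\<And>i. i \<in> {1..stages tab} \<Longrightarrow> 0 \<le> node tab i \<and> node tab i \<le> 1"
    and order: "imex_order tab p"
    and pos: "0 < T" "0 < \<rho>" "0 < \<theta>0"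
    and K: "compact K"
    and smooth_f: "\<And>m. m \<le> p \<Longrightarrow>
      smooth_along (box_domain \<rho> K \<theta>0 T) directions m (\<lambda>(r, u, \<theta>, t). f (u + r) t)"
    and smooth_g: "\<And>m. m \<le> p \<Longrightarrow>
      smooth_along (box_domain \<rho> K \<theta>0 T) directions m (\<lambda>(r, u, \<theta>, t). g (u + r) t)"
    and smooth_\<Psi>: "\<And>m. m \<le> p \<Longrightarrow> smooth_along (box_domain \<rho> K \<theta>0 T) directions m \<Psi>"
    and \<Psi>_zero: "\<And>u \<theta> t. (0, u, \<theta>, t) \<in> box_domain \<rho> K \<theta>0 T \<Longrightarrow> 0 < \<theta> \<Longrightarrow> \<Psi> (0, u, \<theta>, t) = 0"
begin

abbreviation "\<gamma> \<equiv> diag tab"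
abbreviation "\<phi> \<equiv> \<lambda>u t. f u t + g u t"

lemma \<gamma>_pos: "0 < \<gamma>"
  using esdirk by (simp add: imex_esdirk_def)

lemma in_domain:
  assumes "norm r \<le> \<rho>" and "u \<in> K" and "\<theta> \<in> {0..\<theta>0}" and "t \<in> {0..T}"
  shows "(r, u, \<theta>, t) \<in> box_domain \<rho> K \<theta>0 T"
  unfolding mem_box_domain using assms by (auto intro: order_trans[OF Basis_le_norm])

lemma bounds:
  obtains B where "0 < B"
    and "\<And>r u t. norm r \<le> \<rho> \<Longrightarrow> u \<in> K \<Longrightarrow> t \<in> {0..T} \<Longrightarrow> norm (f (u + r) t) \<le> B"
    and "\<And>r u t. norm r \<le> \<rho> \<Longrightarrow> u \<in> K \<Longrightarrow> t \<in> {0..T} \<Longrightarrow> norm (g (u + r) t) \<le> B"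
    and "\<And>r u \<theta> t. norm r \<le> \<rho> \<Longrightarrow> u \<in> K \<Longrightarrow> \<theta> \<in> {0..\<theta>0} \<Longrightarrow> t \<in> {0..T} \<Longrightarrow> norm (\<Psi> (r, u, \<theta>, t)) \<le> B"
proof -
  let ?D = "box_domain \<rho> K \<theta>0 T"
  have "\<exists>B. \<forall>x\<in>?D. norm (F x) \<le> B" if "smooth_along ?D directions 0 F" for F :: "_ \<Rightarrow> real ^ 'n"
    using compact_imp_bounded[OF compact_continuous_image[OF smooth_along_continuous[OF that]
        compact_box_domain[OF K]]] by (auto simp: bounded_iff)
  from this[OF smooth_f] this[OF smooth_g] this[OF smooth_\<Psi>] obtain B1 B2 B3
    where B: "\<forall>x\<in>?D. norm (case x of (r, u, \<theta>, t) \<Rightarrow> f (u + r) t) \<le> B1"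
      "\<forall>x\<in>?D. norm (case x of (r, u, \<theta>, t) \<Rightarrow> g (u + r) t) \<le> B2" "\<forall>x\<in>?D. norm (\<Psi> x) \<le> B3"
    by auto
  show thesis
  proof (rule that[of "max 1 (max B1 (max B2 B3))"])
    fix r u :: "real ^ 'n" and t assume *: "norm r \<le> \<rho>" "u \<in> K" "t \<in> {0..T}"
    show "norm (f (u + r) t) \<le> max 1 (max B1 (max B2 B3))"
      "norm (g (u + r) t) \<le> max 1 (max B1 (max B2 B3))"
      \<comment> \<open>The fields do not depend on \<theta>; the value 0 is a placeholder.\<close>
      using B(1,2)[rule_format, OF in_domain[OF *(1,2) _ *(3), of 0]] pos by auto
    show "norm (\<Psi> (r, u, \<theta>, t)) \<le> max 1 (max B1 (max B2 B3))" if "\<theta> \<in> {0..\<theta>0}" for \<theta>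
      using B(3)[rule_format, OF in_domain[OF *(1,2) that *(3)]] by auto
  qed auto
qed

lemma continuous_field:
  assumes "u \<in> K"
  shows "continuous_on (cball 0 \<rho> \<times> {0..T}) (\<lambda>(v, s). \<phi> (u + v) s)"
proof -
  have sub: "(\<lambda>(v, s). (v, u, 0, s)) ` (cball 0 \<rho> \<times> {0..T}) \<subseteq> box_domain \<rho> K \<theta>0 T"
    using in_domain assms pos by auto
  have "continuous_on (cball 0 \<rho> \<times> {0..T}) (\<lambda>(v, s). (v, u, 0::real, s))"
    unfolding split_beta by (intro continuous_intros)
  from continuous_on_compose2[OF smooth_along_continuous[OF smooth_f[OF le0]] this sub]
    continuous_on_compose2[OF smooth_along_continuous[OF smooth_g[OF le0]] this sub]
  show ?thesis by (simp add: split_beta continuous_on_add)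
qed

definition "coefficient_bound =
  (\<Sum>i=1..stages tab. \<Sum>j=1..stages tab. \<bar>impl tab i j\<bar> + \<bar>expl tab i j\<bar>)"

lemma stage_sum_bound:
  assumes "i \<in> {1..stages tab}" and "A \<subseteq> {1..stages tab}"
    and "\<And>j. j \<in> A \<Longrightarrow> norm (k j) \<le> B" and "\<And>j. j \<in> A \<Longrightarrow> norm (k' j) \<le> B" and "0 \<le> B"
  shows "norm (\<Sum>j\<in>A. impl tab i j *\<^sub>R k j + expl tab i j *\<^sub>R k' j) \<le> coefficient_bound * B"
proof -
  have "norm (\<Sum>j\<in>A. impl tab i j *\<^sub>R k j + expl tab i j *\<^sub>R k' j) \<le>
      (\<Sum>j\<in>A. (\<bar>impl tab i j\<bar> + \<bar>expl tab i j\<bar>) * B)"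
    using assms(3,4)
    by (intro order_trans[OF norm_sum] sum_mono order_trans[OF norm_triangle_ineq])
      (auto simp: distrib_right intro!: add_mono mult_left_mono)
  also have "\<dots> \<le> (\<Sum>j=1..stages tab. (\<bar>impl tab i j\<bar> + \<bar>expl tab i j\<bar>) * B)"
    using assms(2,5) by (intro sum_mono2) auto
  also have "\<dots> = (\<Sum>j=1..stages tab. \<bar>impl tab i j\<bar> + \<bar>expl tab i j\<bar>) * B"
    by (simp only: sum_distrib_right)
  also have "\<dots> \<le> coefficient_bound * B"
    unfolding coefficient_bound_def using assms(1,5)
    by (intro mult_right_mono member_le_sum[where f = "\<lambda>i. \<Sum>j=1..stages tab. \<bar>impl tab i j\<bar> + \<bar>expl tab i j\<bar>"])
      (auto intro!: sum_nonneg)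
  finally show ?thesis .
qed

text \<open>
  In terms of the full sums \<open>\<eta>\<^sub>i\<close>, which include the diagonal, all stages satisfy the same
  equations, the first one because \<open>\<Psi>\<close> vanishes at \<open>r = 0\<close>.
\<close>

definition stage_increment :: "real \<Rightarrow> (nat \<Rightarrow> real ^ 'n) \<Rightarrow> (nat \<Rightarrow> real ^ 'n) \<Rightarrow> nat \<Rightarrow> real ^ 'n"
  where "stage_increment h k k' i =
    h *\<^sub>R (\<Sum>j=1..stages tab. impl tab i j *\<^sub>R k j + expl tab i j *\<^sub>R k' j)"

lemma stage_equations_full:
  assumes eqs: "stage_equations tab \<rho> f g \<Psi> h t u (stages tab) k k'" and i: "i \<in> {1..stages tab}"
    and "u \<in> K" and "0 < h" and "h * \<gamma> \<le> \<theta>0" and "t \<in> {0..T}"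
  defines "\<eta> \<equiv> stage_increment h k k' i"
  defines "r \<equiv> \<eta> - (h * \<gamma>) *\<^sub>R (k i - k 1)"
  shows "norm r \<le> \<rho>" and "norm \<eta> \<le> \<rho>"
    and "k i = k 1 + \<Psi> (r, u, h * \<gamma>, t + node tab i * h)"
    and "k' i = \<phi> (u + \<eta>) (t + node tab i * h) - k i"
proof -
  have "norm r \<le> \<rho> \<and> norm \<eta> \<le> \<rho> \<and> k i = k 1 + \<Psi> (r, u, h * \<gamma>, t + node tab i * h) \<and>
    k' i = \<phi> (u + \<eta>) (t + node tab i * h) - k i"
  proof (cases "i = 1")
    case True
    have "impl tab 1 j = 0 \<and> expl tab 1 j = 0" if "j \<in> {1..stages tab}" for j
      using esdirk that i True unfolding imex_esdirk_def by (cases "j = 1") auto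
    then have "(\<Sum>j=1..stages tab. impl tab 1 j *\<^sub>R k j + expl tab 1 j *\<^sub>R k' j) = 0"
      by (intro sum.neutral) auto
    then have \<eta>: "\<eta> = 0" unfolding \<eta>_def True stage_increment_def by simp
    have "r = 0" unfolding r_def \<eta> using True by simp
    moreover have "node tab 1 = 0" using esdirk by (simp add: imex_esdirk_def)
    moreover have "\<Psi> (0, u, h * \<gamma>, t) = 0"
      using \<Psi>_zero[OF in_domain] assms \<gamma>_pos pos by simp
    ultimately show ?thesis
      using True \<eta> pos eqs by (simp add: stage_equations_def)
  next
    case False
    with i have i2: "i \<in> {2..stages tab}" by auto
    then obtain r' \<eta>' where
      r': "r' = h *\<^sub>R (\<Sum>j=1..<i. impl tab i j *\<^sub>R k j + expl tab i j *\<^sub>R k' j) + (h * \<gamma>) *\<^sub>R k 1"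
      and \<eta>': "\<eta>' = r' + (h * \<gamma>) *\<^sub>R \<Psi> (r', u, h * \<gamma>, t + node tab i * h)"
      and n: "norm r' \<le> \<rho>" "norm \<eta>' \<le> \<rho>"
      and k: "k i = k 1 + \<Psi> (r', u, h * \<gamma>, t + node tab i * h)"
        "k' i = f (u + \<eta>') (t + node tab i * h) + g (u + \<eta>') (t + node tab i * h) - k i"
      using eqs unfolding stage_equations_def by blast
    have "(\<Sum>j=1..stages tab. impl tab i j *\<^sub>R k j + expl tab i j *\<^sub>R k' j) =
        (\<Sum>j\<in>insert i {1..<i}. impl tab i j *\<^sub>R k j + expl tab i j *\<^sub>R k' j)"
      using esdirk i unfolding imex_esdirk_def
      by (intro sum.mono_neutral_right) (auto simp: not_less less_le)
    also have "\<dots> = \<gamma> *\<^sub>R k i + (\<Sum>j=1..<i. impl tab i j *\<^sub>R k j + expl tab i j *\<^sub>R k' j)"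
      using esdirk i i2 unfolding imex_esdirk_def by simp
    \<comment> \<open>In \<open>r'\<close> the diagonal term carries \<open>k 1\<close> instead of
      \<open>k i\<close>. The difference of the two slopes is \<Psi>, so the full sum is the value
      of the filter.\<close>
    finally have "\<eta> = r' + (h * \<gamma>) *\<^sub>R (k i - k 1)"
      unfolding \<eta>_def r' stage_increment_def by (simp add: algebra_simps)
    then have "r = r'" "\<eta> = \<eta>'" unfolding r_def \<eta>' k(1) by simp_all
    then show ?thesis using n k by simp
  qed
  then show "norm r \<le> \<rho>" "norm \<eta> \<le> \<rho>" "k i = k 1 + \<Psi> (r, u, h * \<gamma>, t + node tab i * h)"
    "k' i = \<phi> (u + \<eta>) (t + node tab i * h) - k i" by blast+
qed

text \<open>The filter is only evaluated, so the stages follow one after another and just the bounds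
  have to be propagated. With all data bounded by \<open>B\<close>, the implicit slope is at most 2
  * B, and the field minus that slope at most 4 * B.\<close>

lemma stage_equations_solvable:
  assumes f: "\<And>r u t. norm r \<le> \<rho> \<Longrightarrow> u \<in> K \<Longrightarrow> t \<in> {0..T} \<Longrightarrow> norm (f (u + r) t) \<le> B"
    and g: "\<And>r u t. norm r \<le> \<rho> \<Longrightarrow> u \<in> K \<Longrightarrow> t \<in> {0..T} \<Longrightarrow> norm (g (u + r) t) \<le> B"
    and \<Psi>: "\<And>r u \<theta> t. norm r \<le> \<rho> \<Longrightarrow> u \<in> K \<Longrightarrow> \<theta> \<in> {0..\<theta>0} \<Longrightarrow> t \<in> {0..T} \<Longrightarrow>
      norm (\<Psi> (r, u, \<theta>, t)) \<le> B"
    and B: "0 < B" and small: "h * (coefficient_bound * (4 * B) + 2 * \<gamma> * B) \<le> \<rho>"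
    and u: "u \<in> K" and h: "0 < h" "h * \<gamma> \<le> \<theta>0" and t: "0 \<le> t" "t + h \<le> T" and "s \<le> stages tab"
  shows "\<exists>k k'. stage_equations tab \<rho> f g \<Psi> h t u s k k' \<and>
    (\<forall>i\<in>{1..s}. norm (k i) \<le> 4 * B \<and> norm (k' i) \<le> 4 * B)"
  using \<open>s \<le> stages tab\<close>
proof (induction s)
  case 0
  show ?case
    by (rule exI[of _ "\<lambda>_. g u t"], rule exI[of _ "\<lambda>_. f u t"]) (simp add: stage_equations_def)
next
  case (Suc s)
  then obtain k k' where eqs: "stage_equations tab \<rho> f g \<Psi> h t u s k k'"
    and kB: "\<forall>i\<in>{1..s}. norm (k i) \<le> 4 * B \<and> norm (k' i) \<le> 4 * B" by auto
  have tT: "t \<in> {0..T}" using t h by auto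
  have k1: "k 1 = g u t" "k' 1 = f u t" using eqs by (auto simp: stage_equations_def)
  have k1B: "norm (k 1) \<le> B" "norm (k' 1) \<le> B"
    using f[of 0 u t] g[of 0 u t] u tT pos k1 by auto
  show ?case
  proof (cases "s = 0")
    case True
    then show ?thesis
      using k1 k1B B by (intro exI[of _ k] exI[of _ k']) (auto simp: stage_equations_def)
  next
    case False
    let ?i = "Suc s"
    have i: "?i \<in> {1..stages tab}" using Suc.prems by simp
    define \<tau> where "\<tau> = t + node tab ?i * h"
    have "0 \<le> node tab ?i * h" "node tab ?i * h \<le> 1 * h"
      using nodes[OF i] h by (auto intro: mult_right_mono)
    then have \<tau>: "\<tau> \<in> {0..T}" unfolding \<tau>_def using t by auto
    define d where "d = h *\<^sub>R (\<Sum>j=1..<?i. impl tab ?i j *\<^sub>R k j + expl tab ?i j *\<^sub>R k' j)"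
    define r where "r = d + (h * \<gamma>) *\<^sub>R k 1"
    define \<kappa> where "\<kappa> = \<Psi> (r, u, h * \<gamma>, \<tau>)"
    define \<eta> where "\<eta> = r + (h * \<gamma>) *\<^sub>R \<kappa>"
    define K2 where "K2 = \<phi> (u + \<eta>) \<tau> - (k 1 + \<kappa>)"
    have "norm (\<Sum>j\<in>{1..<?i}. impl tab ?i j *\<^sub>R k j + expl tab ?i j *\<^sub>R k' j) \<le> coefficient_bound * (4 * B)"
      using kB B Suc.prems by (intro stage_sum_bound[OF i]) auto
    then have d: "norm d \<le> h * (coefficient_bound * (4 * B))"
      unfolding d_def using h by simp
    have "norm ((h * \<gamma>) *\<^sub>R k 1) \<le> h * (\<gamma> * B)"
      using k1B h \<gamma>_pos by (simp add: mult.assoc)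
    then have rB: "norm r \<le> h * (coefficient_bound * (4 * B)) + h * (\<gamma> * B)"
      unfolding r_def using d by (meson add_mono norm_triangle_ineq order_trans)
    have pos': "0 \<le> h * (\<gamma> * B)" using h B \<gamma>_pos by simp
    then have r: "norm r \<le> \<rho>" using rB small by (simp add: algebra_simps)
    have \<kappa>: "norm \<kappa> \<le> B" unfolding \<kappa>_def using \<Psi>[OF r u _ \<tau>] h \<gamma>_pos by simp
    have "norm ((h * \<gamma>) *\<^sub>R \<kappa>) \<le> h * (\<gamma> * B)"
      using \<kappa> h \<gamma>_pos by (simp add: mult.assoc)
    then have \<eta>: "norm \<eta> \<le> \<rho>"
      unfolding \<eta>_def using rB small norm_triangle_ineq[of r "(h * \<gamma>) *\<^sub>R \<kappa>"] by (simp add: algebra_simps)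
    have "norm K2 \<le> 4 * B"
      unfolding K2_def using f[OF \<eta> u \<tau>] g[OF \<eta> u \<tau>] k1B \<kappa>
        norm_triangle_ineq4[of "\<phi> (u + \<eta>) \<tau>" "k 1 + \<kappa>"] norm_triangle_ineq[of "f (u + \<eta>) \<tau>" "g (u + \<eta>) \<tau>"]
        norm_triangle_ineq[of "k 1" \<kappa>] by linarith
    moreover have "norm (k 1 + \<kappa>) \<le> 4 * B"
      using k1B \<kappa> B norm_triangle_ineq[of "k 1" \<kappa>] by linarith
    moreover have "stage_equations tab \<rho> f g \<Psi> h t u ?i (k(?i := k 1 + \<kappa>)) (k'(?i := K2))"
    proof -
      let ?k = "k(?i := k 1 + \<kappa>)" and ?k' = "k'(?i := K2)"
      have sum: "(\<Sum>j=1..<i. impl tab i j *\<^sub>R ?k j + expl tab i j *\<^sub>R ?k' j) =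
          (\<Sum>j=1..<i. impl tab i j *\<^sub>R k j + expl tab i j *\<^sub>R k' j)" if "i \<le> ?i" for i
        using that by (intro sum.cong) auto
      have k1': "?k 1 = k 1" "?k' 1 = k' 1" using False by auto
      show ?thesis
        unfolding stage_equations_def k1'
      proof (intro conjI ballI k1)
        fix i assume i: "i \<in> {2..?i}"
        show "\<exists>r \<eta>.
          r = h *\<^sub>R (\<Sum>j=1..<i. impl tab i j *\<^sub>R ?k j + expl tab i j *\<^sub>R ?k' j) + (h * \<gamma>) *\<^sub>R k 1 \<and>
          \<eta> = r + (h * \<gamma>) *\<^sub>R \<Psi> (r, u, h * \<gamma>, t + node tab i * h) \<and>
          norm r \<le> \<rho> \<and> norm \<eta> \<le> \<rho> \<and>
          ?k i = k 1 + \<Psi> (r, u, h * \<gamma>, t + node tab i * h) \<and>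
          ?k' i = f (u + \<eta>) (t + node tab i * h) + g (u + \<eta>) (t + node tab i * h) - ?k i"
        proof (cases "i = ?i")
          case True
          have s: "(\<Sum>j=1..<i. impl tab i j *\<^sub>R ?k j + expl tab i j *\<^sub>R ?k' j) =
              (\<Sum>j=1..<?i. impl tab ?i j *\<^sub>R k j + expl tab ?i j *\<^sub>R k' j)"
            using sum[of ?i] unfolding True by simp
          show ?thesis
            unfolding s
            by (rule exI[of _ r], rule exI[of _ \<eta>])
              (use r \<eta> in \<open>simp add: True r_def d_def \<eta>_def K2_def \<kappa>_def \<tau>_def\<close>)
        next
          case False
          then have "i \<in> {2..s}" and i': "?k i = k i" "?k' i = k' i" using i by auto
          have s: "(\<Sum>j=1..<i. impl tab i j *\<^sub>R ?k j + expl tab i j *\<^sub>R ?k' j) =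
              (\<Sum>j=1..<i. impl tab i j *\<^sub>R k j + expl tab i j *\<^sub>R k' j)"
            using sum[of i] i by simp
          show ?thesis
            unfolding s i' using eqs \<open>i \<in> {2..s}\<close> unfolding stage_equations_def by blast
        qed
      qed
    qed
    ultimately have "stage_equations tab \<rho> f g \<Psi> h t u ?i (k(?i := k 1 + \<kappa>)) (k'(?i := K2)) \<and>
        (\<forall>i\<in>{1..?i}. norm ((k(?i := k 1 + \<kappa>)) i) \<le> 4 * B \<and> norm ((k'(?i := K2)) i) \<le> 4 * B)"
      using kB by auto
    then show ?thesis by blast
  qed
qed

end

section \<open>The local error\<close>

context simex_increment
begin

definition "parameters h1 =
  {(u, t, h). u \<in> K \<and> 0 < h \<and> h \<le> h1 \<and> 0 \<le> t \<and> t + h \<le> T}"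

text \<open>Induction on the order of the expansion. The numerical stages stay fixed and merely
  become known to higher order, whereas the continuous stages change in each pass. Quadrature gives
  O(h ^ p) for the mean slope, and the step size one more power. The iterate is number
  \<open>Suc p\<close> because integrating the field along iterate \<open>p\<close> yields the next
  one.\<close>

lemma local_error:
  shows "\<exists>h1 C. 0 < h1 \<and> h1 \<le> 1 \<and> h1 * \<gamma> \<le> \<theta>0 \<and>
    (\<forall>u t h. (u, t, h) \<in> parameters h1 \<longrightarrow>
      (\<exists>k k'. stage_equations tab \<rho> f g \<Psi> h t u (stages tab) k k' \<and>
        norm (u + h *\<^sub>R (\<Sum>i=1..stages tab. weight tab i *\<^sub>R (k i + k' i)) -
          picard \<phi> h t u (Suc p) 1) \<le> C * h ^ Suc p))"
proof -
  obtain B where B: "0 < B"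
    and fB: "\<And>r u t. norm r \<le> \<rho> \<Longrightarrow> u \<in> K \<Longrightarrow> t \<in> {0..T} \<Longrightarrow> norm (f (u + r) t) \<le> B"
    and gB: "\<And>r u t. norm r \<le> \<rho> \<Longrightarrow> u \<in> K \<Longrightarrow> t \<in> {0..T} \<Longrightarrow> norm (g (u + r) t) \<le> B"
    and \<Psi>B: "\<And>r u \<theta> t. norm r \<le> \<rho> \<Longrightarrow> u \<in> K \<Longrightarrow> \<theta> \<in> {0..\<theta>0} \<Longrightarrow> t \<in> {0..T} \<Longrightarrow>
      norm (\<Psi> (r, u, \<theta>, t)) \<le> B"
    by (rule bounds) (rule that; assumption)
  have \<phi>B: "norm (\<phi> (u + r) t) \<le> 2 * B" if "norm r \<le> \<rho>" "u \<in> K" "t \<in> {0..T}" for u r t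
    using fB[OF that] gB[OF that] norm_triangle_ineq[of "f (u + r) t" "g (u + r) t"] by linarith
  have cb0: "0 \<le> coefficient_bound"
    unfolding coefficient_bound_def by (intro sum_nonneg) auto
  \<comment> \<open>\<open>R * h\<close> will bound \<open>r\<close> and \<open>\<eta>\<close> in
    every pass. The first two summands are those of the stage solver, \<gamma> * (8 * B) covers the
    correction \<gamma> * (k i - k 1), and 2 * B the Picard iterates.\<close>
  define R where "R = coefficient_bound * (4 * B) + 2 * \<gamma> * B + \<gamma> * (8 * B) + 2 * B"
  have R: "0 < R" "coefficient_bound * (4 * B) + 2 * \<gamma> * B \<le> R" "2 * B + \<gamma> * B \<le> R"
    "coefficient_bound * (4 * B) + \<gamma> * (8 * B) \<le> R"
    unfolding R_def using B \<gamma>_pos cb0 by (auto simp: add_nonneg_pos)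
  define h1 where "h1 = min 1 (min (\<theta>0 / \<gamma>) (\<rho> / R))"
  have h1: "0 < h1" "h1 \<le> 1"
    unfolding h1_def using pos \<gamma>_pos R by auto
  have h1': "h1 * \<gamma> \<le> \<theta>0" "h1 * R \<le> \<rho>"
  proof -
    have "h1 \<le> \<theta>0 / \<gamma>" "h1 \<le> \<rho> / R" unfolding h1_def by auto
    then show "h1 * \<gamma> \<le> \<theta>0" "h1 * R \<le> \<rho>" using \<gamma>_pos R by (auto simp: field_simps)
  qed
  let ?P = "parameters h1"
  have P: "u \<in> K" "0 < h" "h \<le> 1" "h * \<gamma> \<in> {0..\<theta>0}" "0 \<le> t" "t + h \<le> T" "t \<in> {0..T}" "h * R \<le> \<rho>"
    if "(u, t, h) \<in> ?P" for u t h
  proof -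
    show "u \<in> K" "0 < h" "0 \<le> t" "t + h \<le> T" "t \<in> {0..T}" "h \<le> 1"
      using that h1 by (auto simp: parameters_def)
    have "h * \<gamma> \<le> h1 * \<gamma>" "h * R \<le> h1 * R"
      using that \<gamma>_pos R by (auto simp: parameters_def)
    then have "h * \<gamma> \<le> \<theta>0" "h * R \<le> \<rho>"
      using h1' by linarith+
    then show "h * \<gamma> \<in> {0..\<theta>0}" "h * R \<le> \<rho>"
      using \<open>0 < h\<close> \<gamma>_pos by simp_all
  qed
  interpret S: step_family tab ?P "\<lambda>(u, t, h). h"
    by unfold_locales (use h1 in \<open>auto simp: parameters_def\<close>)
  define solution where "solution \<pi> k k' \<longleftrightarrow> (case \<pi> of (u, t, h) \<Rightarrow>
      stage_equations tab \<rho> f g \<Psi> h t u (stages tab) k k') \<and>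
      (\<forall>i\<in>{1..stages tab}. norm (k i) \<le> 4 * B \<and> norm (k' i) \<le> 4 * B)" for \<pi> k k'
  have "\<exists>k k'. \<pi> \<in> ?P \<longrightarrow> solution \<pi> k k'" for \<pi>
  proof (cases \<pi>)
    case (fields u t h)
    show ?thesis
    proof (cases "\<pi> \<in> ?P")
      case True
      note \<pi> = True[unfolded fields]
      have "h * (coefficient_bound * (4 * B) + 2 * \<gamma> * B) \<le> h * R"
        using P(2)[OF \<pi>] R by (intro mult_left_mono) auto
      then have small: "h * (coefficient_bound * (4 * B) + 2 * \<gamma> * B) \<le> \<rho>" using P(8)[OF \<pi>] by simp
      have h\<gamma>: "h * \<gamma> \<le> \<theta>0" using P(4)[OF \<pi>] by simp
      have "\<exists>k k'. stage_equations tab \<rho> f g \<Psi> h t u (stages tab) k k' \<and>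
          (\<forall>i\<in>{1..stages tab}. norm (k i) \<le> 4 * B \<and> norm (k' i) \<le> 4 * B)"
        by (rule stage_equations_solvable[where B = B])
          (fact fB gB \<Psi>B B small P(1,2,5,6)[OF \<pi>] h\<gamma> le_refl)+
      then show ?thesis by (simp add: solution_def fields)
    qed simp
  qed
  \<comment> \<open>One solution is fixed for each parameter, which turns the stages into families
    over the parameter set.\<close>
  then obtain k k' where sol: "\<And>\<pi>. \<pi> \<in> ?P \<Longrightarrow> solution \<pi> (k \<pi>) (k' \<pi>)"
    by metis
  have eqs: "stage_equations tab \<rho> f g \<Psi> h t u (stages tab) (k (u, t, h)) (k' (u, t, h))"
    and kB: "\<And>i. i \<in> {1..stages tab} \<Longrightarrow> norm (k (u, t, h) i) \<le> 4 * B"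
    and k'B: "\<And>i. i \<in> {1..stages tab} \<Longrightarrow> norm (k' (u, t, h) i) \<le> 4 * B"
    if "(u, t, h) \<in> ?P" for u t h
    using sol[OF that] by (simp_all add: solution_def)
  have k1: "k (u, t, h) 1 = g u t" if "(u, t, h) \<in> ?P" for u t h
    using eqs[OF that] by (simp add: stage_equations_def)
  have gB': "norm (g u t) \<le> B" if "(u, t, h) \<in> ?P" for u t h
    using gB[of 0 u t] P[OF that] pos by simp
  have picard: "continuous_on {0..1} (picard \<phi> h t u m)"
    "\<And>\<tau>. \<tau> \<in> {0..1} \<Longrightarrow> norm (picard \<phi> h t u m \<tau> - u) \<le> h * (2 * B)"
    "continuous_on {0..1} (\<lambda>\<sigma>. \<phi> (picard \<phi> h t u m \<sigma>) (t + \<sigma> * h))"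
    and hB: "h * (2 * B) \<le> \<rho>" if "(u, t, h) \<in> ?P" for u t h m
  proof -
    note P = P[OF that]
    have "2 * B \<le> R" unfolding R_def using B \<gamma>_pos cb0 by simp
    then have "h * (2 * B) \<le> h * R" using P(2) by (intro mult_left_mono) auto
    with P(8) show hB: "h * (2 * B) \<le> \<rho>" by simp
    show "continuous_on {0..1} (picard \<phi> h t u m)"
      "\<And>\<tau>. \<tau> \<in> {0..1} \<Longrightarrow> norm (picard \<phi> h t u m \<tau> - u) \<le> h * (2 * B)"
      "continuous_on {0..1} (\<lambda>\<sigma>. \<phi> (picard \<phi> h t u m \<sigma>) (t + \<sigma> * h))"
      using picard_properties[OF continuous_field[OF P(1)] \<phi>B[OF _ P(1)] P(2) _ hB P(5,6), where m = m] B
      by auto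
  qed
  define \<delta> where "\<delta> \<pi> j = (case \<pi> of (u, t, h) \<Rightarrow> h * (case j of Inl i \<Rightarrow> node tab i | Inr \<tau> \<Rightarrow> \<tau>))"
    for \<pi> :: "(real ^ 'n) \<times> real \<times> real" and j
  have \<delta>_small: "0 \<le> \<delta> (u, t, h) j \<and> \<delta> (u, t, h) j \<le> h"
    if "(u, t, h) \<in> ?P" "j \<in> stage_index tab" for u t h j
    using that nodes P(2)[OF that(1)] by (auto simp: \<delta>_def stage_index_def intro!: mult_left_le)
  have time: "t + \<delta> (u, t, h) j \<in> {0..T}" if "(u, t, h) \<in> ?P" "j \<in> stage_index tab" for u t h j
    using \<delta>_small[OF that] P[OF that(1)] by auto
  \<comment> \<open>The elapsed time is the monomial of the single leaf \<open>Time\<close>, at both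
    kinds of stages.\<close>
  have \<delta>: "S.expandable m \<delta>" for m
  proof (rule S.expandable_cong[OF S.monomial[of "\<lambda>_. 1" 1 m "[Time]"]])
    show "\<delta> \<pi> j = 1 * ((case \<pi> of (u, t, h) \<Rightarrow> h) ^ forest_order [Time] * forest_weight tab j [Time])"
      for \<pi> j
      by (cases j) (simp_all add: \<delta>_def forest_order_def forest_weight_def split_beta)
  qed simp
  have const_g: "S.expandable m (\<lambda>\<pi> j. (case \<pi> of (u, t, h) \<Rightarrow> g u t) \<bullet> b)" if "b \<in> Basis" for m b
    by (rule S.expandable_const[of _ B])
      (use gB' Basis_le_norm[OF that] in \<open>fastforce intro: order_trans\<close>)
  \<comment> \<open>On the continuous stages just the sum of the two parts is prescribed. The bound
    on \<open>X\<close> minus \<open>g\<close> makes \<open>r\<close> of size O(h) there.\<close>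
  define family where "family m X X' \<longleftrightarrow>
      (\<forall>u t h i. (u, t, h) \<in> ?P \<longrightarrow> i \<in> {1..stages tab} \<longrightarrow>
        X (u, t, h) (Inl i) = k (u, t, h) i \<and> X' (u, t, h) (Inl i) = k' (u, t, h) i) \<and>
      (\<forall>u t h \<tau>. (u, t, h) \<in> ?P \<longrightarrow> \<tau> \<in> {0..1} \<longrightarrow>
        X (u, t, h) (Inr \<tau>) + X' (u, t, h) (Inr \<tau>) = \<phi> (picard \<phi> h t u m \<tau>) (t + \<tau> * h) \<and>
        norm (X (u, t, h) (Inr \<tau>) - g u t) \<le> B) \<and>
      (\<forall>b\<in>Basis. S.expandable m (\<lambda>\<pi> j. X \<pi> j \<bullet> b)) \<and>
      (\<forall>b\<in>Basis. S.expandable m (\<lambda>\<pi> j. X' \<pi> j \<bullet> b))" for m X X'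
  have "\<exists>X X'. family m X X'" if "m \<le> p" for m
    using that
  proof (induction m)
    case 0
    \<comment> \<open>Order 0 asks for little more than boundedness. The first splitting on the
      continuous stages is a free choice: the constant value of \<open>g\<close>, and the rest of
      the field.\<close>
    define X where "X \<pi> j = (case \<pi> of (u, t, h) \<Rightarrow>
      case j of Inl i \<Rightarrow> k (u, t, h) i | Inr \<tau> \<Rightarrow> g u t)" for \<pi> and j :: "nat + real"
    define X' where "X' \<pi> j = (case \<pi> of (u, t, h) \<Rightarrow>
      case j of Inl i \<Rightarrow> k' (u, t, h) i | Inr \<tau> \<Rightarrow> \<phi> u (t + \<tau> * h) - g u t)" for \<pi> j
    have "S.expandable 0 (\<lambda>\<pi> j. X \<pi> j \<bullet> b)" "S.expandable 0 (\<lambda>\<pi> j. X' \<pi> j \<bullet> b)" if b: "b \<in> Basis" for b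
    proof -
      have "norm (X \<pi> j) \<le> 4 * B" if "\<pi> \<in> ?P" "j \<in> stage_index tab" for \<pi> j
        using that kB gB' B by (cases \<pi>) (fastforce simp: X_def stage_index_def)
      then have "\<bar>X \<pi> j \<bullet> b\<bar> \<le> 4 * B" if "\<pi> \<in> ?P" "j \<in> stage_index tab" for \<pi> j
        using Basis_le_norm[OF b, of "X \<pi> j"] that by (meson order_trans)
      then show "S.expandable 0 (\<lambda>\<pi> j. X \<pi> j \<bullet> b)"
        by (intro S.remainder[where C = "4 * B"]) (auto simp: X_def)
      have "norm (X' (u, t, h) j) \<le> 4 * B" if \<pi>: "(u, t, h) \<in> ?P" and j: "j \<in> stage_index tab" for u t h j
      proof (cases j)
        case (Inl i)
        then show ?thesis using k'B[OF \<pi>] j by (auto simp: X'_def stage_index_def)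
      next
        case (Inr \<tau>)
        have "norm (\<phi> (u + 0) (t + \<tau> * h)) \<le> 2 * B"
          using P[OF \<pi>] time[OF \<pi> j] pos by (intro \<phi>B) (auto simp: Inr \<delta>_def mult.commute)
        then show ?thesis
          using norm_triangle_ineq4[of "\<phi> u (t + \<tau> * h)" "g u t"] gB'[OF \<pi>] B by (simp add: Inr X'_def)
      qed
      then have "\<bar>X' \<pi> j \<bullet> b\<bar> \<le> 4 * B" if "\<pi> \<in> ?P" "j \<in> stage_index tab" for \<pi> j
        using Basis_le_norm[OF b, of "X' \<pi> j"] that by (cases \<pi>) (force intro: order_trans)
      moreover have "continuous_on {0..1} (\<lambda>\<tau>. X' \<pi> (Inr \<tau>) \<bullet> b)" if "\<pi> \<in> ?P" for \<pi>
      proof -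
        obtain u t h where \<pi>: "\<pi> = (u, t, h)" by (cases \<pi>)
        from picard(3)[of u t h 0] that show ?thesis
          by (auto simp: X'_def \<pi> intro!: continuous_intros)
      qed
      ultimately show "S.expandable 0 (\<lambda>\<pi> j. X' \<pi> j \<bullet> b)"
        by (intro S.remainder[where C = "4 * B"]) auto
    qed
    moreover have "X (u, t, h) (Inl i) = k (u, t, h) i" "X' (u, t, h) (Inl i) = k' (u, t, h) i"
      "X (u, t, h) (Inr \<tau>) + X' (u, t, h) (Inr \<tau>) = \<phi> (picard \<phi> h t u 0 \<tau>) (t + \<tau> * h)"
      "norm (X (u, t, h) (Inr \<tau>) - g u t) \<le> B" for u t h i \<tau>
      using B by (simp_all add: X_def X'_def)
    ultimately have "family 0 X X'"
      unfolding family_def by simp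
    then show ?case by blast
  next
    case (Suc m)
    then obtain X X' where "family m X X'" by auto
    note family = this[unfolded family_def]
    have Xi: "X (u, t, h) (Inl i) = k (u, t, h) i" "X' (u, t, h) (Inl i) = k' (u, t, h) i"
      if "(u, t, h) \<in> ?P" "i \<in> {1..stages tab}" for u t h i
      using family that by simp_all
    have X\<tau>: "X (u, t, h) (Inr \<tau>) + X' (u, t, h) (Inr \<tau>) = \<phi> (picard \<phi> h t u m \<tau>) (t + \<tau> * h)"
      "norm (X (u, t, h) (Inr \<tau>) - g u t) \<le> B" if "(u, t, h) \<in> ?P" "\<tau> \<in> {0..1}" for u t h \<tau>
      using family that by simp_all
    have XS: "S.expandable m (\<lambda>\<pi> j. X \<pi> j \<bullet> b)" and X'S: "S.expandable m (\<lambda>\<pi> j. X' \<pi> j \<bullet> b)"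
      if "b \<in> Basis" for b
      using family that by simp_all
    define \<eta> where "\<eta> \<pi> j = (case \<pi> of (u, t, h) \<Rightarrow> case j of
        Inl i \<Rightarrow> stage_increment h (k \<pi>) (k' \<pi>) i
      | Inr \<tau> \<Rightarrow> picard \<phi> h t u (Suc m) \<tau> - u)" for \<pi> j
    define r where "r \<pi> j = (case \<pi> of (u, t, h) \<Rightarrow> \<eta> \<pi> j - (h * \<gamma>) *\<^sub>R (X \<pi> j - g u t))" for \<pi> j
    \<comment> \<open>One pass: the right-hand sides of the full stage equations, read on both kinds
      of stages.\<close>
    define Z where "Z \<pi> j = (case \<pi> of (u, t, h) \<Rightarrow>
      g u t + \<Psi> (r \<pi> j, u, h * \<gamma>, t + \<delta> \<pi> j))" for \<pi> j
    define Z' where "Z' \<pi> j = (case \<pi> of (u, t, h) \<Rightarrow>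
      \<phi> (u + \<eta> \<pi> j) (t + \<delta> \<pi> j) - Z \<pi> j)" for \<pi> j
    have \<eta>R: "norm (\<eta> (u, t, h) j) \<le> R * h" and rR: "norm (r (u, t, h) j) \<le> R * h"
      if \<pi>: "(u, t, h) \<in> ?P" and j: "j \<in> stage_index tab" for u t h j
    proof -
      note P = P[OF \<pi>]
      have "norm (\<eta> (u, t, h) j) \<le> h * R \<and> norm (r (u, t, h) j) \<le> h * R"
      proof (cases j)
        case (Inl i)
        with j have i: "i \<in> {1..stages tab}" by (auto simp: stage_index_def)
        have \<eta>: "norm (\<eta> (u, t, h) j) \<le> h * (coefficient_bound * (4 * B))"
          unfolding Inl \<eta>_def stage_increment_def using stage_sum_bound[OF i subset_refl kB[OF \<pi>] k'B[OF \<pi>]] B P(2)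
          by simp
        have "norm (X (u, t, h) j - g u t) \<le> 8 * B"
          using Xi[OF \<pi> i] kB[OF \<pi> i] gB'[OF \<pi>] B norm_triangle_ineq4[of "X (u, t, h) j" "g u t"]
          by (simp add: Inl)
        then have "norm ((h * \<gamma>) *\<^sub>R (X (u, t, h) j - g u t)) \<le> h * (\<gamma> * (8 * B))"
          using P(2) \<gamma>_pos by (simp add: mult.assoc)
        then have "norm (r (u, t, h) j) \<le> h * (coefficient_bound * (4 * B) + \<gamma> * (8 * B))"
          unfolding r_def distrib_left using \<eta>
            norm_triangle_ineq4[of "\<eta> (u, t, h) j" "(h * \<gamma>) *\<^sub>R (X (u, t, h) j - g u t)"] by simp
        moreover have "h * (coefficient_bound * (4 * B) + \<gamma> * (8 * B)) \<le> h * R"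
          using R P(2) by (intro mult_left_mono) auto
        moreover have "h * (coefficient_bound * (4 * B)) \<le> h * R"
          using P(2) B \<gamma>_pos unfolding R_def by (intro mult_left_mono) auto
        ultimately show ?thesis using \<eta> by linarith
      next
        case (Inr \<tau>)
        with j have \<tau>: "\<tau> \<in> {0..1}" by (auto simp: stage_index_def)
        have \<eta>: "norm (\<eta> (u, t, h) j) \<le> h * (2 * B)"
          using picard(2)[OF \<pi> \<tau>, of "Suc m"] by (simp add: Inr \<eta>_def)
        have "norm ((h * \<gamma>) *\<^sub>R (X (u, t, h) j - g u t)) \<le> h * (\<gamma> * B)"
          using X\<tau>[OF \<pi> \<tau>] P(2) \<gamma>_pos by (simp add: Inr mult.assoc)
        then have "norm (r (u, t, h) j) \<le> h * (2 * B + \<gamma> * B)"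
          unfolding r_def distrib_left using \<eta>
            norm_triangle_ineq4[of "\<eta> (u, t, h) j" "(h * \<gamma>) *\<^sub>R (X (u, t, h) j - g u t)"] by simp
        moreover have "h * (2 * B + \<gamma> * B) \<le> h * R"
          using R P(2) by (intro mult_left_mono) auto
        moreover have "h * (2 * B) \<le> h * (2 * B + \<gamma> * B)"
          using P(2) B \<gamma>_pos by (intro mult_left_mono) auto
        ultimately show ?thesis using \<eta> by linarith
      qed
      then show "norm (\<eta> (u, t, h) j) \<le> R * h" "norm (r (u, t, h) j) \<le> R * h"
        by (simp_all add: mult.commute)
    qed
    \<comment> \<open>On the continuous stages the two operators are the same integral, and the
      parts add up to the field along iterate \<open>m\<close>; this produces the next
      iterate.\<close>
    have \<eta>S: "S.expandable (Suc m) (\<lambda>\<pi> j. \<eta> \<pi> j \<bullet> b)" if b: "b \<in> Basis" for b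
    proof (rule S.expandable_cong[OF S.add[OF S.expandable_stage_operator[OF XS[OF b], of Implicit]
          S.expandable_stage_operator[OF X'S[OF b], of Explicit]]])
      fix \<pi> j assume \<pi>: "\<pi> \<in> ?P" and j: "j \<in> stage_index tab"
      obtain u t h where uth: "\<pi> = (u, t, h)" by (cases \<pi>)
      note \<pi>' = \<pi>[unfolded uth]
      show "\<eta> \<pi> j \<bullet> b = (case \<pi> of (u, t, h) \<Rightarrow> h) * stage_operator tab Implicit (\<lambda>j. X \<pi> j \<bullet> b) j +
          (case \<pi> of (u, t, h) \<Rightarrow> h) * stage_operator tab Explicit (\<lambda>j. X' \<pi> j \<bullet> b) j"
      proof (cases j)
        case (Inl i)
        then show ?thesis
          using Xi[OF \<pi>']
          by (simp add: uth \<eta>_def stage_increment_def inner_sum_left inner_add_left sum.distrib distrib_left)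
      next
        case (Inr \<tau>)
        with j have \<tau>: "\<tau> \<in> {0..1}" by (auto simp: stage_index_def)
        let ?f = "\<lambda>\<sigma>. \<phi> (picard \<phi> h t u m \<sigma>) (t + \<sigma> * h)"
        have "continuous_on {0..\<tau>} ?f"
          by (rule continuous_on_subset[OF picard(3)[OF \<pi>']]) (use \<tau> in auto)
        then have "integral {0..\<tau>} ?f \<bullet> b = integral {0..\<tau>} (\<lambda>\<sigma>. ?f \<sigma> \<bullet> b)"
          using integral_linear[OF integrable_continuous_real bounded_linear_inner_left, of 0 \<tau> ?f b]
          by (simp add: o_def)
        also have "\<dots> = integral {0..\<tau>} (\<lambda>\<sigma>. X \<pi> (Inr \<sigma>) \<bullet> b + X' \<pi> (Inr \<sigma>) \<bullet> b)"
          using X\<tau>[OF \<pi>'] \<tau> by (intro integral_cong) (auto simp: uth simp flip: inner_add_left)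
        also have "\<dots> = integral {0..\<tau>} (\<lambda>\<sigma>. X \<pi> (Inr \<sigma>) \<bullet> b) + integral {0..\<tau>} (\<lambda>\<sigma>. X' \<pi> (Inr \<sigma>) \<bullet> b)"
          by (intro integral_add S.expandable_integrable[OF XS[OF b] \<pi> \<tau>] S.expandable_integrable[OF X'S[OF b] \<pi> \<tau>])
        finally show ?thesis by (simp add: uth Inr \<eta>_def distrib_left)
      qed
    qed
    \<comment> \<open>\<open>X\<close> is known to order \<open>m\<close> only, but it enters with
      the factor \<open>h\<close>, which restores the order \<open>Suc m\<close>.\<close>
    have rS: "S.expandable (Suc m) (\<lambda>\<pi> j. r \<pi> j \<bullet> b)" if b: "b \<in> Basis" for b
    proof -
      have "S.expandable (Suc m) (\<lambda>\<pi> j. \<eta> \<pi> j \<bullet> b - \<gamma> * ((case \<pi> of (u, t, h) \<Rightarrow> h) *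
          (X \<pi> j \<bullet> b - (case \<pi> of (u, t, h) \<Rightarrow> g u t) \<bullet> b)))"
        by (intro S.expandable_diff \<eta>S b S.expandable_scale[where C = \<gamma>] S.expandable_times_step XS const_g)
          (use \<gamma>_pos in simp)
      then show ?thesis
        by (rule S.expandable_cong) (auto simp: r_def inner_diff_left algebra_simps)
    qed
    have compose: "S.expandable (Suc m) (\<lambda>\<pi> j. F (x \<pi> j, case \<pi> of (u, t, h) \<Rightarrow> u,
        case \<pi> of (u, t, h) \<Rightarrow> h * \<gamma>, (case \<pi> of (u, t, h) \<Rightarrow> t) + \<delta> \<pi> j) \<bullet> b)"
      if "smooth_along (box_domain \<rho> K \<theta>0 T) directions (Suc m) F"
        and "\<And>b. b \<in> Basis \<Longrightarrow> S.expandable (Suc m) (\<lambda>\<pi> j. x \<pi> j \<bullet> b)"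
        and xR: "\<And>u t h j. (u, t, h) \<in> ?P \<Longrightarrow> j \<in> stage_index tab \<Longrightarrow> norm (x (u, t, h) j) \<le> R * h"
      for F :: "_ \<Rightarrow> real ^ 'n" and x b
    proof (rule S.expandable_compose_box[OF K that(1) \<delta> that(2)])
      fix \<pi> j assume \<pi>: "\<pi> \<in> ?P" and j: "j \<in> stage_index tab"
      obtain u t h where uth: "\<pi> = (u, t, h)" by (cases \<pi>)
      note \<pi>' = \<pi>[unfolded uth]
      show "0 \<le> \<delta> \<pi> j \<and> \<delta> \<pi> j \<le> (case \<pi> of (u, t, h) \<Rightarrow> h)"
        using \<delta>_small[OF \<pi>' j] by (simp add: uth)
      show "norm (x \<pi> j) \<le> R * (case \<pi> of (u, t, h) \<Rightarrow> h)"
        using xR[OF \<pi>' j] by (simp add: uth)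
      show "norm (x \<pi> j) \<le> \<rho> \<and> (case \<pi> of (u, t, h) \<Rightarrow> u) \<in> K \<and>
          (case \<pi> of (u, t, h) \<Rightarrow> h * \<gamma>) \<in> {0..\<theta>0} \<and> 0 \<le> (case \<pi> of (u, t, h) \<Rightarrow> t) \<and>
          (case \<pi> of (u, t, h) \<Rightarrow> t) + \<delta> \<pi> j \<le> T"
        using xR[OF \<pi>' j] P[OF \<pi>'] time[OF \<pi>' j] by (simp add: uth mult.commute)
    qed
    have ZS: "S.expandable (Suc m) (\<lambda>\<pi> j. Z \<pi> j \<bullet> b)" if b: "b \<in> Basis" for b
      by (rule S.expandable_cong[OF S.add[OF const_g[OF b] compose[OF smooth_\<Psi>[OF Suc.prems] rS rR]]])
        (auto simp: Z_def inner_add_left)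
    have Z'S: "S.expandable (Suc m) (\<lambda>\<pi> j. Z' \<pi> j \<bullet> b)" if b: "b \<in> Basis" for b
      by (rule S.expandable_cong[OF S.expandable_diff[OF S.add[OF compose[OF smooth_f[OF Suc.prems] \<eta>S \<eta>R]
            compose[OF smooth_g[OF Suc.prems] \<eta>S \<eta>R]] ZS[OF b]]])
        (auto simp: Z'_def inner_add_left inner_diff_left)
    \<comment> \<open>The numerical stages solve the full equations, so the pass reproduces
      them.\<close>
    have "Z (u, t, h) (Inl i) = k (u, t, h) i \<and> Z' (u, t, h) (Inl i) = k' (u, t, h) i"
      if \<pi>: "(u, t, h) \<in> ?P" and i: "i \<in> {1..stages tab}" for u t h i
    proof -
      note full = stage_equations_full[OF eqs[OF \<pi>] i P(1,2)[OF \<pi>] _ P(7)[OF \<pi>]]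
      have "Z (u, t, h) (Inl i) = k (u, t, h) i"
        using full(3) P(4)[OF \<pi>] Xi[OF \<pi> i] k1[OF \<pi>]
        by (simp add: Z_def r_def \<eta>_def \<delta>_def mult.commute)
      then show ?thesis
        using full(4) P(4)[OF \<pi>] by (simp add: Z'_def \<eta>_def \<delta>_def mult.commute)
    qed
    moreover have "Z (u, t, h) (Inr \<tau>) + Z' (u, t, h) (Inr \<tau>) = \<phi> (picard \<phi> h t u (Suc m) \<tau>) (t + \<tau> * h) \<and>
        norm (Z (u, t, h) (Inr \<tau>) - g u t) \<le> B"
      if \<pi>: "(u, t, h) \<in> ?P" and \<tau>: "\<tau> \<in> {0..1}" for u t h \<tau>
    proof
      have j: "Inr \<tau> \<in> stage_index tab" using \<tau> by (auto simp: stage_index_def)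
      show "Z (u, t, h) (Inr \<tau>) + Z' (u, t, h) (Inr \<tau>) = \<phi> (picard \<phi> h t u (Suc m) \<tau>) (t + \<tau> * h)"
        by (simp add: Z'_def \<eta>_def \<delta>_def mult.commute)
      have "norm (r (u, t, h) (Inr \<tau>)) \<le> \<rho>"
        using rR[OF \<pi> j] P(8)[OF \<pi>] by (simp add: mult.commute)
      then show "norm (Z (u, t, h) (Inr \<tau>) - g u t) \<le> B"
        using \<Psi>B[OF _ P(1)[OF \<pi>] P(4)[OF \<pi>] time[OF \<pi> j]] by (simp add: Z_def)
    qed
    ultimately have "family (Suc m) Z Z'"
      unfolding family_def using ZS Z'S by (intro conjI allI impI ballI) blast+
    then show ?case by blast
  qed
  from this[OF le_refl] obtain X X' where "family p X X'" by blast
  note family = this[unfolded family_def]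
  have Xi: "X (u, t, h) (Inl i) = k (u, t, h) i" "X' (u, t, h) (Inl i) = k' (u, t, h) i"
    if "(u, t, h) \<in> ?P" "i \<in> {1..stages tab}" for u t h i
    using family that by simp_all
  have X\<tau>: "X (u, t, h) (Inr \<tau>) + X' (u, t, h) (Inr \<tau>) = \<phi> (picard \<phi> h t u p \<tau>) (t + \<tau> * h)"
    if "(u, t, h) \<in> ?P" "\<tau> \<in> {0..1}" for u t h \<tau>
    using family that by simp
  have XS: "S.expandable p (\<lambda>\<pi> j. X \<pi> j \<bullet> b)" and X'S: "S.expandable p (\<lambda>\<pi> j. X' \<pi> j \<bullet> b)"
    if "b \<in> Basis" for b
    using family that by simp_all
  define defect where "defect b \<pi> =
      (\<Sum>i=1..stages tab. weight tab i * (X \<pi> (Inl i) \<bullet> b + X' \<pi> (Inl i) \<bullet> b)) -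
        integral {0..1} (\<lambda>\<tau>. X \<pi> (Inr \<tau>) \<bullet> b + X' \<pi> (Inr \<tau>) \<bullet> b)" for b \<pi>
  have "\<exists>C. \<forall>\<pi>\<in>?P. \<bar>defect b \<pi>\<bar> \<le> C * (case \<pi> of (u, t, h) \<Rightarrow> h) ^ p" if "b \<in> Basis" for b
    using S.expandable_quadrature[OF order S.add[OF XS[OF that] X'S[OF that]]]
    by (simp only: defect_def)
  then obtain C where C: "\<forall>b\<in>Basis. \<forall>\<pi>\<in>?P. \<bar>defect b \<pi>\<bar> \<le> C b * (case \<pi> of (u, t, h) \<Rightarrow> h) ^ p"
    using bchoice[of Basis "\<lambda>b C. \<forall>\<pi>\<in>?P. \<bar>defect b \<pi>\<bar> \<le> C * (case \<pi> of (u, t, h) \<Rightarrow> h) ^ p"]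
    by blast
  have err: "norm (u + h *\<^sub>R (\<Sum>i=1..stages tab. weight tab i *\<^sub>R (k (u, t, h) i + k' (u, t, h) i)) -
      picard \<phi> h t u (Suc p) 1) \<le> sum C Basis * h ^ Suc p" if \<pi>: "(u, t, h) \<in> ?P" for u t h
  proof -
    let ?f = "\<lambda>\<sigma>. \<phi> (picard \<phi> h t u p \<sigma>) (t + \<sigma> * h)"
    let ?s = "\<Sum>i=1..stages tab. weight tab i *\<^sub>R (k (u, t, h) i + k' (u, t, h) i)"
    have "\<bar>(?s - integral {0..1} ?f) \<bullet> b\<bar> \<le> C b * h ^ p" if b: "b \<in> Basis" for b
    proof -
      have "integral {0..1} ?f \<bullet> b = integral {0..1} (\<lambda>\<sigma>. ?f \<sigma> \<bullet> b)"
        using integral_linear[OF integrable_continuous_real[OF picard(3)[OF \<pi>, where m = p]]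
            bounded_linear_inner_left[of b]]
        by (simp add: o_def)
      also have "\<dots> = integral {0..1} (\<lambda>\<tau>. X (u, t, h) (Inr \<tau>) \<bullet> b + X' (u, t, h) (Inr \<tau>) \<bullet> b)"
        using X\<tau>[OF \<pi>] by (intro integral_cong) (auto simp flip: inner_add_left)
      finally have "(?s - integral {0..1} ?f) \<bullet> b = defect b (u, t, h)"
        using Xi[OF \<pi>] by (simp add: defect_def inner_diff_left inner_sum_left inner_add_left)
      then show ?thesis using C[rule_format, OF b \<pi>] by simp
    qed
    then have "norm (?s - integral {0..1} ?f) \<le> (\<Sum>b\<in>Basis. C b * h ^ p)"
      by (intro order_trans[OF norm_le_l1] sum_mono) auto
    then have "h * norm (?s - integral {0..1} ?f) \<le> h * (sum C Basis * h ^ p)"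
      using P(2)[OF \<pi>] by (intro mult_left_mono) (auto simp: sum_distrib_right)
    moreover have "u + h *\<^sub>R ?s - picard \<phi> h t u (Suc p) 1 = h *\<^sub>R (?s - integral {0..1} ?f)"
      by (simp add: scaleR_diff_right)
    ultimately show ?thesis using P(2)[OF \<pi>] by (simp add: mult_ac)
  qed
  show ?thesis
    using h1 h1'(1) eqs err by (intro exI[of _ h1] exI[of _ "sum C Basis"]) blast
qed

end

section \<open>Global error\<close>

text \<open>Each iteration contracts by h * \<Lambda>, which leaves h * B * (h * \<Lambda>) ^ m of
  the deviation of the constant iterate. The error at the left end point re-enters every time; its
  amplification remains 1 + O(h), as the global recursion needs. The Lipschitz condition is used
  only against the exact solution.\<close>

lemma picard_error:
  fixes \<phi> :: "'n::finite vec_field"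
  assumes deriv: "\<And>s. s \<in> {0..T} \<Longrightarrow> (y has_vector_derivative \<phi> (y s) s) (at s within {0..T})"
    and lip: "\<And>w s. s \<in> {0..T} \<Longrightarrow> norm (w - y s) \<le> \<epsilon> \<Longrightarrow> norm (\<phi> w s - \<phi> (y s) s) \<le> \<Lambda> * norm (w - y s)"
    and bound: "\<And>s. s \<in> {0..T} \<Longrightarrow> norm (\<phi> (y s) s) \<le> B"
    and cont: "\<And>m. continuous_on {0..1} (\<lambda>\<sigma>. \<phi> (picard \<phi> h t u m \<sigma>) (t + \<sigma> * h))"
    and near: "\<And>m \<tau>. \<tau> \<in> {0..1} \<Longrightarrow> norm (picard \<phi> h t u m \<tau> - u) \<le> h * B"
    and h: "0 < h" and t: "0 \<le> t" "t + h \<le> T" and B: "0 \<le> B" and \<Lambda>: "0 \<le> \<Lambda>" "h * \<Lambda> \<le> 1"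
    and small: "norm (u - y t) + 2 * (h * B) \<le> \<epsilon>" and \<tau>: "\<tau> \<in> {0..1}"
  shows "norm (picard \<phi> h t u m \<tau> - y (t + \<tau> * h)) \<le>
    norm (u - y t) * (1 + real m * (h * \<Lambda>)) + h * B * (h * \<Lambda>) ^ m"
proof -
  have time: "t + \<sigma> * h \<in> {0..T}" if "\<sigma> \<in> {0..1}" for \<sigma>
  proof -
    have "\<sigma> * h \<le> 1 * h" "0 \<le> \<sigma> * h"
      using that h by (auto intro!: mult_right_mono simp del: mult_1)
    then show ?thesis using t by auto
  qed
  have exact: "((\<lambda>\<sigma>. h *\<^sub>R \<phi> (y (t + \<sigma> * h)) (t + \<sigma> * h)) has_integral (y (t + \<tau> * h) - y t)) {0..\<tau>}"
    if \<tau>: "\<tau> \<in> {0..1}" for \<tau>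
  proof -
    have "((\<lambda>\<sigma>. h *\<^sub>R \<phi> (y (t + \<sigma> * h)) (t + \<sigma> * h)) has_integral (y (t + \<tau> * h) - y (t + 0 * h))) {0..\<tau>}"
    proof (rule fundamental_theorem_of_calculus)
      fix \<sigma> assume \<sigma>: "\<sigma> \<in> {0..\<tau>}"
      then have "t + \<sigma> * h \<in> {0..T}" using time \<tau> by auto
      have sub: "(\<lambda>\<sigma>. t + \<sigma> * h) ` {0..\<tau>} \<subseteq> {0..T}" using time \<tau> by auto
      have "((\<lambda>\<sigma>. t + \<sigma> * h) has_vector_derivative h) (at \<sigma> within {0..\<tau>})"
        by (auto intro!: derivative_eq_intros simp: has_real_derivative_iff_has_vector_derivative[symmetric])
      from vector_diff_chain_within[OF this
          has_vector_derivative_within_subset[OF deriv[OF \<open>t + \<sigma> * h \<in> {0..T}\<close>] sub]]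
      show "((\<lambda>\<sigma>. y (t + \<sigma> * h)) has_vector_derivative h *\<^sub>R \<phi> (y (t + \<sigma> * h)) (t + \<sigma> * h))
          (at \<sigma> within {0..\<tau>})"
        by (simp add: o_def)
    qed (use \<tau> in auto)
    then show ?thesis by simp
  qed
  have y_near: "norm (y (t + \<tau> * h) - y t) \<le> h * B" if \<tau>: "\<tau> \<in> {0..1}" for \<tau>
  proof -
    have "norm (y (t + \<tau> * h) - y t) \<le> h * B * measure lborel (cbox 0 \<tau>)"
    proof (rule has_integral_bound)
      show "((\<lambda>\<sigma>. h *\<^sub>R \<phi> (y (t + \<sigma> * h)) (t + \<sigma> * h)) has_integral (y (t + \<tau> * h) - y t)) (cbox 0 \<tau>)"
        using exact[OF \<tau>] by simp
    qed (use h B bound time \<tau> in auto)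
    also have "\<dots> \<le> h * B * 1" using \<tau> h B by (intro mult_left_mono) auto
    finally show ?thesis by simp
  qed
  \<comment> \<open>Iterate and solution each move by at most \<open>h * B\<close> during the step,
    hence the term \<open>2 * (h * B)\<close> in \<open>small\<close>.\<close>
  have tube: "norm (picard \<phi> h t u m \<tau> - y (t + \<tau> * h)) \<le> \<epsilon>" if \<tau>: "\<tau> \<in> {0..1}" for m \<tau>
  proof -
    have "picard \<phi> h t u m \<tau> - y (t + \<tau> * h) =
        (picard \<phi> h t u m \<tau> - u) + (u - y t) - (y (t + \<tau> * h) - y t)" by simp
    then have "norm (picard \<phi> h t u m \<tau> - y (t + \<tau> * h)) \<le>
        norm (picard \<phi> h t u m \<tau> - u) + norm (u - y t) + norm (y (t + \<tau> * h) - y t)"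
      by (metis (no_types) norm_triangle_ineq4 norm_triangle_ineq order_trans add_right_mono)
    then show ?thesis using near[OF \<tau>, of m] y_near[OF \<tau>] small by linarith
  qed
  let ?e = "norm (u - y t)" and ?q = "h * \<Lambda>"
  have q: "0 \<le> ?q" using h \<Lambda> by simp
  show ?thesis
    using \<tau>
  proof (induction m arbitrary: \<tau>)
    case 0
    have "norm (u - y (t + \<tau> * h)) \<le> ?e + norm (y (t + \<tau> * h) - y t)"
      using norm_triangle_ineq4[of "u - y t" "y (t + \<tau> * h) - y t"] by simp
    then show ?case using y_near[OF 0] by simp
  next
    case (Suc m)
    let ?pic = "\<lambda>\<sigma>. \<phi> (picard \<phi> h t u m \<sigma>) (t + \<sigma> * h)"
    let ?a = "?e * (1 + real m * ?q) + h * B * ?q ^ m"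
    have a0: "0 \<le> ?a" using q h B \<Lambda>(1) by (intro add_nonneg_nonneg mult_nonneg_nonneg) auto
    have "?pic integrable_on {0..\<tau>}"
      by (rule integrable_continuous_real, rule continuous_on_subset[OF cont]) (use Suc.prems in auto)
    then have "((\<lambda>\<sigma>. h *\<^sub>R ?pic \<sigma>) has_integral (picard \<phi> h t u (Suc m) \<tau> - u)) {0..\<tau>}"
      by (auto intro!: has_integral_cmul integrable_integral)
    then have diff: "((\<lambda>\<sigma>. h *\<^sub>R ?pic \<sigma> - h *\<^sub>R \<phi> (y (t + \<sigma> * h)) (t + \<sigma> * h)) has_integral
        (picard \<phi> h t u (Suc m) \<tau> - u - (y (t + \<tau> * h) - y t))) (cbox 0 \<tau>)"
      using has_integral_diff[OF _ exact[OF Suc.prems]] by (simp only: box_real)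
    have "norm (picard \<phi> h t u (Suc m) \<tau> - u - (y (t + \<tau> * h) - y t)) \<le> ?q * ?a * measure lborel (cbox 0 \<tau>)"
    proof (rule has_integral_bound[OF _ diff])
      show "0 \<le> ?q * ?a" using q a0 by simp
      fix \<sigma> assume "\<sigma> \<in> cbox 0 \<tau>"
      then have \<sigma>: "\<sigma> \<in> {0..1}" using Suc.prems by auto
      have "norm (?pic \<sigma> - \<phi> (y (t + \<sigma> * h)) (t + \<sigma> * h)) \<le> \<Lambda> * norm (picard \<phi> h t u m \<sigma> - y (t + \<sigma> * h))"
        by (rule lip[OF time[OF \<sigma>] tube[OF \<sigma>]])
      also have "\<dots> \<le> \<Lambda> * ?a" using Suc.IH[OF \<sigma>] \<Lambda>(1) by (rule mult_left_mono)
      finally have "h * norm (?pic \<sigma> - \<phi> (y (t + \<sigma> * h)) (t + \<sigma> * h)) \<le> h * (\<Lambda> * ?a)"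
        using h by simp
      then show "norm (h *\<^sub>R ?pic \<sigma> - h *\<^sub>R \<phi> (y (t + \<sigma> * h)) (t + \<sigma> * h)) \<le> ?q * ?a"
        using h by (simp add: mult.assoc flip: scaleR_diff_right)
    qed
    also have "\<dots> \<le> ?q * ?a * 1"
      using Suc.prems by (intro mult_left_mono mult_nonneg_nonneg[OF q a0]) auto
    finally have "norm (picard \<phi> h t u (Suc m) \<tau> - u - (y (t + \<tau> * h) - y t)) \<le> ?q * ?a" by simp
    moreover have "picard \<phi> h t u (Suc m) \<tau> - y (t + \<tau> * h) =
        (u - y t) + (picard \<phi> h t u (Suc m) \<tau> - u - (y (t + \<tau> * h) - y t))" by simp
    ultimately have "norm (picard \<phi> h t u (Suc m) \<tau> - y (t + \<tau> * h)) \<le> ?e + ?q * ?a"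
      using norm_triangle_ineq[of "u - y t" "picard \<phi> h t u (Suc m) \<tau> - u - (y (t + \<tau> * h) - y t)"]
      by (simp del: picard.simps)
    moreover have "?e + ?q * ?a \<le> ?e * (1 + real (Suc m) * ?q) + h * B * ?q ^ Suc m"
    proof -
      \<comment> \<open>Since \<open>h * \<Lambda> \<le> 1\<close>, the square is absorbed and the
        factor stays linear in the number of iterations.\<close>
      have "real m * (?q * ?q) \<le> real m * (?q * 1)"
        using q \<Lambda>(2) by (intro mult_left_mono) auto
      then have "?e * (?q + real m * (?q * ?q)) \<le> ?e * (?q + real m * ?q)"
        by (intro mult_left_mono) auto
      then show ?thesis by (simp add: algebra_simps)
    qed
    ultimately show ?case by linarith
  qed
qed

text \<open>The bound solves the recursion with equality and zero start: the local error is C * h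
  times h ^ p, which exactly restores the summand -1.\<close>

lemma discrete_Gronwall:
  fixes e :: "nat \<Rightarrow> real"
  assumes "0 \<le> C" and "0 \<le> h" and "e 0 \<le> 0"
    and "\<And>n. n < N \<Longrightarrow> e (Suc n) \<le> (1 + C * h) * e n + C * h ^ Suc p" and "n \<le> N"
  shows "e n \<le> ((1 + C * h) ^ n - 1) * h ^ p"
  using assms(5)
proof (induction n)
  case (Suc n)
  have "e (Suc n) \<le> (1 + C * h) * e n + C * h ^ Suc p"
    using assms(4) Suc.prems by simp
  also have "\<dots> \<le> (1 + C * h) * (((1 + C * h) ^ n - 1) * h ^ p) + C * h ^ Suc p"
    using Suc assms(1,2) by (intro add_right_mono mult_left_mono) auto
  also have "\<dots> = ((1 + C * h) ^ Suc n - 1) * h ^ p"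
    by (simp add: algebra_simps)
  finally show ?case .
qed (use assms in simp)

lemma power_exp_bound:
  fixes C h :: real
  assumes "0 \<le> C" and "0 \<le> h" and "real n * h \<le> T"
  shows "(1 + C * h) ^ n \<le> exp (C * T)"
proof -
  have "(1 + C * h) ^ n \<le> exp (C * h) ^ n"
    using assms by (intro power_mono exp_ge_add_one_self) (simp add: add_nonneg_nonneg)
  also have "\<dots> = exp (C * (real n * h))" by (simp add: exp_of_nat_mult[symmetric] mult_ac)
  also have "\<dots> \<le> exp (C * T)" using assms by (simp add: mult_left_mono)
  finally show ?thesis .
qed

text \<open>The way back to the algorithm: \<theta> > 0 permits recovering the slope as the quotient
  (\<eta> - d) / \<theta>, and the bounds by \<open>\<rho>\<close> place each evaluation inside the
  domains.\<close>

lemma (in simex_increment) simex_step_stages: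
  assumes incr: "\<And>r u \<theta> t. (r, u, \<theta>, t) \<in> box_domain \<rho> K \<theta>0 T \<Longrightarrow>
      \<F> r u \<theta> t g = Some (r + \<theta> *\<^sub>R \<Psi> (r, u, \<theta>, t))"
    and U: "\<And>r. norm r \<le> \<rho> \<Longrightarrow> r \<in> U" and Y: "\<And>r u. u \<in> K \<Longrightarrow> norm r \<le> \<rho> \<Longrightarrow> u + r \<in> Y"
    and "\<theta>0 \<le> \<theta>M" and u: "u \<in> K" and h: "0 < h" "h * \<gamma> \<le> \<theta>0" and t: "0 \<le> t" "t + h \<le> T"
    and eqs: "stage_equations tab \<rho> f g \<Psi> h t u (stages tab) k k'"
  shows "simex_step tab T \<theta>M U Y \<F> f g h t u
    (u + h *\<^sub>R (\<Sum>i=1..stages tab. weight tab i *\<^sub>R (k i + k' i)))"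
  unfolding simex_step_def
proof (intro conjI; (rule exI[of _ k], rule exI[of _ k'], intro conjI ballI refl)?)
  show "u \<in> Y" using Y[OF u, of 0] pos by simp
  show "t \<in> {0..T}" using t h by simp
  show "k 1 = g u t" "k' 1 = f u t" using eqs by (simp_all add: stage_equations_def)
next
  fix i assume i: "i \<in> {2..stages tab}"
  let ?\<theta> = "h * \<gamma>" and ?t = "t + node tab i * h"
  obtain r \<eta> where
    r: "r = h *\<^sub>R (\<Sum>j=1..<i. impl tab i j *\<^sub>R k j + expl tab i j *\<^sub>R k' j) + ?\<theta> *\<^sub>R k 1"
    and \<eta>: "\<eta> = r + ?\<theta> *\<^sub>R \<Psi> (r, u, ?\<theta>, ?t)" and n: "norm r \<le> \<rho>" "norm \<eta> \<le> \<rho>"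
    and k: "k i = k 1 + \<Psi> (r, u, ?\<theta>, ?t)" "k' i = f (u + \<eta>) ?t + g (u + \<eta>) ?t - k i"
    using bspec[OF conjunct2[OF conjunct2[OF eqs[unfolded stage_equations_def]]] i] by blast
  define d where "d = h *\<^sub>R (\<Sum>j=1..<i. impl tab i j *\<^sub>R k j + expl tab i j *\<^sub>R k' j)"
  have \<theta>: "0 < ?\<theta>" using h \<gamma>_pos by simp
  have "0 \<le> node tab i * h" "node tab i * h \<le> 1 * h"
    using nodes[of i] i h by (auto intro: mult_right_mono)
  then have time: "?t \<in> {0..T}" using t by auto
  have dr: "d + ?\<theta> *\<^sub>R k 1 = r" by (simp add: d_def r)
  have F: "\<F> (d + ?\<theta> *\<^sub>R k 1) u ?\<theta> ?t g = Some \<eta>"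
    unfolding dr \<eta> by (rule incr[OF in_domain[OF n(1) u _ time]]) (use \<theta> h in simp)
  have "\<eta> - d = ?\<theta> *\<^sub>R k i" unfolding \<eta> k(1) using dr by (simp add: algebra_simps)
  moreover have "inverse ?\<theta> * ?\<theta> = 1" using h(1) \<gamma>_pos by (intro left_inverse) simp
  ultimately have "k i = (\<eta> - d) /\<^sub>R ?\<theta>" by (simp only: scaleR_scaleR scaleR_one)
  then show "\<exists>d \<eta>. d = h *\<^sub>R (\<Sum>j=1..<i. impl tab i j *\<^sub>R k j + expl tab i j *\<^sub>R k' j) \<and>
      d + ?\<theta> *\<^sub>R k 1 \<in> U \<and> ?\<theta> \<in> {0..\<theta>M} \<and> ?t \<in> {0..T} \<and>
      \<F> (d + ?\<theta> *\<^sub>R k 1) u ?\<theta> ?t g = Some \<eta> \<and> u + \<eta> \<in> Y \<and> k i = (\<eta> - d) /\<^sub>R ?\<theta> \<and>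
      k' i = f (u + \<eta>) ?t + g (u + \<eta>) ?t - k i"
    using time F k(2) U[OF n(1)] Y[OF u n(2)] \<theta> h(2) assms(4) dr
    by (intro exI[of _ d] exI[of _ \<eta>] conjI) (simp_all add: d_def)
qed

section \<open>Propagation of the error along the grid\<close>

theorem theorem4p2:
  fixes tab :: imex_tableau
    and p :: nat
    and T \<theta>M \<theta>B :: real
    and U V Y :: "(real ^ 'n::finite) set"
    and \<F> :: "'n step_filter"
    and f g :: "'n vec_field"
    and y :: "real \<Rightarrow> real ^ 'n"
  assumes "0 < T"
    and "1 \<le> p"
    and "imex_esdirk tab"
    and "\<And>i. i \<in> {1..stages tab} \<Longrightarrow> 0 \<le> node tab i \<and> node tab i \<le> 1"
    and "imex_order tab p"
    and "implicit_step_filter p T \<theta>M U V Y \<theta>B \<F> g"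
    and "C_upto p (Y \<times> {0..T}) (\<lambda>(u, t). f u t)"
    and "C_upto p (Y \<times> {0..T}) (\<lambda>(u, t). g u t)"
    and "\<And>t. t \<in> {0..T} \<Longrightarrow> y t \<in> Y"
    and "\<And>t. t \<in> {0..T} \<Longrightarrow>
           (y has_vector_derivative f (y t) t + g (y t) t) (at t within {0..T})"
    and "\<exists>W L. open W \<and> (\<forall>t\<in>{0..T}. (y t, t) \<in> W) \<and>
           L-lipschitz_on (W \<inter> (Y \<times> {0..T})) (\<lambda>(u, t). f u t) \<and>
           L-lipschitz_on (W \<inter> (Y \<times> {0..T})) (\<lambda>(u, t). g u t)"
  shows "simex_converges tab T \<theta>M U Y \<F> f g y p"
proof -
  note filter = assms(6)
  note sol = assms(10)
  obtain W L where W: "open W" "\<And>t. t \<in> {0..T} \<Longrightarrow> (y t, t) \<in> W"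
    and Lf: "L-lipschitz_on (W \<inter> (Y \<times> {0..T})) (\<lambda>(u, t). f u t)"
    and Lg: "L-lipschitz_on (W \<inter> (Y \<times> {0..T})) (\<lambda>(u, t). g u t)"
    using assms(11) by blast
  have L0: "0 \<le> L" using Lf by (rule lipschitz_on_nonneg)
  have y_cont: "continuous_on {0..T} y"
    using sol by (intro continuous_on_vector_derivative) auto
  have "compact ((\<lambda>t. (y t, t)) ` {0..T})"
    using y_cont by (intro compact_continuous_image continuous_intros) auto
  moreover have "open (W \<inter> (Y \<times> UNIV))"
    using W(1) implicit_step_filterD(2)[OF filter] by (intro open_Int open_Times) auto
  moreover have "(\<lambda>t. (y t, t)) ` {0..T} \<subseteq> W \<inter> (Y \<times> UNIV)"
    using W(2) assms(9) by auto
  \<comment> \<open>The trajectory is compact, so a tube of uniform radius fits into the Lipschitz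
    neighbourhood over \<open>Y\<close>.\<close>
  ultimately obtain \<epsilon> where \<epsilon>: "0 < \<epsilon>"
    "(\<Union>z\<in>(\<lambda>t. (y t, t)) ` {0..T}. cball z \<epsilon>) \<subseteq> W \<inter> (Y \<times> UNIV)"
    by (rule compact_subset_open_imp_cball_epsilon_subset)
  have tube: "(w, s) \<in> W" "w \<in> Y" if "s \<in> {0..T}" "norm (w - y s) \<le> \<epsilon>" for w s
  proof -
    have "(w, s) \<in> cball (y s, s) \<epsilon>"
      using that(2) by (simp add: dist_Pair_Pair dist_norm norm_minus_commute)
    then have "(w, s) \<in> W \<inter> (Y \<times> UNIV)" using \<epsilon>(2) that(1) by blast
    then show "(w, s) \<in> W" "w \<in> Y" by auto
  qed
  define \<phi> where "\<phi> = (\<lambda>u t. f u t + g u t)"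
  define \<Lambda> where "\<Lambda> = 2 * L"
  have lip: "norm (\<phi> w s - \<phi> (y s) s) \<le> \<Lambda> * norm (w - y s)"
    if "s \<in> {0..T}" "norm (w - y s) \<le> \<epsilon>" for w s
  proof -
    have "(w, s) \<in> W \<inter> (Y \<times> {0..T})" "(y s, s) \<in> W \<inter> (Y \<times> {0..T})"
      using tube[OF that] that(1) W(2) assms(9) by auto
    from lipschitz_onD[OF Lf this] lipschitz_onD[OF Lg this]
    have "norm (f w s - f (y s) s) \<le> L * norm (w - y s)" "norm (g w s - g (y s) s) \<le> L * norm (w - y s)"
      by (simp_all add: dist_norm dist_Pair_Pair)
    moreover have "\<phi> w s - \<phi> (y s) s = (f w s - f (y s) s) + (g w s - g (y s) s)"
      by (simp add: \<phi>_def)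
    ultimately show ?thesis
      using norm_triangle_ineq[of "f w s - f (y s) s" "g w s - g (y s) s"]
      by (simp add: \<Lambda>_def)
  qed
  \<comment> \<open>Half of the tube is for base points; the other half is left for displacements
    from them.\<close>
  define K where "K = {a + b |a b. a \<in> y ` {0..T} \<and> b \<in> cball 0 (\<epsilon> / 2)}"
  have K: "compact K"
    unfolding K_def using y_cont by (intro compact_sums compact_continuous_image) auto
  have K_mem: "u \<in> K" if "t \<in> {0..T}" "norm (u - y t) \<le> \<epsilon> / 2" for u t
    unfolding K_def using that by (intro CollectI exI[of _ "y t"] exI[of _ "u - y t"]) auto
  obtain e where e: "0 < e" "cball 0 e \<subseteq> U"
    using implicit_step_filterD(1,3)[OF filter] by (meson open_contains_cball)
  \<comment> \<open>Division by the dimension converts a bound on the coordinates into one on the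
    norm. \<open>e\<close> keeps the box in \<open>U\<close>, and \<epsilon> / 2 keeps displaced
    base points in \<open>Y\<close>.\<close>
  define \<rho> where "\<rho> = min e (\<epsilon> / 2) / real CARD('n)"
  have \<rho>: "0 < \<rho>" using e \<epsilon> by (simp add: \<rho>_def)
  have box: "norm r \<le> e" "norm r \<le> \<epsilon> / 2" if "\<forall>b\<in>Basis. \<bar>r \<bullet> b\<bar> \<le> \<rho>" for r :: "real ^ 'n"
    using box_norm_le[OF that] by (simp_all add: \<rho>_def)
  have box': "\<forall>b\<in>Basis. \<bar>r \<bullet> b\<bar> \<le> \<rho>" if "norm r \<le> \<rho>" for r :: "real ^ 'n"
    using that by (auto intro: order_trans[OF Basis_le_norm])
  have box_U: "r \<in> U" if "\<forall>b\<in>Basis. \<bar>r \<bullet> b\<bar> \<le> \<rho>" for r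
    using box[OF that] e(2) by auto
  have box_Y: "u + r \<in> Y" if u: "u \<in> K" and r: "\<forall>b\<in>Basis. \<bar>r \<bullet> b\<bar> \<le> \<rho>" for u r
  proof -
    obtain t b where t: "t \<in> {0..T}" "b \<in> cball 0 (\<epsilon> / 2)" "u = y t + b"
      using u unfolding K_def by blast
    then show ?thesis
      using tube(2)[OF t(1), of "u + r"] box(2)[OF r] norm_triangle_ineq[of b r] by simp
  qed
  have K_Y: "K \<subseteq> Y" using box_Y[of _ 0] \<rho> by auto
  have \<theta>B: "0 < \<theta>B" "\<theta>B \<le> \<theta>M" using implicit_step_filterD(4,5)[OF filter] .
  obtain \<Psi> where \<Psi>: "\<And>m. m \<le> p \<Longrightarrow> smooth_along (box_domain \<rho> K \<theta>B T) directions m \<Psi>"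
    "\<And>r u \<theta> t. (r, u, \<theta>, t) \<in> box_domain \<rho> K \<theta>B T \<Longrightarrow>
      \<F> r u \<theta> t g = Some (r + \<theta> *\<^sub>R \<Psi> (r, u, \<theta>, t))"
    "\<And>u \<theta> t. (0, u, \<theta>, t) \<in> box_domain \<rho> K \<theta>B T \<Longrightarrow> 0 < \<theta> \<Longrightarrow> \<Psi> (0, u, \<theta>, t) = 0"
    using filter_increment[OF filter assms(1) \<rho> \<theta>B(1) order_refl K_Y box_U] by blast
  interpret simex_increment tab p T \<rho> \<theta>B K f g \<Psi>
  proof
    show "smooth_along (box_domain \<rho> K \<theta>B T) directions m (\<lambda>(r, u, \<theta>, t). f (u + r) t)" if "m \<le> p" for m
      by (rule smooth_along_field[OF assms(1) \<rho> that assms(7) box_Y])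
    show "smooth_along (box_domain \<rho> K \<theta>B T) directions m (\<lambda>(r, u, \<theta>, t). g (u + r) t)" if "m \<le> p" for m
      by (rule smooth_along_field[OF assms(1) \<rho> that assms(8) box_Y])
  qed (use assms \<rho> \<theta>B K \<Psi> in auto)
  obtain h1 C1 where h1: "0 < h1" "h1 \<le> 1" "h1 * \<gamma> \<le> \<theta>B"
    and loc: "\<And>u t h. (u, t, h) \<in> parameters h1 \<Longrightarrow>
      \<exists>k k'. stage_equations tab \<rho> f g \<Psi> h t u (stages tab) k k' \<and>
        norm (u + h *\<^sub>R (\<Sum>i=1..stages tab. weight tab i *\<^sub>R (k i + k' i)) - picard \<phi> h t u (Suc p) 1)
          \<le> C1 * h ^ Suc p"
    using local_error unfolding \<phi>_def by blast
  obtain B0 where B0: "0 < B0"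
    "\<And>r u t. norm r \<le> \<rho> \<Longrightarrow> u \<in> K \<Longrightarrow> t \<in> {0..T} \<Longrightarrow> norm (f (u + r) t) \<le> B0"
    "\<And>r u t. norm r \<le> \<rho> \<Longrightarrow> u \<in> K \<Longrightarrow> t \<in> {0..T} \<Longrightarrow> norm (g (u + r) t) \<le> B0"
    by (rule bounds) (rule that; assumption)
  define B where "B = 2 * B0"
  have B: "0 < B" using B0(1) by (simp add: B_def)
  have \<phi>B: "norm (\<phi> (u + r) t) \<le> B" if "norm r \<le> \<rho>" "u \<in> K" "t \<in> {0..T}" for u r t
    using B0(2)[OF that] B0(3)[OF that] norm_triangle_ineq[of "f (u + r) t" "g (u + r) t"]
    by (simp add: B_def \<phi>_def)
  \<comment> \<open>One constant for the whole recursion: the amplification by iterate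
    \<open>Suc p\<close>, and the local error plus the Picard error, whose power h ^ (p + 2) is
    weakened to h ^ (p + 1).\<close>
  define C where "C = max 1 (max (real (Suc p) * \<Lambda>) (\<bar>C1\<bar> + B * \<Lambda> ^ Suc p))"
  have C: "1 \<le> C" "real (Suc p) * \<Lambda> \<le> C" "\<bar>C1\<bar> + B * \<Lambda> ^ Suc p \<le> C"
    unfolding C_def by auto
  define E where "E = exp (C * T)"
  have E: "0 < E" by (simp add: E_def)
  have \<Lambda>: "0 \<le> \<Lambda>" using L0 by (simp add: \<Lambda>_def)
  \<comment> \<open>In turn: validity of the local bound, \<open>h * \<Lambda> \<le> 1\<close>,
    Picard iterates within \<open>\<rho>\<close>, two moves by \<open>h * B\<close> within
    \<epsilon> / 2, and a global error of at most \<epsilon> / 2. The denominator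
    \<open>\<Lambda> + 1\<close> is never zero.\<close>
  define h0 where "h0 = min h1 (min (1 / (\<Lambda> + 1)) (min (\<rho> / B) (min (\<epsilon> / (4 * B)) (\<epsilon> / (2 * E)))))"
  have h0: "0 < h0"
    unfolding h0_def using h1 \<Lambda> \<rho> B \<epsilon> E by simp
  have small: "h \<le> h1" "h * \<Lambda> \<le> 1" "h * B \<le> \<rho>" "4 * (h * B) \<le> \<epsilon>" "2 * (E * h) \<le> \<epsilon>" "h \<le> 1"
    if "0 < h" "h \<le> h0" for h
  proof -
    have h: "h \<le> h1" "h \<le> 1 / (\<Lambda> + 1)" "h \<le> \<rho> / B" "h \<le> \<epsilon> / (4 * B)" "h \<le> \<epsilon> / (2 * E)"
      using that(2) unfolding h0_def by auto
    show "h \<le> h1" "h \<le> 1" using h(1) h1 by auto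
    have "h * \<Lambda> + h \<le> 1" using h(2) \<Lambda> by (simp add: field_simps)
    then show "h * \<Lambda> \<le> 1" using that(1) by simp
    show "h * B \<le> \<rho>" "4 * (h * B) \<le> \<epsilon>" "2 * (E * h) \<le> \<epsilon>"
      using h(3-5) B E by (simp_all add: field_simps)
  qed
  have step: "\<exists>w. simex_step tab T \<theta>M U Y \<F> f g h t u w \<and>
      norm (w - y (t + h)) \<le> (1 + C * h) * norm (u - y t) + C * h ^ Suc p"
    if h: "0 < h" "h \<le> h0" and t: "0 \<le> t" "t + h \<le> T" and u: "norm (u - y t) \<le> \<epsilon> / 2" for h t u
  proof -
    note small = small[OF h]
    have tT: "t \<in> {0..T}" using h t by simp
    have uK: "u \<in> K" using K_mem[OF tT u] .
    have "(u, t, h) \<in> parameters h1" using uK h t small by (simp add: parameters_def)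
    then obtain k k' where eqs: "stage_equations tab \<rho> f g \<Psi> h t u (stages tab) k k'"
      and err: "norm (u + h *\<^sub>R (\<Sum>i=1..stages tab. weight tab i *\<^sub>R (k i + k' i)) - picard \<phi> h t u (Suc p) 1)
          \<le> C1 * h ^ Suc p"
      using loc by blast
    let ?w = "u + h *\<^sub>R (\<Sum>i=1..stages tab. weight tab i *\<^sub>R (k i + k' i))"
    have "h * \<gamma> \<le> h1 * \<gamma>" using small(1) \<gamma>_pos by (intro mult_right_mono) auto
    then have "h * \<gamma> \<le> \<theta>B" using h1(3) by linarith
    then have "simex_step tab T \<theta>M U Y \<F> f g h t u ?w"
      using \<Psi>(2) box_U box_Y box' \<theta>B(2) uK h(1) t eqs by (intro simex_step_stages) auto
    have cont: "continuous_on (cball 0 \<rho> \<times> {0..T}) (\<lambda>(v, s). \<phi> (u + v) s)"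
      using continuous_field[OF uK] by (simp add: \<phi>_def)
    have yB: "norm (\<phi> (y s) s) \<le> B" if "s \<in> {0..T}" for s
      using \<phi>B[of 0 "y s" s] K_mem[OF that, of "y s"] \<rho> \<epsilon>(1) that by simp
    note pp = picard_properties[OF cont \<phi>B[OF _ uK] h(1) less_imp_le[OF B] small(3) t]
    have "norm (picard \<phi> h t u (Suc p) 1 - y (t + 1 * h)) \<le>
        norm (u - y t) * (1 + real (Suc p) * (h * \<Lambda>)) + h * B * (h * \<Lambda>) ^ Suc p"
    proof (rule picard_error)
      show "(y has_vector_derivative \<phi> (y s) s) (at s within {0..T})" if "s \<in> {0..T}" for s
        using sol[OF that] by (simp add: \<phi>_def)
      show "norm (u - y t) + 2 * (h * B) \<le> \<epsilon>" using u small(4) by linarith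
    qed (use lip yB pp(2,3) h(1) t B \<Lambda> small(2) in auto)
    then have "norm (picard \<phi> h t u (Suc p) 1 - y (t + h)) \<le>
        norm (u - y t) * (1 + real (Suc p) * (h * \<Lambda>)) + h * B * (h * \<Lambda>) ^ Suc p"
      by (simp only: mult_1)
    from norm_diff_triangle_le[OF err this]
    have "norm (?w - y (t + h)) \<le> C1 * h ^ Suc p +
        (norm (u - y t) * (1 + real (Suc p) * (h * \<Lambda>)) + h * B * (h * \<Lambda>) ^ Suc p)" .
    moreover have "norm (u - y t) * (1 + real (Suc p) * (h * \<Lambda>)) \<le> (1 + C * h) * norm (u - y t)"
    proof -
      have "(real (Suc p) * \<Lambda>) * h \<le> C * h" using C(2) h(1) by (intro mult_right_mono) auto
      then have "norm (u - y t) * (1 + real (Suc p) * (h * \<Lambda>)) \<le> norm (u - y t) * (1 + C * h)"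
        by (intro mult_left_mono) (auto simp: mult_ac)
      then show ?thesis by (simp only: mult.commute)
    qed
    moreover have "h * B * (h * \<Lambda>) ^ Suc p \<le> B * \<Lambda> ^ Suc p * h ^ Suc p"
    proof -
      have "h * (B * \<Lambda> ^ Suc p * h ^ Suc p) \<le> 1 * (B * \<Lambda> ^ Suc p * h ^ Suc p)"
        using small(6) h(1) B \<Lambda> by (intro mult_right_mono) auto
      then show ?thesis by (simp add: power_mult_distrib mult_ac)
    qed
    moreover have "C1 * h ^ Suc p + B * \<Lambda> ^ Suc p * h ^ Suc p \<le> C * h ^ Suc p"
      unfolding distrib_right[symmetric] using C(3) h(1) by (intro mult_right_mono) auto
    ultimately have "norm (?w - y (t + h)) \<le> (1 + C * h) * norm (u - y t) + C * h ^ Suc p"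
      by linarith
    with \<open>simex_step tab T \<theta>M U Y \<F> f g h t u ?w\<close> show ?thesis by blast
  qed
  have "\<exists>u. u 0 = y 0 \<and>
      (\<forall>n<M. simex_step tab T \<theta>M U Y \<F> f g h (real n * h) (u n) (u (Suc n))) \<and>
      (\<forall>n\<le>M. norm (u n - y (real n * h)) \<le> E * h ^ p)"
    if M: "0 < M" and hM: "h = T / real M" and h_le: "h \<le> h0" for M :: nat and h
  proof -
    have h: "0 < h" using assms(1) M hM by simp
    have nT: "real n * h \<le> T" if "n \<le> M" for n
      using that M assms(1) by (simp add: hM field_simps)
    \<comment> \<open>The choice makes the step a total function; by uniqueness it picks the step
      that has the error bound.\<close>
    define u where "u = rec_nat (y 0) (\<lambda>n v. SOME w. simex_step tab T \<theta>M U Y \<F> f g h (real n * h) v w)"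
    have step': "simex_step tab T \<theta>M U Y \<F> f g h (real n * h) (u n) (u (Suc n)) \<and>
        norm (u (Suc n) - y (real (Suc n) * h)) \<le> (1 + C * h) * norm (u n - y (real n * h)) + C * h ^ Suc p"
      if n: "n < M" and near: "norm (u n - y (real n * h)) \<le> \<epsilon> / 2" for n
    proof -
      have t: "0 \<le> real n * h" "real n * h + h \<le> T"
        using h nT[of "Suc n"] n by (simp_all add: algebra_simps)
      obtain w where w: "simex_step tab T \<theta>M U Y \<F> f g h (real n * h) (u n) w"
        "norm (w - y (real n * h + h)) \<le> (1 + C * h) * norm (u n - y (real n * h)) + C * h ^ Suc p"
        using step[OF h h_le t near] by blast
      have "u (Suc n) = (SOME w. simex_step tab T \<theta>M U Y \<F> f g h (real n * h) (u n) w)"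
        by (simp add: u_def)
      also have "\<dots> = w"
        using w(1) simex_step_unique by (intro some_equality) blast+
      finally show ?thesis using w by (simp add: algebra_simps)
    qed
    have small_err: "((1 + C * h) ^ n - 1) * h ^ p \<le> E * h ^ p" "E * h ^ p \<le> \<epsilon> / 2" if "n \<le> M" for n
    proof -
      have "(1 + C * h) ^ n \<le> E"
        unfolding E_def using C(1) h nT[OF that] by (intro power_exp_bound) auto
      then show "((1 + C * h) ^ n - 1) * h ^ p \<le> E * h ^ p"
        using h by (intro mult_right_mono) auto
      \<comment> \<open>Here \<open>1 \<le> p\<close> enters: the global error is at most E * h and
        so stays within the half tube.\<close>
      have "h ^ p \<le> h ^ 1"
        using small(6)[OF h h_le] h assms(2) by (intro power_decreasing) auto
      then have "E * h ^ p \<le> E * h" using E by simp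
      then show "E * h ^ p \<le> \<epsilon> / 2" using small(5)[OF h h_le] by linarith
    qed
    have err: "norm (u n - y (real n * h)) \<le> ((1 + C * h) ^ n - 1) * h ^ p" if "n \<le> M" for n
      using that
    \<comment> \<open>The recursion is valid only while the error is at most \<epsilon> / 2. The
      bounds at all smaller indices ensure this, so the Gronwall estimate is applied anew up to each
      \<open>n\<close>.\<close>
    proof (induction n rule: less_induct)
      case (less n)
      show ?case
      proof (rule discrete_Gronwall[where N = n and e = "\<lambda>n. norm (u n - y (real n * h))"])
        fix m assume m: "m < n"
        then have "norm (u m - y (real m * h)) \<le> \<epsilon> / 2"
          using less.IH[OF m] small_err[of m] less.prems by simp
        then show "norm (u (Suc m) - y (real (Suc m) * h)) \<le>
            (1 + C * h) * norm (u m - y (real m * h)) + C * h ^ Suc p"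
          using step'[of m] m less.prems by simp
      qed (use C h in \<open>auto simp: u_def\<close>)
    qed
    show ?thesis
    proof (intro exI[of _ u] conjI allI impI)
      show "u 0 = y 0" by (simp add: u_def)
      show "simex_step tab T \<theta>M U Y \<F> f g h (real n * h) (u n) (u (Suc n))" if "n < M" for n
        using step'[OF that] err[of n] small_err[of n] that by simp
      show "norm (u n - y (real n * h)) \<le> E * h ^ p" if "n \<le> M" for n
        using err[OF that] small_err(1)[OF that] by simp
    qed
  qed
  then show ?thesis
    unfolding simex_converges_def using E h0 by blast
qed

end
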